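(* Let $\alpha\in(1,2]$ and let $Y$ be the $\alpha$-stable continuous state branching process. Then $Y$ is a positive self-similar Markov process with self-similarity index $\alpha-1$. Moreover, its pssMp-Lamperti representation under $\mathbb{P}_x$, $x>0$, is $$Y_t=x\exp\big\{\xi_{h(tx^{-(\alpha-1)})}\big\},\qquad 0\le t\le x^{\alpha-1}\int_0^\infty \exp\{(\alpha-1)\xi_u\}\,du,$$ where $$h(t)=\inf\Big\{s\ge 0:\int_0^s\exp\{(\alpha-1)\xi_u\}\,du>t\Big\}$$ and $\xi$ is the Lévy process underlying the spectrally positive $\alpha$-stable process killed on first entering $(-\infty,0]$.
   Context: A positive self-similar Markov process (pssMp) with index $\beta>0$ is a positive Markov process with càdlàg paths such that for all $k>0$ the law of $(kX_{k^{-\beta}t},t\ge0)$ under the law started from $x$ is the law started from $kx$. Its pssMp-Lamperti representation is: started from $x>0$ and up to the first hitting time of $0$, $X_t=x\exp\{\eta_{\zeta(tx^{-\beta})}\}$, where $\eta$ is a (possibly killed) Lévy process started from $0$ whose law does not depend on $x$ (the underlying Lévy process) and $\zeta$ is the right inverse of $s\mapsto\int_0^s e^{\beta\eta_u}du$. Under $\mathbb{P}_x$, $X$ is a spectrally positive $\alpha$-stable Lévy process started at $x$, $\alpha\in(1,2]$, with $\mathbb{E}_0(e^{-\lambda X_t})=e^{t\psi(\lambda)}$, $\psi(\lambda)=c_+\lambda^\alpha$, $\lambda\ge0$, $c_+>0$ (and $c_+=1/2$ if $\alpha=2$). Let $\tau_0^-=\inf\{t>0:X_t\le0\}$. The $\alpha$-stable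 CB-process is $Y_t=X_{\theta(t)}$, where $\theta(t)=\inf\{s\ge0:A_s>t\}$ and $A_t=\int_0^t ds/X_s$ for $t<\tau_0^-$; $Y$ is absorbed at $0$ at time $T_0^-=\inf\{t>0:Y_t=0\}$. The killed process $X_t\mathbf{1}_{\{t<\tau_0^-\}}$ is a pssMp of index $\alpha$; $\xi$ denotes its underlying Lévy process. It is spectrally positive, starts from $0$, drifts to $-\infty$, and satisfies $E(e^{-\lambda\xi_t})=e^{t\Psi(\lambda)}$ with $\Psi(\lambda)=m\frac{\Gamma(\lambda+\alpha)}{\Gamma(\lambda)\Gamma(\alpha)}$, $\lambda\ge0$, $m=-E(\xi_1)\in(0,\infty)$; for $\alpha=2$, $\xi_t=B_t-t/2$ with $B$ a standard Brownian motion. At the right endpoint of the time interval, $h=\infty$ and the exponential is read as $0$ ($\xi_\infty=-\infty$). *)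

theory Defs
  imports "HOL-Probability.Probability"
begin

text \<open>
  Processes are functions of type \<open>real \<Rightarrow> 'a \<Rightarrow> real\<close> (time first); only times \<open>t \<ge> 0\<close>
  are relevant. A family of laws is a function \<open>P :: real \<Rightarrow> 'a measure\<close>, where \<open>P x\<close> governs
  the process started from \<open>x\<close>. Infima of times are taken in \<^typ>\<open>ereal\<close>, so that the infimum
  of the empty set is \<open>\<infinity>\<close>.
\<close>

section \<open>Paths and laws\<close>

definition cadlag :: "(real \<Rightarrow> real) \<Rightarrow> bool" where
  "cadlag f \<longleftrightarrow> (\<forall>t\<ge>0. (f \<longlongrightarrow> f t) (at_right t)) \<and> (\<forall>t>0. \<exists>l. (f \<longlongrightarrow> l) (at_left t))"

definition no_negative_jumps :: "(real \<Rightarrow> real) \<Rightarrow> bool" where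
  "no_negative_jumps f \<longleftrightarrow> (\<forall>t>0. \<forall>l. (f \<longlongrightarrow> l) (at_left t) \<longrightarrow> l \<le> f t)"

definition process_law :: "'a measure \<Rightarrow> (real \<Rightarrow> 'a \<Rightarrow> real) \<Rightarrow> (real \<Rightarrow> real) measure" where
  "process_law M Z = distr M (\<Pi>\<^sub>M t\<in>{0..}. borel) (\<lambda>\<omega>. \<lambda>t\<in>{0..}. Z t \<omega>)"

definition history :: "'a measure \<Rightarrow> (real \<Rightarrow> 'a \<Rightarrow> real) \<Rightarrow> real \<Rightarrow> 'a measure" where
  "history M Z t =
     sigma (space M) {Z u -` B \<inter> space M | u B. 0 \<le> u \<and> u \<le> t \<and> B \<in> sets borel}"

section \<open>Levy processes\<close>

definition levy_process :: "'a measure \<Rightarrow> (real \<Rightarrow> 'a \<Rightarrow> real) \<Rightarrow> real \<Rightarrow> bool" where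
  "levy_process M Z x \<longleftrightarrow>
     prob_space M \<and>
     (\<forall>t\<ge>0. Z t \<in> borel_measurable M) \<and>
     (AE \<omega> in M. Z 0 \<omega> = x) \<and>
     (AE \<omega> in M. cadlag (\<lambda>t. Z t \<omega>)) \<and>
     (\<forall>(t :: nat \<Rightarrow> real) n. 0 \<le> t 0 \<and> mono t \<longrightarrow>
        prob_space.indep_vars M (\<lambda>_. borel) (\<lambda>i \<omega>. Z (t (Suc i)) \<omega> - Z (t i) \<omega>) {..<n}) \<and>
     (\<forall>s\<ge>0. \<forall>t\<ge>0. distr M borel (\<lambda>\<omega>. Z (s + t) \<omega> - Z s \<omega>)
                  = distr M borel (\<lambda>\<omega>. Z t \<omega> - Z 0 \<omega>))"

definition spectrally_positive_stable ::
    "'a measure \<Rightarrow> (real \<Rightarrow> 'a \<Rightarrow> real) \<Rightarrow> real \<Rightarrow> real \<Rightarrow> real \<Rightarrow> bool" where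
  "spectrally_positive_stable M X x \<alpha> c \<longleftrightarrow>
     levy_process M X x \<and>
     (AE \<omega> in M. no_negative_jumps (\<lambda>t. X t \<omega>)) \<and>
     (\<forall>k>0. \<forall>t\<ge>0. distr M borel (\<lambda>\<omega>. X (k * t) \<omega> - x)
                  = distr M borel (\<lambda>\<omega>. k powr (1 / \<alpha>) * (X t \<omega> - x))) \<and>
     (\<forall>t\<ge>0. \<forall>q\<ge>0. integrable M (\<lambda>\<omega>. exp (- q * (X t \<omega> - x))) \<and>
        (\<integral>\<omega>. exp (- q * (X t \<omega> - x)) \<partial>M) = exp (t * (c * q powr \<alpha>)))"

section \<open>Positive self-similar Markov processes\<close>

text \<open>The transition function of a Markov family is read off from the family itself:
  \<open>p\<^sub>s(y, B) = P\<^sub>y(Z\<^sub>s \<in> B)\<close>.\<close>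

definition markov_family :: "real set \<Rightarrow> (real \<Rightarrow> 'a measure) \<Rightarrow> (real \<Rightarrow> 'a \<Rightarrow> real) \<Rightarrow> bool" where
  "markov_family S P Z \<longleftrightarrow>
     (\<forall>x\<in>S. prob_space (P x) \<and> (\<forall>t\<ge>0. Z t \<in> borel_measurable (P x)) \<and>
        (AE \<omega> in P x. Z 0 \<omega> = x) \<and> (AE \<omega> in P x. \<forall>t\<ge>0. Z t \<omega> \<in> S)) \<and>
     (\<forall>t\<ge>0. \<forall>B\<in>sets borel.
        (\<lambda>x. measure (P x) {\<omega> \<in> space (P x). Z t \<omega> \<in> B})
          \<in> borel_measurable (restrict_space borel S)) \<and>
     (\<forall>x\<in>S. \<forall>s\<ge>0. \<forall>t\<ge>0. \<forall>B\<in>sets borel. AE \<omega> in P x.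
        real_cond_exp (P x) (history (P x) Z t) (\<lambda>\<omega>'. indicator B (Z (t + s) \<omega>')) \<omega>
          = measure (P (Z t \<omega>)) {\<omega>' \<in> space (P (Z t \<omega>)). Z s \<omega>' \<in> B})"

definition pssMp :: "(real \<Rightarrow> 'a measure) \<Rightarrow> (real \<Rightarrow> 'a \<Rightarrow> real) \<Rightarrow> real \<Rightarrow> bool" where
  "pssMp P Z \<beta> \<longleftrightarrow>
     0 < \<beta> \<and> markov_family {0..} P Z \<and>
     (\<forall>x\<ge>0. AE \<omega> in P x. cadlag (\<lambda>t. Z t \<omega>)) \<and>
     (\<forall>k>0. \<forall>x\<ge>0. process_law (P x) (\<lambda>t \<omega>. k * Z (k powr (- \<beta>) * t) \<omega>)
                   = process_law (P (k * x)) Z)"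

section \<open>The Lamperti representation\<close>

definition exp_functional :: "real \<Rightarrow> (real \<Rightarrow> real) \<Rightarrow> real set \<Rightarrow> ennreal" where
  "exp_functional \<beta> f A = (\<integral>\<^sup>+u\<in>A. ennreal (exp (\<beta> * f u)) \<partial>lborel)"

definition lamperti_clock :: "real \<Rightarrow> (real \<Rightarrow> real) \<Rightarrow> real \<Rightarrow> ereal" where
  "lamperti_clock \<beta> f t = Inf {ereal s | s. 0 \<le> s \<and> ennreal t < exp_functional \<beta> f {0..s}}"

text \<open>\<open>exp (f h)\<close> with the convention \<open>f \<infinity> = -\<infinity>\<close>, \<open>exp (-\<infinity>) = 0\<close>.\<close>

definition exp_path_at :: "(real \<Rightarrow> real) \<Rightarrow> ereal \<Rightarrow> real" where
  "exp_path_at f h = (if h = \<infinity> then 0 else exp (f (real_of_ereal h)))"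

definition hitting_time_zero :: "(real \<Rightarrow> real) \<Rightarrow> ereal" where
  "hitting_time_zero f = Inf {ereal t | t. 0 < t \<and> f t = 0}"

text \<open>Only underlying Levy processes \<open>\<eta>\<close> with infinite lifetime (no killing) are considered.\<close>

definition lamperti_representation ::
    "(real \<Rightarrow> 'a measure) \<Rightarrow> (real \<Rightarrow> 'a \<Rightarrow> real) \<Rightarrow> real \<Rightarrow> (real \<Rightarrow> 'a \<Rightarrow> real) \<Rightarrow> bool" where
  "lamperti_representation P Z \<beta> \<eta> \<longleftrightarrow>
     (\<forall>x>0. levy_process (P x) \<eta> 0) \<and>
     (\<forall>x>0. \<forall>y>0. process_law (P x) \<eta> = process_law (P y) \<eta>) \<and>
     (\<forall>x>0. AE \<omega> in P x. \<forall>t\<ge>0. ereal t \<le> hitting_time_zero (\<lambda>u. Z u \<omega>) \<longrightarrow>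
        Z t \<omega> = x * exp_path_at (\<lambda>u. \<eta> u \<omega>)
                      (lamperti_clock \<beta> (\<lambda>u. \<eta> u \<omega>) (t * x powr (- \<beta>))))"

section \<open>The killed process and the continuous state branching process\<close>

definition passage_time :: "(real \<Rightarrow> 'a \<Rightarrow> real) \<Rightarrow> 'a \<Rightarrow> ereal" where
  "passage_time X \<omega> = Inf {ereal t | t. 0 < t \<and> X t \<omega> \<le> 0}"

definition killed :: "(real \<Rightarrow> 'a \<Rightarrow> real) \<Rightarrow> real \<Rightarrow> 'a \<Rightarrow> real" where
  "killed X t \<omega> = (if ereal t < passage_time X \<omega> then X t \<omega> else 0)"

definition cb_additive :: "(real \<Rightarrow> 'a \<Rightarrow> real) \<Rightarrow> 'a \<Rightarrow> real \<Rightarrow> ennreal" where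
  "cb_additive X \<omega> t = (\<integral>\<^sup>+s\<in>{0..t}. ennreal (1 / X s \<omega>) \<partial>lborel)"

text \<open>\<open>cb_additive\<close> is used before the passage time only. If it does not exceed \<open>t\<close> there, then
  \<open>cb_clock X \<omega> t = \<infinity>\<close>, and the time-changed process is put to \<open>0\<close>.\<close>

definition cb_clock :: "(real \<Rightarrow> 'a \<Rightarrow> real) \<Rightarrow> 'a \<Rightarrow> real \<Rightarrow> ereal" where
  "cb_clock X \<omega> t =
     Inf {ereal s | s. 0 \<le> s \<and> ereal s < passage_time X \<omega> \<and> ennreal t < cb_additive X \<omega> s}"

definition cb_time_change :: "(real \<Rightarrow> 'a \<Rightarrow> real) \<Rightarrow> real \<Rightarrow> 'a \<Rightarrow> real" where
  "cb_time_change X t \<omega> =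
     (if cb_clock X \<omega> t = \<infinity> then 0 else X (real_of_ereal (cb_clock X \<omega> t)) \<omega>)"

definition cb_process :: "(real \<Rightarrow> 'a \<Rightarrow> real) \<Rightarrow> real \<Rightarrow> 'a \<Rightarrow> real" where
  "cb_process X t \<omega> =
     (if \<exists>s. 0 \<le> s \<and> s \<le> t \<and> cb_time_change X s \<omega> = 0 then 0 else cb_time_change X t \<omega>)"

end

theory Submission
  imports Defs
begin

text \<open>Let \<open>\<beta> = \<alpha> - 1\<close>. Substituting the Lamperti representation of the killed process into
  \<open>A\<^sub>t = \<integral>\<^sub>0\<^sup>t ds / X\<^sub>s\<close> turns this functional into \<open>x\<^sup>\<beta> \<integral>\<^sub>0\<^sup>v exp (\<beta> \<xi>\<^sub>u) du\<close>, where
  \<open>t = x\<^sup>\<alpha> \<integral>\<^sub>0\<^sup>v exp (\<alpha> \<xi>\<^sub>u) du\<close>. Inverting it shows that, path by path, \<open>Y\<close> is the Lamperti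
  transform of \<open>\<xi>\<close> of index \<open>\<beta>\<close>. All remaining claims are then claims about such transforms:
  self-similarity holds because the law of \<open>\<xi>\<close> does not depend on \<open>x\<close>, and the Markov property
  of \<open>Y\<close> is the strong Markov property of \<open>\<xi>\<close> at the time \<open>h\<close> at which its clock reaches
  \<open>t x\<^sup>-\<^sup>\<beta>\<close>. Under \<open>P\<^sub>0\<close> the process vanishes identically, whether or not the passage
  time is \<open>0\<close>.\<close>

section \<open>Right-continuous paths\<close>

text \<open>Two obstacles shape the development. The law of \<xi> lives on the product sigma-algebra
  over uncountably many times, where evaluation at a random time and the clock need not be
  measurable; hence the transform is defined through a dyadic regularisation of the path, which
  makes it measurable on all paths and agrees with the intended one on cadlag paths. Moreover, the
  Markov property is demanded for the history of \<open>Y\<close>, not of \<xi>: each event of that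
  history is almost surely an event about the transform up to time t, which is fixed by \<xi> up to
  h. Independence of the later increments of \<xi> therefore settles the case of finite h; for
  infinite h the process has already been absorbed in 0. Since \<open>Y\<close> equals a measurable
  functional of \<xi> only almost surely, its own measurability rests on completeness of the
  measures. The drift of \<xi> to minus infinity supplies the left limit of \<open>Y\<close> at
  absorption, a finite time before which all of [0, infinity) is run through by \<xi>.\<close>

definition dyadic_succ :: "nat \<Rightarrow> real \<Rightarrow> real" where
  "dyadic_succ n u = (real (nat \<lfloor>2 ^ n * u\<rfloor>) + 1) / 2 ^ n"

lemma dyadic_succ_gt: "0 \<le> u \<Longrightarrow> u < dyadic_succ n u"
  unfolding dyadic_succ_def by (simp add: pos_less_divide_eq mult.commute)

lemma dyadic_succ_le: "0 \<le> u \<Longrightarrow> dyadic_succ n u \<le> u + 1 / 2 ^ n"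
  unfolding dyadic_succ_def by (simp add: field_simps)

lemma dyadic_succ_nonneg: "0 \<le> dyadic_succ n u"
  unfolding dyadic_succ_def by simp

text \<open>The strict inequality in \<open>dyadic_succ_gt\<close> is what places the approximants
  in \<open>at_right u\<close>, the filter along which right-continuity speaks.\<close>

lemma filterlim_dyadic_succ:
  assumes "0 \<le> u"
  shows "filterlim (\<lambda>n. dyadic_succ n u) (at_right u) sequentially"
proof -
  have "(\<lambda>n. (1/2::real) ^ n) \<longlonglongrightarrow> 0"
    by (rule LIMSEQ_power_zero) auto
  then have "(\<lambda>n. u + (1/2) ^ n) \<longlonglongrightarrow> u + 0"
    by (rule tendsto_add[OF tendsto_const])
  then have *: "(\<lambda>n. u + 1 / 2 ^ n) \<longlonglongrightarrow> u"
    by (simp add: power_divide)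
  have "(\<lambda>n. dyadic_succ n u) \<longlonglongrightarrow> u"
    by (rule tendsto_sandwich[OF _ _ tendsto_const *])
       (use assms dyadic_succ_gt dyadic_succ_le in \<open>auto intro!: always_eventually less_imp_le\<close>)
  then show ?thesis
    unfolding filterlim_at using dyadic_succ_gt[OF assms]
    by (auto intro!: always_eventually simp: less_imp_neq[THEN not_sym])
qed

text \<open>Evaluation of a path along dyadic times is jointly measurable in the path and the time,
  which evaluation itself is not; on right-continuous paths the two agree.\<close>

definition reg :: "(real \<Rightarrow> real) \<Rightarrow> real \<Rightarrow> real" where
  "reg w u = lim (\<lambda>n. w (dyadic_succ n u))"

lemma cadlagD_right: "cadlag w \<Longrightarrow> 0 \<le> t \<Longrightarrow> (w \<longlongrightarrow> w t) (at_right t)"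
  by (auto simp: cadlag_def)

lemma cadlagD_left: "cadlag w \<Longrightarrow> 0 < t \<Longrightarrow> \<exists>l. (w \<longlongrightarrow> l) (at_left t)"
  by (auto simp: cadlag_def)

lemma reg_eq:
  assumes "cadlag w" "0 \<le> u"
  shows "reg w u = w u"
proof -
  have "(\<lambda>n. w (dyadic_succ n u)) \<longlonglongrightarrow> w u"
    by (rule filterlim_compose[OF cadlagD_right[OF assms] filterlim_dyadic_succ[OF assms(2)]])
  then show ?thesis
    unfolding reg_def by (rule limI)
qed

text \<open>The dyadic successors of u are eventually below r because u < r is strict; at r itself
  \<open>reg\<close> would look beyond the common part of the two paths.\<close>

lemma reg_local:
  assumes "\<And>v. 0 \<le> v \<Longrightarrow> v \<le> r \<Longrightarrow> w1 v = w2 v" "0 \<le> u" "u < r"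
  shows "reg w1 u = reg w2 u"
proof -
  have "filterlim (\<lambda>n. dyadic_succ n u) (nhds u) sequentially"
    using filterlim_dyadic_succ[OF assms(2)] by (auto simp: filterlim_at)
  then have "eventually (\<lambda>n. dyadic_succ n u < r) sequentially"
    using assms(3) by (rule order_tendstoD(2))
  then have "eventually (\<lambda>n. w1 (dyadic_succ n u) = w2 (dyadic_succ n u)) sequentially"
    by eventually_elim (auto intro!: assms(1) dyadic_succ_nonneg)
  \<comment> \<open>Comparing all candidate limits L, rather than one, makes the two values of
    \<open>lim\<close> agree even when neither sequence converges.\<close>
  then have "((\<lambda>n. w1 (dyadic_succ n u)) \<longlonglongrightarrow> L) = ((\<lambda>n. w2 (dyadic_succ n u)) \<longlonglongrightarrow> L)" for L
    by (rule tendsto_cong)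
  then show ?thesis
    unfolding reg_def lim_def by simp
qed

text \<open>Holds for an arbitrary path: at each level n only countably many sample values of w
  occur.\<close>

lemma measurable_reg_path: "reg w \<in> borel_measurable borel"
proof -
  have "(\<lambda>u. w (dyadic_succ n u)) \<in> borel_measurable borel" for n
    unfolding dyadic_succ_def
    by (rule measurable_compose_countable[where f="\<lambda>i u. w ((real i + 1) / 2 ^ n)"]) measurable
  then show ?thesis
    unfolding reg_def[abs_def] by measurable
qed

abbreviation path_space :: "(real \<Rightarrow> real) measure" where
  "path_space \<equiv> \<Pi>\<^sub>M t\<in>{0..}. borel"

lemma measurable_reg[measurable]:
  "(\<lambda>p. reg (fst p) (snd p)) \<in> borel_measurable (path_space \<Otimes>\<^sub>M borel)"
proof -
  have "(\<lambda>p. fst p ((real i + 1) / 2 ^ n)) \<in> borel_measurable (path_space \<Otimes>\<^sub>M borel)" for n i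
    by (rule measurable_compose[OF measurable_fst measurable_component_singleton]) auto
  then have "(\<lambda>p. fst p (dyadic_succ n (snd p))) \<in> borel_measurable (path_space \<Otimes>\<^sub>M borel)" for n
    unfolding dyadic_succ_def
    by (rule measurable_compose_countable[where f="\<lambda>i p. fst p ((real i + 1) / 2 ^ n)"]) measurable
  then show ?thesis
    unfolding reg_def by measurable
qed

text \<open>Compactness by bisection: the one-sided limits bound the path near each point, and
  bounds on adjacent intervals combine.\<close>

lemma cadlag_bounded:
  assumes w: "cadlag w"
  shows "\<exists>C. \<forall>u\<in>{0..V}. \<bar>w u\<bar> \<le> C"
proof (cases "0 \<le> V")
  case False
  then have "{0..V} = {}" by simp
  then show ?thesis by simp
next
  case True
  \<comment> \<open>The clause \<open>0 \<le> u\<close> is there because the small intervals around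
    0 reach into negative times, about which \<open>cadlag\<close> says nothing.\<close>
  define Q where "Q a b \<longleftrightarrow> (\<exists>C. \<forall>u\<in>{a..b}. 0 \<le> u \<longrightarrow> \<bar>w u\<bar> \<le> C)" for a b
  have "Q 0 V"
    using True
  proof (rule Bolzano[where P=Q])
    fix a b c :: real assume "Q a b" "Q b c" "a \<le> b" "b \<le> c"
    then obtain C1 C2 where C: "\<forall>u\<in>{a..b}. 0 \<le> u \<longrightarrow> \<bar>w u\<bar> \<le> C1"
      "\<forall>u\<in>{b..c}. 0 \<le> u \<longrightarrow> \<bar>w u\<bar> \<le> C2"
      unfolding Q_def by blast
    show "Q a c"
      unfolding Q_def
    proof (intro exI ballI impI)
      fix u assume u: "u \<in> {a..c}" "0 \<le> u"
      show "\<bar>w u\<bar> \<le> max C1 C2"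
      proof (cases "u \<le> b")
        case True
        with C(1) u have "\<bar>w u\<bar> \<le> C1" by simp
        then show ?thesis by simp
      next
        case False
        with C(2) u have "\<bar>w u\<bar> \<le> C2" by simp
        then show ?thesis by simp
      qed
    qed
  next
    fix x assume local: "0 \<le> x" "x \<le> V"
    have "eventually (\<lambda>y. \<bar>w y - w x\<bar> < 1) (at_right x)"
      using tendstoD[OF cadlagD_right[OF w local(1)], of 1] by (simp add: dist_real_def)
    then obtain b where b: "b > x" "\<And>y. x < y \<Longrightarrow> y < b \<Longrightarrow> \<bar>w y - w x\<bar> < 1"
      unfolding eventually_at_right_field by auto
    obtain a l where a: "a < x" "\<And>y. a < y \<Longrightarrow> y < x \<Longrightarrow> 0 \<le> y \<Longrightarrow> \<bar>w y - l\<bar> < 1"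
    proof (cases "x = 0")
      case True
      \<comment> \<open>There is no left limit at 0, and none is needed: no nonnegative time lies to
        the left, so any a and l serve.\<close>
      then show ?thesis by (intro that[of "-1" 0]) auto
    next
      case False
      with local obtain l where "(w \<longlongrightarrow> l) (at_left x)"
        using cadlagD_left[OF w, of x] by auto
      from tendstoD[OF this, of 1] have "eventually (\<lambda>y. \<bar>w y - l\<bar> < 1) (at_left x)"
        by (simp add: dist_real_def)
      then show ?thesis
        unfolding eventually_at_left_field using that by metis
    qed
    show "\<exists>d>0. \<forall>p q. p \<le> x \<and> x \<le> q \<and> q - p < d \<longrightarrow> Q p q"
    proof (intro exI[of _ "min (x - a) (b - x)"] conjI allI impI)
      show "0 < min (x - a) (b - x)" using a b by auto
    next
      fix p q assume pq: "p \<le> x \<and> x \<le> q \<and> q - p < min (x - a) (b - x)"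
      show "Q p q"
        unfolding Q_def
      proof (intro exI ballI impI)
        fix u assume u: "u \<in> {p..q}" "0 \<le> u"
        consider "u < x" | "u = x" | "u > x" by linarith
        then show "\<bar>w u\<bar> \<le> 1 + \<bar>w x\<bar> + \<bar>l\<bar>"
        proof cases
          case 1
          with u pq have "\<bar>w u - l\<bar> < 1" by (intro a) auto
          then show ?thesis by linarith
        next
          case 3
          with u pq have "\<bar>w u - w x\<bar> < 1" by (intro b) auto
          then show ?thesis by linarith
        qed auto
      qed
    qed
  qed
  then obtain C where "\<And>u. u \<in> {0..V} \<Longrightarrow> 0 \<le> u \<Longrightarrow> \<bar>w u\<bar> \<le> C"
    unfolding Q_def by blast
  then show ?thesis by (intro exI[of _ C]) simp
qed

section \<open>The clock of the Lamperti transformation\<close>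

text \<open>Real-valued form of the clock; on cadlag paths \<open>enn2real\<close> loses nothing, by
  \<open>exp_functional_eq_clock_integral\<close>.\<close>

definition clock_integral :: "real \<Rightarrow> (real \<Rightarrow> real) \<Rightarrow> real \<Rightarrow> real" where
  "clock_integral \<beta> w s = enn2real (exp_functional \<beta> w {0..s})"

text \<open>On nonnegative times w may be replaced by \<open>reg w\<close>; its values at negative
  times are unconstrained, hence the condition on A.\<close>

lemma measurable_exp_path:
  assumes "cadlag w" "A \<in> sets borel" "A \<subseteq> {0..}"
  shows "(\<lambda>u. ennreal (exp (\<beta> * w u)) * indicator A u) \<in> borel_measurable borel"
proof -
  note [measurable] = measurable_reg_path assms(2)
  have "(\<lambda>u. ennreal (exp (\<beta> * w u)) * indicator A u) =
        (\<lambda>u. ennreal (exp (\<beta> * reg w u)) * indicator A u)"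
    using assms by (auto simp: fun_eq_iff reg_eq indicator_def)
  then show ?thesis by simp
qed

lemma exp_functional_split:
  assumes "cadlag w" "0 \<le> a" "a \<le> b"
  shows "exp_functional \<beta> w {0..b} = exp_functional \<beta> w {0..a} + exp_functional \<beta> w {a<..b}"
proof -
  have "exp_functional \<beta> w {0..b} =
      (\<integral>\<^sup>+u. ennreal (exp (\<beta> * w u)) * indicator {0..a} u
           + ennreal (exp (\<beta> * w u)) * indicator {a<..b} u \<partial>lborel)"
    unfolding exp_functional_def using assms
    by (intro nn_integral_cong) (auto simp: indicator_def)
  also have "\<dots> = exp_functional \<beta> w {0..a} + exp_functional \<beta> w {a<..b}"
    unfolding exp_functional_def using assms
    by (intro nn_integral_add) (auto intro!: measurable_exp_path)
  finally show ?thesis .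
qed

lemma exp_functional_increment_bounds:
  assumes "\<And>u. a < u \<Longrightarrow> u \<le> b \<Longrightarrow> \<bar>\<beta> * w u\<bar> \<le> C" "a \<le> b"
  shows "ennreal (exp (- C) * (b - a)) \<le> exp_functional \<beta> w {a<..b}"
    and "exp_functional \<beta> w {a<..b} \<le> ennreal (exp C * (b - a))"
proof -
  have c: "(\<integral>\<^sup>+u. ennreal c * indicator {a<..b} u \<partial>lborel) = ennreal (c * (b - a))" if "0 \<le> c" for c
    using assms(2) that by (subst nn_integral_cmult_indicator) (auto simp: ennreal_mult)
  have *: "- C \<le> \<beta> * w u" "\<beta> * w u \<le> C" if "a < u" "u \<le> b" for u
    using assms(1)[OF that] by auto
  show "ennreal (exp (- C) * (b - a)) \<le> exp_functional \<beta> w {a<..b}"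
    unfolding exp_functional_def
    by (subst c[symmetric]) (auto intro!: nn_integral_mono ennreal_leI * split: split_indicator)
  show "exp_functional \<beta> w {a<..b} \<le> ennreal (exp C * (b - a))"
    unfolding exp_functional_def
    by (subst c[symmetric]) (auto intro!: nn_integral_mono ennreal_leI * split: split_indicator)
qed

lemma exp_functional_at_0: "exp_functional \<beta> w {0..0} = 0"
  unfolding exp_functional_def by (auto intro!: nn_integral_0_iff_AE[THEN iffD2] AE_I[of _ _ "{0}"])

lemma exp_functional_less_top:
  assumes "cadlag w"
  shows "exp_functional \<beta> w {0..s} < \<infinity>"
proof (cases "0 \<le> s")
  case False
  then have "{0..s} = {}" by simp
  then show ?thesis by (simp add: exp_functional_def)
next
  case True
  obtain C where C: "\<And>u. 0 \<le> u \<Longrightarrow> u \<le> s \<Longrightarrow> \<bar>w u\<bar> \<le> C"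
    using cadlag_bounded[OF assms, of s] by (metis atLeastAtMost_iff)
  have "exp_functional \<beta> w {0<..s} \<le> ennreal (exp (\<bar>\<beta>\<bar> * C) * (s - 0))"
    using True C by (intro exp_functional_increment_bounds) (auto simp: abs_mult intro!: mult_left_mono)
  then show ?thesis
    using exp_functional_split[OF assms order_refl True] exp_functional_at_0
    by (simp add: order.strict_trans1)
qed

lemma exp_functional_eq_clock_integral:
  "cadlag w \<Longrightarrow> exp_functional \<beta> w {0..s} = ennreal (clock_integral \<beta> w s)"
  unfolding clock_integral_def using exp_functional_less_top[of w \<beta> s] by simp

lemma clock_integral_nonneg: "0 \<le> clock_integral \<beta> w s"
  unfolding clock_integral_def by simp

lemma clock_integral_0[simp]: "clock_integral \<beta> w 0 = 0"
  unfolding clock_integral_def exp_functional_at_0 by simp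

text \<open>A cadlag path is bounded on [0, V], so the integrand stays between two positive
  constants and the clock is bi-Lipschitz there. The lower constant yields strict monotonicity, the
  upper one continuity.\<close>

lemma clock_integral_increment_bounds:
  assumes w: "cadlag w"
  shows "\<exists>k K. 0 < k \<and> 0 \<le> K \<and> (\<forall>a b. 0 \<le> a \<and> a \<le> b \<and> b \<le> V \<longrightarrow>
    k * (b - a) \<le> clock_integral \<beta> w b - clock_integral \<beta> w a \<and>
    clock_integral \<beta> w b - clock_integral \<beta> w a \<le> K * (b - a))"
proof -
  obtain C where C: "\<And>u. 0 \<le> u \<Longrightarrow> u \<le> V \<Longrightarrow> \<bar>w u\<bar> \<le> C"
    using cadlag_bounded[OF w, of V] by (metis atLeastAtMost_iff)
  define D where "D = \<bar>\<beta>\<bar> * C"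
  have *: "exp (- D) * (b - a) \<le> clock_integral \<beta> w b - clock_integral \<beta> w a \<and>
    clock_integral \<beta> w b - clock_integral \<beta> w a \<le> exp D * (b - a)"
    if "0 \<le> a" "a \<le> b" "b \<le> V" for a b
  proof -
    define z where "z = clock_integral \<beta> w b - clock_integral \<beta> w a"
    have "\<bar>\<beta> * w u\<bar> \<le> D" if "a < u" "u \<le> b" for u
      using C \<open>0 \<le> a\<close> \<open>b \<le> V\<close> that by (auto simp: D_def abs_mult intro!: mult_left_mono)
    note bd = exp_functional_increment_bounds[where w=w and \<beta>=\<beta>, OF this \<open>a \<le> b\<close>]
    define y where "y = enn2real (exp_functional \<beta> w {a<..b})"
    have y: "exp_functional \<beta> w {a<..b} = ennreal y" "0 \<le> y"
      using order.strict_trans1[OF bd(2) ennreal_less_top] by (auto simp: y_def)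
    have "ennreal (clock_integral \<beta> w b) = ennreal (clock_integral \<beta> w a + y)"
      using exp_functional_split[OF w \<open>0 \<le> a\<close> \<open>a \<le> b\<close>, of \<beta>] y
      by (simp add: exp_functional_eq_clock_integral[OF w] clock_integral_nonneg)
    then have "clock_integral \<beta> w b = clock_integral \<beta> w a + y"
      by (subst (asm) ennreal_inj) (auto intro!: add_nonneg_nonneg clock_integral_nonneg y(2))
    then show ?thesis
      using bd y \<open>a \<le> b\<close> by simp
  qed
  show ?thesis
    by (rule exI[of _ "exp (- D)"], rule exI[of _ "exp D"]) (use * in auto)
qed

lemma clock_integral_strict_mono:
  assumes "cadlag w" "0 \<le> a" "a < b"
  shows "clock_integral \<beta> w a < clock_integral \<beta> w b"
proof -
  obtain k K where k: "0 < k" and bd: "\<forall>a' b'. 0 \<le> a' \<and> a' \<le> b' \<and> b' \<le> b \<longrightarrow>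
    k * (b' - a') \<le> clock_integral \<beta> w b' - clock_integral \<beta> w a' \<and>
    clock_integral \<beta> w b' - clock_integral \<beta> w a' \<le> K * (b' - a')"
    using clock_integral_increment_bounds[OF assms(1), of b \<beta>] by blast
  have "k * (b - a) \<le> clock_integral \<beta> w b - clock_integral \<beta> w a"
    using bd assms by auto
  moreover have "0 < k * (b - a)" using k assms by simp
  ultimately show ?thesis by linarith
qed

lemma clock_integral_less_iff:
  "cadlag w \<Longrightarrow> 0 \<le> a \<Longrightarrow> 0 \<le> b \<Longrightarrow> clock_integral \<beta> w a < clock_integral \<beta> w b \<longleftrightarrow> a < b"
  using clock_integral_strict_mono[of w a b \<beta>] clock_integral_strict_mono[of w b a \<beta>]
  by (metis less_asym linorder_neqE_linordered_idom)

lemma clock_integral_le_iff: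
  "cadlag w \<Longrightarrow> 0 \<le> a \<Longrightarrow> 0 \<le> b \<Longrightarrow> clock_integral \<beta> w a \<le> clock_integral \<beta> w b \<longleftrightarrow> a \<le> b"
  using clock_integral_less_iff[of w b a \<beta>] by (simp add: not_less[symmetric])

lemma continuous_on_clock_integral:
  assumes "cadlag w"
  shows "continuous_on {0..V} (clock_integral \<beta> w)"
proof -
  obtain k K where k: "0 \<le> K" "\<forall>a b. 0 \<le> a \<and> a \<le> b \<and> b \<le> V \<longrightarrow>
    k * (b - a) \<le> clock_integral \<beta> w b - clock_integral \<beta> w a \<and>
    clock_integral \<beta> w b - clock_integral \<beta> w a \<le> K * (b - a)"
    using clock_integral_increment_bounds[OF assms, of V \<beta>] by blast
  have bd: "clock_integral \<beta> w b - clock_integral \<beta> w a \<le> K * (b - a)"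
    if "0 \<le> a" "a \<le> b" "b \<le> V" for a b
    using k(2) that by blast
  have "K-lipschitz_on {0..V} (clock_integral \<beta> w)"
  proof (rule lipschitz_onI[OF _ k(1)])
    fix a b assume ab: "a \<in> {0..V}" "b \<in> {0..V}"
    show "dist (clock_integral \<beta> w a) (clock_integral \<beta> w b) \<le> K * dist a b"
    proof (cases "a \<le> b")
      case True
      then have "clock_integral \<beta> w a \<le> clock_integral \<beta> w b"
        using ab by (simp add: clock_integral_le_iff[OF assms])
      then show ?thesis using bd[of a b] ab True by (simp add: dist_real_def)
    next
      case False
      then have "clock_integral \<beta> w b \<le> clock_integral \<beta> w a"
        using ab by (simp add: clock_integral_le_iff[OF assms])
      then show ?thesis using bd[of b a] ab False by (simp add: dist_real_def)
    qed
  qed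
  then show ?thesis by (rule lipschitz_on_continuous_on)
qed

lemma clock_integral_ivt:
  assumes "cadlag w" "0 \<le> t" "0 \<le> s" "t \<le> clock_integral \<beta> w s"
  obtains v where "0 \<le> v" "v \<le> s" "clock_integral \<beta> w v = t"
  using IVT'[of "clock_integral \<beta> w" 0 t s] assms continuous_on_clock_integral[OF assms(1), of s \<beta>]
  by auto

text \<open>By the intermediate value theorem a time is either reached by the clock or exceeds all
  its values. The case \<open>infinite\<close> includes t equal to the total integral, which is
  approached but never attained.\<close>

lemma clock_integral_cases:
  assumes "cadlag w" "0 \<le> t"
  obtains (finite) v where "0 \<le> v" "clock_integral \<beta> w v = t"
  | (infinite) "\<And>s. 0 \<le> s \<Longrightarrow> clock_integral \<beta> w s < t"
proof (cases "\<exists>s\<ge>0. t \<le> clock_integral \<beta> w s")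
  case True
  then obtain s where "0 \<le> s" "t \<le> clock_integral \<beta> w s" by blast
  then show ?thesis using clock_integral_ivt[OF assms] finite by blast
next
  case False
  then show ?thesis using infinite not_less by blast
qed

text \<open>A right inverse of the clock K, read on a second time scale J. The infimum is not
  attained, since the inequality is strict, and is identified through the right limit of J. With J
  the identity it computes \<open>lamperti_clock\<close>; with J the time of the killed process it
  computes \<open>cb_clock\<close>.\<close>

lemma Inf_image_above:
  fixes v0 :: real
  assumes v0: "0 \<le> v0"
    and J: "(J \<longlongrightarrow> J v0) (at_right v0)" "\<And>v. v0 < v \<Longrightarrow> J v0 < (J v :: real)"
    and K: "\<And>v. 0 \<le> v \<Longrightarrow> K v0 < (K v :: real) \<longleftrightarrow> v0 < v"
  shows "Inf {ereal (J v) | v. 0 \<le> v \<and> K v0 < K v} = ereal (J v0)"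
proof (rule Inf_eqI)
  fix y assume "y \<in> {ereal (J v) | v. 0 \<le> v \<and> K v0 < K v}"
  then show "ereal (J v0) \<le> y" using J(2) K by (auto intro!: less_imp_le)
next
  fix y assume y: "\<And>i. i \<in> {ereal (J v) | v. 0 \<le> v \<and> K v0 < K v} \<Longrightarrow> y \<le> i"
  have "((\<lambda>v. ereal (J v)) \<longlongrightarrow> ereal (J v0)) (at_right v0)"
    using J(1) by simp
  moreover have "eventually (\<lambda>v. y \<le> ereal (J v)) (at_right v0)"
  proof (rule eventually_mono[OF eventually_at_right_less])
    fix v assume "v0 < v"
    then have "ereal (J v) \<in> {ereal (J v) | v. 0 \<le> v \<and> K v0 < K v}"
      using v0 K[of v] by auto
    then show "y \<le> ereal (J v)" by (rule y)
  qed
  ultimately show "y \<le> ereal (J v0)"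
    by (rule tendsto_lowerbound) simp
qed

lemma lamperti_clock_clock_integral:
  assumes "cadlag w" "0 \<le> v"
  shows "lamperti_clock \<beta> w (clock_integral \<beta> w v) = ereal v"
proof -
  have "lamperti_clock \<beta> w (clock_integral \<beta> w v) =
      Inf {ereal s | s. 0 \<le> s \<and> clock_integral \<beta> w v < clock_integral \<beta> w s}"
    unfolding lamperti_clock_def exp_functional_eq_clock_integral[OF assms(1)]
    by (simp add: ennreal_less_iff clock_integral_nonneg)
  also have "\<dots> = ereal v"
    using assms by (intro Inf_image_above[where J="\<lambda>v. v"]) (auto simp: clock_integral_less_iff)
  finally show ?thesis .
qed

text \<open>A non-strict bound suffices because the clock asks for strict excess over t; so the
  endpoint, where t is the total integral, already counts as absorbed.\<close>

lemma lamperti_clock_infinite: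
  assumes "cadlag w" "\<And>s. 0 \<le> s \<Longrightarrow> clock_integral \<beta> w s \<le> t"
  shows "lamperti_clock \<beta> w t = \<infinity>"
proof -
  have t: "0 \<le> t" using assms(2)[of 0] by simp
  have "{ereal s | s. 0 \<le> s \<and> ennreal t < exp_functional \<beta> w {0..s}} = {}"
    using assms(2) t by (auto simp: exp_functional_eq_clock_integral[OF assms(1)] ennreal_less_iff not_less)
  then show ?thesis
    unfolding lamperti_clock_def by (simp only: Inf_empty top_ereal_def)
qed

lemma exp_functional_cong:
  assumes "\<And>u. u \<in> A \<Longrightarrow> f u = g u"
  shows "exp_functional \<beta> f A = exp_functional \<beta> g A"
  unfolding exp_functional_def by (rule nn_integral_cong) (auto simp: assms indicator_def)

lemma lamperti_clock_cong:
  assumes "\<And>u. 0 \<le> u \<Longrightarrow> f u = g u"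
  shows "lamperti_clock \<beta> f t = lamperti_clock \<beta> g t"
proof -
  have "exp_functional \<beta> f {0..s} = exp_functional \<beta> g {0..s}" for s
    by (rule exp_functional_cong) (simp add: assms)
  then show ?thesis unfolding lamperti_clock_def by simp
qed

lemma lamperti_clock_nonneg: "0 \<le> lamperti_clock \<beta> f t"
  unfolding lamperti_clock_def by (rule Inf_greatest) auto

text \<open>The transform started from 1; a start x enters as
  \<open>x * lamperti_path \<beta> w (t * x powr (- \<beta>))\<close>. It is built from
  \<open>reg w\<close> so as to be measurable in w.\<close>

definition lamperti_path :: "real \<Rightarrow> (real \<Rightarrow> real) \<Rightarrow> real \<Rightarrow> real" where
  "lamperti_path \<beta> w t = exp_path_at (reg w) (lamperti_clock \<beta> (reg w) t)"

lemma exp_path_at_cong: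
  assumes "\<And>u. 0 \<le> u \<Longrightarrow> f u = g u" "0 \<le> h"
  shows "exp_path_at f h = exp_path_at g h"
  unfolding exp_path_at_def using assms by (simp add: real_of_ereal_pos)

lemma lamperti_path_eq:
  assumes "cadlag w"
  shows "lamperti_path \<beta> w t = exp_path_at w (lamperti_clock \<beta> w t)"
proof -
  have "lamperti_clock \<beta> (reg w) t = lamperti_clock \<beta> w t"
    by (rule lamperti_clock_cong) (rule reg_eq[OF assms])
  then show ?thesis
    unfolding lamperti_path_def
    using exp_path_at_cong[of "reg w" w, OF reg_eq[OF assms] lamperti_clock_nonneg] by simp
qed

lemma lamperti_path_clock_integral:
  "cadlag w \<Longrightarrow> 0 \<le> v \<Longrightarrow> lamperti_path \<beta> w (clock_integral \<beta> w v) = exp (w v)"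
  by (simp add: lamperti_path_eq lamperti_clock_clock_integral exp_path_at_def)

lemma lamperti_path_infinite:
  "cadlag w \<Longrightarrow> (\<And>s. 0 \<le> s \<Longrightarrow> clock_integral \<beta> w s \<le> t) \<Longrightarrow> lamperti_path \<beta> w t = 0"
  by (simp add: lamperti_path_eq lamperti_clock_infinite exp_path_at_def)

lemma lamperti_path_nonneg: "0 \<le> lamperti_path \<beta> w t"
  by (simp add: lamperti_path_def exp_path_at_def)

lemma reg_restrict[simp]: "reg (restrict w {0..}) = reg w"
  unfolding reg_def[abs_def] by (simp add: dyadic_succ_nonneg)

lemma lamperti_path_restrict[simp]: "lamperti_path \<beta> (restrict w {0..}) t = lamperti_path \<beta> w t"
  unfolding lamperti_path_def by simp

text \<open>This is optionality of the clock: whether it is below r, and then its value, depends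
  only on the path up to r, because all competing s below r integrate \<open>reg\<close> over times
  below r.\<close>

lemma lamperti_path_local:
  assumes eq: "\<And>v. 0 \<le> v \<Longrightarrow> v \<le> r \<Longrightarrow> w1 v = w2 v"
    and r: "lamperti_clock \<beta> (reg w1) t < ereal r"
  shows "lamperti_clock \<beta> (reg w2) t = lamperti_clock \<beta> (reg w1) t"
    and "lamperti_path \<beta> w2 t = lamperti_path \<beta> w1 t"
proof -
  have reg: "reg w1 u = reg w2 u" if "0 \<le> u" "u < r" for u
    using reg_local[OF eq that] .
  have I: "exp_functional \<beta> (reg w1) {0..s} = exp_functional \<beta> (reg w2) {0..s}" if "s < r" for s
    using that by (intro exp_functional_cong reg) auto
  define S where "S w = {ereal s | s. 0 \<le> s \<and> ennreal t < exp_functional \<beta> (reg w) {0..s}}" for w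
  have S: "S w1 \<inter> {..<ereal r} = S w2 \<inter> {..<ereal r}"
    unfolding S_def using I by auto
  obtain y where y: "y \<in> S w1" "y < ereal r"
    using r unfolding lamperti_clock_def S_def[symmetric] by (auto simp: Inf_less_iff)
  with S have y2: "y \<in> S w2" by blast
  \<comment> \<open>Since y is a member below r, discarding the members from r onwards does not
    change the infimum.\<close>
  have "Inf (S w) = Inf (S w \<inter> {..<ereal r})" if "y \<in> S w" for w
  proof (rule antisym[OF Inf_superset_mono Inf_greatest])
    fix z assume "z \<in> S w"
    then show "Inf (S w \<inter> {..<ereal r}) \<le> z"
      using that y(2) by (cases "z < ereal r") (auto intro: Inf_lower Inf_lower2[of y])
  qed auto
  from this[OF y(1)] this[OF y2] S have "Inf (S w2) = Inf (S w1)" by simp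
  then show c: "lamperti_clock \<beta> (reg w2) t = lamperti_clock \<beta> (reg w1) t"
    unfolding lamperti_clock_def S_def .
  obtain h where h: "lamperti_clock \<beta> (reg w1) t = ereal h" "0 \<le> h" "h < r"
    using r lamperti_clock_nonneg[of \<beta> "reg w1" t]
    by (cases "lamperti_clock \<beta> (reg w1) t") auto
  show "lamperti_path \<beta> w2 t = lamperti_path \<beta> w1 t"
    unfolding lamperti_path_def c using h reg by (simp add: exp_path_at_def)
qed

section \<open>Restarting the transform at a later time of the path\<close>

lemma cadlag_shift:
  assumes "cadlag w" "0 \<le> s"
  shows "cadlag (\<lambda>v. w (s + v) - c)"
  unfolding cadlag_def
proof (intro conjI allI impI)
  fix t :: real assume t: "0 \<le> t"
  have "filterlim (\<lambda>v. s + v) (at_right (s + t)) (at_right t)"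
    by (auto simp: filterlim_at eventually_at_filter intro!: tendsto_eq_intros)
  moreover have "(w \<longlongrightarrow> w (s + t)) (at_right (s + t))"
    using assms(2) t by (intro cadlagD_right[OF assms(1)]) simp
  ultimately have "((\<lambda>v. w (s + v)) \<longlongrightarrow> w (s + t)) (at_right t)"
    by (rule filterlim_compose[rotated])
  then show "((\<lambda>v. w (s + v) - c) \<longlongrightarrow> w (s + t) - c) (at_right t)"
    by (intro tendsto_diff tendsto_const)
next
  fix t :: real assume t: "0 < t"
  then obtain l where "(w \<longlongrightarrow> l) (at_left (s + t))"
    using cadlagD_left[OF assms(1), of "s + t"] assms(2) by auto
  moreover have "filterlim (\<lambda>v. s + v) (at_left (s + t)) (at_left t)"
    by (auto simp: filterlim_at eventually_at_filter intro!: tendsto_eq_intros)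
  ultimately have "((\<lambda>v. w (s + v)) \<longlongrightarrow> l) (at_left t)"
    by (rule filterlim_compose)
  from tendsto_diff[OF this tendsto_const]
  show "\<exists>l. ((\<lambda>v. w (s + v) - c) \<longlongrightarrow> l) (at_left t)" by blast
qed

text \<open>Translating Lebesgue measure by s and splitting w (s + u) into w s plus an increment
  factors \<open>exp (\<beta> * w s)\<close> out of the later part of the clock.\<close>

lemma clock_integral_add:
  assumes w: "cadlag w" and s: "0 \<le> s" and v: "0 \<le> v"
  shows "clock_integral \<beta> w (s + v) =
    clock_integral \<beta> w s + exp (\<beta> * w s) * clock_integral \<beta> (\<lambda>v. w (s + v) - w s) v"
proof -
  define w' where "w' v = w (s + v) - w s" for v
  have w': "cadlag w'" unfolding w'_def[abs_def] by (rule cadlag_shift[OF w s])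
  have "exp_functional \<beta> w {s<..s+v} =
      (\<integral>\<^sup>+u. ennreal (exp (\<beta> * w (s + 1 * u))) * indicator {s<..s+v} (s + 1 * u) \<partial>lborel)"
    unfolding exp_functional_def using s
    by (subst nn_integral_real_affine[where c=1 and t=s]) (auto intro!: measurable_exp_path w)
  also have "\<dots> = (\<integral>\<^sup>+u. ennreal (exp (\<beta> * w s)) * (ennreal (exp (\<beta> * w' u)) * indicator {0<..v} u) \<partial>lborel)"
    by (rule nn_integral_cong)
      (auto simp: w'_def ennreal_mult[symmetric] exp_add[symmetric] algebra_simps split: split_indicator)
  also have "\<dots> = ennreal (exp (\<beta> * w s)) * exp_functional \<beta> w' {0<..v}"
    unfolding exp_functional_def by (intro nn_integral_cmult) (auto intro!: measurable_exp_path w')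
  also have "exp_functional \<beta> w' {0<..v} = exp_functional \<beta> w' {0..v}"
    using exp_functional_split[OF w' order_refl v, of \<beta>] exp_functional_at_0 by simp
  finally have "ennreal (clock_integral \<beta> w (s + v)) =
      ennreal (clock_integral \<beta> w s + exp (\<beta> * w s) * clock_integral \<beta> w' v)"
    using exp_functional_split[OF w s, of "s + v" \<beta>] v
    by (simp add: exp_functional_eq_clock_integral w w' clock_integral_nonneg ennreal_mult)
  then show ?thesis
    unfolding w'_def
    by (subst (asm) ennreal_inj)
      (auto intro!: add_nonneg_nonneg mult_nonneg_nonneg clock_integral_nonneg)
qed

text \<open>The flow property behind the Markov property: after the clock has run to s, the
  transform continues with the increments of w, in a time slowed or sped up by the factor from
  \<open>clock_integral_add\<close>. If the shifted clock never reaches the remaining time, both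
  sides are 0.\<close>

lemma lamperti_path_add:
  assumes w: "cadlag w" and s: "0 \<le> s" and t: "0 \<le> t"
  shows "lamperti_path \<beta> w (clock_integral \<beta> w s + t) =
    exp (w s) * lamperti_path \<beta> (\<lambda>v. w (s + v) - w s) (t * exp (- (\<beta> * w s)))"
proof -
  define w' where "w' v = w (s + v) - w s" for v
  define t' where "t' = t * exp (- (\<beta> * w s))"
  have w': "cadlag w'" unfolding w'_def[abs_def] by (rule cadlag_shift[OF w s])
  have t': "0 \<le> t'" "t = exp (\<beta> * w s) * t'" using t by (auto simp: t'_def exp_minus)
  have add: "clock_integral \<beta> w (s + v) = clock_integral \<beta> w s + exp (\<beta> * w s) * clock_integral \<beta> w' v"
    if "0 \<le> v" for v
    unfolding w'_def[abs_def] by (rule clock_integral_add[OF w s that])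
  from w' t'(1) have "lamperti_path \<beta> w (clock_integral \<beta> w s + t) = exp (w s) * lamperti_path \<beta> w' t'"
  proof (cases rule: clock_integral_cases[where \<beta>=\<beta>])
    case (finite v)
    then have "clock_integral \<beta> w s + t = clock_integral \<beta> w (s + v)"
      using add t'(2) by simp
    then have "lamperti_path \<beta> w (clock_integral \<beta> w s + t) = exp (w (s + v))"
      using finite s by (simp add: lamperti_path_clock_integral[OF w])
    also have "\<dots> = exp (w s) * exp (w' v)" by (simp add: w'_def exp_add[symmetric])
    also have "exp (w' v) = lamperti_path \<beta> w' t'"
      using lamperti_path_clock_integral[OF w' finite(1), of \<beta>] finite(2) by simp
    finally show ?thesis .
  next
    case infinite
    have "clock_integral \<beta> w u \<le> clock_integral \<beta> w s + t" if u: "0 \<le> u" for u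
    proof (cases "u \<le> s")
      case True
      then have "clock_integral \<beta> w u \<le> clock_integral \<beta> w s"
        using u s by (simp add: clock_integral_le_iff[OF w])
      then show ?thesis using t by simp
    next
      case False
      then have "clock_integral \<beta> w u = clock_integral \<beta> w s + exp (\<beta> * w s) * clock_integral \<beta> w' (u - s)"
        using add[of "u - s"] by simp
      also have "exp (\<beta> * w s) * clock_integral \<beta> w' (u - s) \<le> t"
        unfolding t'(2) using infinite[of "u - s"] False by (intro mult_left_mono) auto
      finally show ?thesis by simp
    qed
    then have "lamperti_path \<beta> w (clock_integral \<beta> w s + t) = 0"
      by (rule lamperti_path_infinite[OF w])
    moreover have "lamperti_path \<beta> w' t' = 0"
      by (rule lamperti_path_infinite[OF w']) (use infinite in \<open>auto intro: less_imp_le\<close>)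
    ultimately show ?thesis by simp
  qed
  then show ?thesis unfolding w'_def t'_def .
qed

lemma exp_functional_increment:
  assumes w: "cadlag w" and "0 \<le> a" "a \<le> b"
  shows "exp_functional \<beta> w {a<..b} = ennreal (clock_integral \<beta> w b - clock_integral \<beta> w a)"
proof -
  have "ennreal (clock_integral \<beta> w a) + exp_functional \<beta> w {a<..b} = ennreal (clock_integral \<beta> w b)"
    using exp_functional_split[OF assms, of \<beta>] by (simp add: exp_functional_eq_clock_integral[OF w])
  then have "exp_functional \<beta> w {a<..b} = ennreal (clock_integral \<beta> w b) - ennreal (clock_integral \<beta> w a)"
    by (metis ennreal_add_diff_cancel_left ennreal_neq_top)
  then show ?thesis
    by (simp add: ennreal_minus clock_integral_nonneg)
qed

section \<open>Path regularity of the transform\<close>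

lemma cadlag_scale:
  assumes f: "cadlag f" and c: "0 < c"
  shows "cadlag (\<lambda>t. k * f (c * t))"
  unfolding cadlag_def
proof (intro conjI allI impI)
  fix t :: real assume t: "0 \<le> t"
  have "filterlim (\<lambda>t. c * t) (at_right (c * t)) (at_right t)"
    using c by (auto simp: filterlim_at eventually_at_filter intro!: tendsto_eq_intros)
  moreover have "(f \<longlongrightarrow> f (c * t)) (at_right (c * t))"
    using c t by (intro cadlagD_right[OF f]) simp
  ultimately have "((\<lambda>t. f (c * t)) \<longlongrightarrow> f (c * t)) (at_right t)"
    by (rule filterlim_compose[rotated])
  then show "((\<lambda>t. k * f (c * t)) \<longlongrightarrow> k * f (c * t)) (at_right t)"
    by (rule tendsto_mult[OF tendsto_const])
next
  fix t :: real assume t: "0 < t"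
  have lim: "filterlim (\<lambda>t. c * t) (at_left (c * t)) (at_left t)"
    using c by (auto simp: filterlim_at eventually_at_filter intro!: tendsto_eq_intros)
  obtain l where "(f \<longlongrightarrow> l) (at_left (c * t))"
    using c t cadlagD_left[OF f, of "c * t"] by auto
  from tendsto_mult[OF tendsto_const filterlim_compose[OF this lim]]
  show "\<exists>l. ((\<lambda>t. k * f (c * t)) \<longlongrightarrow> l) (at_left t)" by blast
qed

text \<open>For times the clock never passes, \<open>real_of_ereal\<close> yields the meaningless
  value 0; hence it is used only at times known to be reached.\<close>

definition clock_inverse :: "real \<Rightarrow> (real \<Rightarrow> real) \<Rightarrow> real \<Rightarrow> real" where
  "clock_inverse \<beta> w t = real_of_ereal (lamperti_clock \<beta> w t)"

lemma clock_inverse_clock_integral: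
  "cadlag w \<Longrightarrow> 0 \<le> v \<Longrightarrow> clock_inverse \<beta> w (clock_integral \<beta> w v) = v"
  by (simp add: clock_inverse_def lamperti_clock_clock_integral)

lemma lamperti_path_clock_inverse:
  assumes w: "cadlag w" and t: "0 \<le> t" "0 \<le> s" "t \<le> clock_integral \<beta> w s"
  shows "lamperti_path \<beta> w t = exp (w (clock_inverse \<beta> w t))"
    and "clock_integral \<beta> w (clock_inverse \<beta> w t) = t" "0 \<le> clock_inverse \<beta> w t"
proof -
  obtain v where "0 \<le> v" "clock_integral \<beta> w v = t"
    using clock_integral_ivt[OF w t] .
  then show "lamperti_path \<beta> w t = exp (w (clock_inverse \<beta> w t))"
    "clock_integral \<beta> w (clock_inverse \<beta> w t) = t" "0 \<le> clock_inverse \<beta> w t"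
    using w lamperti_path_clock_integral[OF w, of v \<beta>] clock_inverse_clock_integral[OF w, of v \<beta>] by auto
qed

text \<open>At a reached time, the inverse clock tends to v strictly from the right, so
  right-continuity of w transfers; from absorption on, the path is constantly 0.\<close>

lemma lamperti_path_right_continuous:
  assumes w: "cadlag w" and t: "0 \<le> t"
  shows "(lamperti_path \<beta> w \<longlongrightarrow> lamperti_path \<beta> w t) (at_right t)"
  using w t
proof (cases rule: clock_integral_cases[where \<beta>=\<beta>])
  case (finite v)
  let ?F = "clock_integral \<beta> w" and ?g = "clock_inverse \<beta> w"
  \<comment> \<open>Any point beyond v would do: it bounds a right neighbourhood of t in which all
    times are reached, so the inverse clock is genuine there.\<close>
  have "t < ?F (v + 1)" using clock_integral_strict_mono[OF w finite(1), of "v + 1" \<beta>] finite by simp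
  then have ev: "eventually (\<lambda>t'. t < t' \<and> t' < ?F (v + 1)) (at_right t)"
    by (auto simp: eventually_at_right_field)
  have g: "?F (?g t') = t'" "0 \<le> ?g t'" "lamperti_path \<beta> w t' = exp (w (?g t'))"
    if "t < t'" "t' < ?F (v + 1)" for t'
    using that t finite(1) lamperti_path_clock_inverse[OF w, of t' "v + 1" \<beta>] by auto
  have gt: "v < ?g t'" if "t < t'" "t' < ?F (v + 1)" for t'
    using clock_integral_less_iff[OF w finite(1) g(2)[OF that], of \<beta>] g(1)[OF that] finite(2) that by simp
  have "filterlim ?g (at_right v) (at_right t)"
    unfolding filterlim_at
  proof
    show "eventually (\<lambda>t'. ?g t' \<in> {v<..} \<and> ?g t' \<noteq> v) (at_right t)"
      using ev by eventually_elim (use gt in force)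
    show "(?g \<longlongrightarrow> v) (at_right t)"
    proof (rule order_tendstoI)
      fix a assume "a < v"
      with ev gt show "eventually (\<lambda>t'. a < ?g t') (at_right t)"
        by (auto elim!: eventually_mono intro: less_trans)
    next
      fix a assume a: "v < a"
      then have "t < ?F a" using clock_integral_strict_mono[OF w finite(1), of a \<beta>] finite by simp
      then have "eventually (\<lambda>t'. t' < ?F a) (at_right t)"
        by (auto simp: eventually_at_right_field)
      with ev show "eventually (\<lambda>t'. ?g t' < a) (at_right t)"
      proof eventually_elim
        case (elim t')
        then show ?case
          using clock_integral_less_iff[OF w g(2)[of t'], of a \<beta>] g(1)[of t'] a finite(1) by simp
      qed
    qed
  qed
  then have "((\<lambda>t'. exp (w (?g t'))) \<longlongrightarrow> exp (w v)) (at_right t)"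
    by (intro tendsto_exp filterlim_compose[OF cadlagD_right[OF w finite(1)]])
  moreover have "eventually (\<lambda>t'. exp (w (?g t')) = lamperti_path \<beta> w t') (at_right t)"
    using ev by eventually_elim (simp add: g)
  ultimately have "(lamperti_path \<beta> w \<longlongrightarrow> exp (w v)) (at_right t)"
    by (rule Lim_transform_eventually)
  then show ?thesis
    using lamperti_path_clock_integral[OF w finite(1), of \<beta>] finite(2) by simp
next
  case infinite
  have z: "lamperti_path \<beta> w t' = 0" if "t \<le> t'" for t'
    by (rule lamperti_path_infinite[OF w]) (use infinite that in \<open>force intro: less_imp_le\<close>)
  have "eventually (\<lambda>t'. t < t') (at_right t)" by (rule eventually_at_right_less)
  then have "eventually (\<lambda>t'. 0 = lamperti_path \<beta> w t') (at_right t)"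
    by eventually_elim (simp add: z)
  from Lim_transform_eventually[OF tendsto_const this] show ?thesis by (simp add: z)
qed

text \<open>At a reached time the left limit of w is carried over through the inverse clock. The
  hypothesis \<open>bot\<close> enters at the one time equal to the total clock, where the inverse
  clock tends to infinity.\<close>

lemma lamperti_path_left_limit:
  assumes w: "cadlag w" and bot: "filterlim w at_bot at_top" and t: "0 < t"
  shows "\<exists>l. (lamperti_path \<beta> w \<longlongrightarrow> l) (at_left t)"
proof -
  let ?F = "clock_integral \<beta> w" and ?g = "clock_inverse \<beta> w"
  have t0: "0 \<le> t" using t by simp
  have pos: "eventually (\<lambda>t'. 0 < t') (at_left t)"
    using t by (auto simp: eventually_at_left_field)
  have lt: "eventually (\<lambda>t'. t' < t) (at_left t)"
    using t by (auto simp: eventually_at_left_field intro!: exI[of _ "t - 1"])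
  from w t0 show ?thesis
  proof (cases rule: clock_integral_cases[where \<beta>=\<beta>])
    case (finite v)
    have v: "0 < v" using finite t by (cases "v = 0") auto
    have ev: "eventually (\<lambda>t'. 0 < t' \<and> t' < t) (at_left t)"
      using pos lt by eventually_elim simp
    have g: "?F (?g t') = t'" "0 \<le> ?g t'" "lamperti_path \<beta> w t' = exp (w (?g t'))"
      if "0 < t'" "t' < t" for t'
      using that finite lamperti_path_clock_inverse[OF w, of t' v \<beta>] by auto
    have less: "?g t' < v" if "0 < t'" "t' < t" for t'
      using clock_integral_less_iff[OF w g(2)[OF that] finite(1), of \<beta>] g(1)[OF that] finite(2) that by simp
    have lim: "filterlim ?g (at_left v) (at_left t)"
      unfolding filterlim_at
    proof
      show "eventually (\<lambda>t'. ?g t' \<in> {..<v} \<and> ?g t' \<noteq> v) (at_left t)"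
        using ev by eventually_elim (use less in force)
      show "(?g \<longlongrightarrow> v) (at_left t)"
      proof (rule order_tendstoI)
        fix a assume "v < a"
        with ev less show "eventually (\<lambda>t'. ?g t' < a) (at_left t)"
          by (auto elim!: eventually_mono intro: less_trans)
      next
        fix a assume a: "a < v"
        then have "?F (max a 0) < t"
          using clock_integral_strict_mono[OF w, of "max a 0" v \<beta>] finite v by simp
        then have "eventually (\<lambda>t'. ?F (max a 0) < t') (at_left t)"
          by (auto simp: eventually_at_left_field)
        with ev show "eventually (\<lambda>t'. a < ?g t') (at_left t)"
        proof eventually_elim
          case (elim t')
          then show ?case
            using clock_integral_less_iff[OF w _ g(2)[of t'], of "max a 0" \<beta>] g(1)[of t'] by simp
        qed
      qed
    qed
    obtain l where "(w \<longlongrightarrow> l) (at_left v)" using cadlagD_left[OF w v] by blast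
    from tendsto_exp[OF filterlim_compose[OF this lim]]
    have "((\<lambda>t'. exp (w (?g t'))) \<longlongrightarrow> exp l) (at_left t)" .
    moreover have "eventually (\<lambda>t'. exp (w (?g t')) = lamperti_path \<beta> w t') (at_left t)"
      using ev by eventually_elim (simp add: g)
    ultimately have "(lamperti_path \<beta> w \<longlongrightarrow> exp l) (at_left t)"
      by (rule Lim_transform_eventually)
    then show ?thesis by blast
  next
    case infinite
    show ?thesis
    \<comment> \<open>The first case puts t strictly after the total clock, so the path is 0 just
      before t; otherwise t is exactly the total clock and all earlier times are reached.\<close>
    proof (cases "\<exists>t0<t. \<forall>s\<ge>0. ?F s \<le> t0")
      case True
      then obtain t1 where t1: "t1 < t" "\<And>s. 0 \<le> s \<Longrightarrow> ?F s \<le> t1" by blast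
      have "eventually (\<lambda>t'. t1 < t') (at_left t)"
        using t1(1) by (auto simp: eventually_at_left_field)
      then have "eventually (\<lambda>t'. 0 = lamperti_path \<beta> w t') (at_left t)"
      proof eventually_elim
        case (elim t')
        show ?case
          by (rule sym, rule lamperti_path_infinite[OF w]) (use t1(2) elim in \<open>force intro: order_trans\<close>)
      qed
      from Lim_transform_eventually[OF tendsto_const this] show ?thesis by blast
    next
      case False
      have g: "?F (?g t') = t'" "0 \<le> ?g t'" "lamperti_path \<beta> w t' = exp (w (?g t'))"
        if t': "0 < t'" "t' < t" for t'
      proof -
        obtain s where "0 \<le> s" "t' < ?F s" using False t'(2) by (force simp: not_le)
        then show "?F (?g t') = t'" "0 \<le> ?g t'" "lamperti_path \<beta> w t' = exp (w (?g t'))"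
          using t' lamperti_path_clock_inverse[OF w, of t' s \<beta>] by auto
      qed
      have "filterlim ?g at_top (at_left t)"
      proof (rule filterlim_at_top_gt[THEN iffD2, rule_format, of 0])
        fix V :: real assume V: "0 < V"
        have "?F V < t" using infinite[of V] V by simp
        then have "eventually (\<lambda>t'. ?F V < t') (at_left t)"
          by (auto simp: eventually_at_left_field)
        with lt pos show "eventually (\<lambda>t'. V \<le> ?g t') (at_left t)"
        proof eventually_elim
          case (elim t')
          then show ?case
            using clock_integral_le_iff[OF w _ g(2)[of t'], of V \<beta>] g(1)[of t'] V by simp
        qed
      qed
      then have "((\<lambda>t'. exp (w (?g t'))) \<longlongrightarrow> 0) (at_left t)"
        by (intro filterlim_compose[OF exp_at_bot] filterlim_compose[OF bot])
      moreover have "eventually (\<lambda>t'. exp (w (?g t')) = lamperti_path \<beta> w t') (at_left t)"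
        using pos lt by eventually_elim (simp add: g)
      ultimately have "(lamperti_path \<beta> w \<longlongrightarrow> 0) (at_left t)"
        by (rule Lim_transform_eventually)
      then show ?thesis by blast
    qed
  qed
qed

lemma cadlag_lamperti_path:
  "cadlag w \<Longrightarrow> filterlim w at_bot at_top \<Longrightarrow> cadlag (lamperti_path \<beta> w)"
  using lamperti_path_right_continuous lamperti_path_left_limit unfolding cadlag_def[of "lamperti_path \<beta> w"]
  by blast

section \<open>Joint measurability in the path and the time\<close>

lemma measurable_exp_functional_reg:
  "(\<lambda>p. exp_functional \<beta> (reg (fst p)) {0..snd p}) \<in> borel_measurable (path_space \<Otimes>\<^sub>M borel)"
proof -
  have [measurable]: "(\<lambda>q. reg (fst (fst q)) (snd q)) \<in>
      borel_measurable ((path_space \<Otimes>\<^sub>M borel) \<Otimes>\<^sub>M lborel)"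
    by (rule measurable_compose[OF _ measurable_reg, of "\<lambda>q. (fst (fst q), snd q)", simplified]) measurable
  \<comment> \<open>The indicator of the interval is spelled out as a condition because its right
    endpoint is itself a variable of the joint space.\<close>
  have "(\<lambda>q. ennreal (exp (\<beta> * reg (fst (fst q)) (snd q))) * (if 0 \<le> snd q \<and> snd q \<le> snd (fst q) then 1 else 0))
      \<in> borel_measurable ((path_space \<Otimes>\<^sub>M borel) \<Otimes>\<^sub>M lborel)"
    by measurable
  then have "(\<lambda>p. \<integral>\<^sup>+u. ennreal (exp (\<beta> * reg (fst p) u)) * (if 0 \<le> u \<and> u \<le> snd p then 1 else 0) \<partial>lborel)
      \<in> borel_measurable (path_space \<Otimes>\<^sub>M borel)"
    by (intro lborel.borel_measurable_nn_integral) (simp add: split_beta')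
  also have "(\<lambda>p. \<integral>\<^sup>+u. ennreal (exp (\<beta> * reg (fst p) u)) * (if 0 \<le> u \<and> u \<le> snd p then 1 else 0) \<partial>lborel) =
      (\<lambda>p. exp_functional \<beta> (reg (fst p)) {0..snd p})"
    unfolding exp_functional_def by (intro ext nn_integral_cong) (auto simp: indicator_def)
  finally show ?thesis .
qed

lemma exp_functional_mono: "A \<subseteq> B \<Longrightarrow> exp_functional \<beta> f A \<le> exp_functional \<beta> f B"
  unfolding exp_functional_def by (intro nn_integral_mono) (auto simp: indicator_def)

text \<open>Rational witnesses suffice, the functional being monotone in the endpoint and
  \<open>ereal s < y\<close> leaving room to the right of s. Sublevel sets of the clock thus become
  countable unions.\<close>

lemma lamperti_clock_less_iff:
  "lamperti_clock \<beta> f t < y \<longleftrightarrow>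
    (\<exists>q\<in>\<rat> \<inter> {0..}. ereal q < y \<and> ennreal t < exp_functional \<beta> f {0..q})"
proof
  assume "lamperti_clock \<beta> f t < y"
  then obtain s where s: "0 \<le> s" "ennreal t < exp_functional \<beta> f {0..s}" "ereal s < y"
    unfolding lamperti_clock_def Inf_less_iff by blast
  from ereal_dense2[OF s(3)] obtain z where z: "s < z" "ereal z < y" by auto
  obtain q where q: "q \<in> \<rat>" "s < q" "q < z" using Rats_dense_in_real[OF z(1)] by blast
  have "exp_functional \<beta> f {0..s} \<le> exp_functional \<beta> f {0..q}"
    using q by (intro exp_functional_mono) auto
  then show "\<exists>q\<in>\<rat> \<inter> {0..}. ereal q < y \<and> ennreal t < exp_functional \<beta> f {0..q}"
    using q s z by (intro bexI[of _ q]) (auto intro: less_le_trans less_trans[of _ "ereal z"])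
next
  assume "\<exists>q\<in>\<rat> \<inter> {0..}. ereal q < y \<and> ennreal t < exp_functional \<beta> f {0..q}"
  then show "lamperti_clock \<beta> f t < y"
    unfolding lamperti_clock_def Inf_less_iff by auto
qed

lemma measurable_lamperti_clock:
  "(\<lambda>p. lamperti_clock \<beta> (reg (fst p)) (snd p)) \<in> borel_measurable (path_space \<Otimes>\<^sub>M borel)"
proof (rule borel_measurableI_less)
  fix y :: ereal
  have [measurable]: "(\<lambda>p. exp_functional \<beta> (reg (fst p)) {0..q}) \<in> borel_measurable (path_space \<Otimes>\<^sub>M borel)"
    for q :: real
    by (rule measurable_compose[OF _ measurable_exp_functional_reg, of "\<lambda>p. (fst p, q)", simplified]) measurable
  have "{p \<in> space (path_space \<Otimes>\<^sub>M borel). lamperti_clock \<beta> (reg (fst p)) (snd p) < y} =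
    (\<Union>q\<in>{q\<in>\<rat> \<inter> {0..}. ereal q < y}.
      {p \<in> space (path_space \<Otimes>\<^sub>M borel). ennreal (snd p) < exp_functional \<beta> (reg (fst p)) {0..q}})"
    unfolding lamperti_clock_less_iff by blast
  also have "\<dots> \<in> sets (path_space \<Otimes>\<^sub>M borel)"
    by (intro sets.countable_UN'' countable_subset[OF _ countable_rat]) auto
  finally show "{p \<in> space (path_space \<Otimes>\<^sub>M borel). lamperti_clock \<beta> (reg (fst p)) (snd p) < y}
      \<in> sets (path_space \<Otimes>\<^sub>M borel)" .
qed

lemma measurable_lamperti_path:
  "(\<lambda>p. lamperti_path \<beta> (fst p) (snd p)) \<in> borel_measurable (path_space \<Otimes>\<^sub>M borel)"
proof -
  note [measurable] = measurable_lamperti_clock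
  have "(\<lambda>p. (fst p, real_of_ereal (lamperti_clock \<beta> (reg (fst p)) (snd p)))) \<in>
      path_space \<Otimes>\<^sub>M borel \<rightarrow>\<^sub>M path_space \<Otimes>\<^sub>M borel"
    by measurable
  from measurable_compose[OF this measurable_reg]
  have [measurable]: "(\<lambda>p. reg (fst p) (real_of_ereal (lamperti_clock \<beta> (reg (fst p)) (snd p))))
      \<in> borel_measurable (path_space \<Otimes>\<^sub>M borel)" by simp
  show ?thesis
    unfolding lamperti_path_def exp_path_at_def by measurable
qed

lemma measurable_lamperti_path_at:
  "(\<lambda>w. lamperti_path \<beta> w u) \<in> borel_measurable path_space"
  by (rule measurable_compose[OF _ measurable_lamperti_path, of "\<lambda>w. (w, u)", simplified]) measurable

section \<open>Time change of the killed process\<close>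

text \<open>The clock integral pushes the measure with density \<open>exp (\<alpha> * w)\<close> forward to Lebesgue
  measure; the classical substitution rule is not available, as the clock integral need not be
  differentiable at the jumps of \<open>w\<close>.\<close>

lemma nn_integral_clock_substitution:
  fixes f :: "real \<Rightarrow> ennreal"
  assumes w: "cadlag w" and c: "0 < c" and V: "0 \<le> V" and f[measurable]: "f \<in> borel_measurable borel"
  shows "(\<integral>\<^sup>+u\<in>{0..c * clock_integral \<alpha> w V}. f u \<partial>lborel) =
    (\<integral>\<^sup>+v\<in>{0..V}. f (c * clock_integral \<alpha> w v) * ennreal (c * exp (\<alpha> * w v)) \<partial>lborel)"
proof -
  let ?F = "clock_integral \<alpha> w"
  define J where "J v = c * ?F v" for v
  \<comment> \<open>Extends monotonicity, and with it Borel measurability, of the clock to the whole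
    line.\<close>
  have F_neg: "?F v = 0" if "v < 0" for v
    using that by (simp add: clock_integral_def exp_functional_def)
  have "mono ?F"
  proof (rule monoI)
    fix a b :: real assume "a \<le> b"
    then show "?F a \<le> ?F b"
      by (cases "0 \<le> a") (auto simp: clock_integral_le_iff[OF w] F_neg clock_integral_nonneg)
  qed
  then have J[measurable]: "J \<in> borel_measurable borel"
    unfolding J_def[abs_def] by (intro borel_measurable_times borel_measurable_mono) auto
  have J_less: "J a < J b \<longleftrightarrow> a < b" if "0 \<le> a" "0 \<le> b" for a b
    using clock_integral_less_iff[OF w that, of \<alpha>] c by (simp add: J_def)
  define d where "d v = ennreal (c * exp (\<alpha> * w v)) * indicator {0..V} v" for v
  have d_eq: "d v * indicator B v = ennreal c * (ennreal (exp (\<alpha> * w v)) * indicator ({0..V} \<inter> B) v)" for v B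
    using c by (auto simp: d_def indicator_def ennreal_mult)
  have d[measurable]: "d \<in> borel_measurable borel"
  proof -
    have [measurable]: "(\<lambda>v. ennreal (exp (\<alpha> * w v)) * indicator {0..V} v) \<in> borel_measurable borel"
      by (rule measurable_exp_path[OF w]) auto
    have "d = (\<lambda>v. ennreal c * (ennreal (exp (\<alpha> * w v)) * indicator {0..V} v))"
      using d_eq[where B=UNIV] by auto
    then show ?thesis by simp
  qed
  have "distr (density lborel d) borel J = density lborel (indicator {0..J V})" (is "?M = ?N")
  \<comment> \<open>Both measures give finite mass to open right half-lines, so it is enough to
    compare them there.\<close>
  proof (rule measure_eqI_lessThan)
    have eqN: "emeasure ?N {a<..} = emeasure lborel ({0..J V} \<inter> {a<..})" for a
      by (auto simp: emeasure_density indicator_inter_arith[symmetric])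
    have J_V: "0 \<le> J V" using c by (simp add: J_def clock_integral_nonneg)
    show eq: "emeasure ?M {a<..} = emeasure ?N {a<..}" for a
    proof -
      have "emeasure ?M {a<..} = (\<integral>\<^sup>+v. d v * indicator {v. a < J v} v \<partial>lborel)"
        by (subst emeasure_distr) (auto simp: emeasure_density vimage_def)
      also have "\<dots> = ennreal c * (\<integral>\<^sup>+v. ennreal (exp (\<alpha> * w v)) * indicator ({0..V} \<inter> {v. a < J v}) v \<partial>lborel)"
        unfolding d_eq by (intro nn_integral_cmult) (auto intro!: measurable_exp_path w)
      finally have M: "emeasure ?M {a<..} = ennreal c * exp_functional \<alpha> w ({0..V} \<inter> {v. a < J v})"
        by (simp add: exp_functional_def)
      \<comment> \<open>Only an \<open>a\<close> in the range of J involves an increment of the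
        clock; otherwise both sides are the total mass or 0.\<close>
      consider "a < 0" | v where "0 \<le> v" "v \<le> V" "a = J v" | "J V < a"
      proof -
        assume *: "a < 0 \<Longrightarrow> thesis" "\<And>v. 0 \<le> v \<Longrightarrow> v \<le> V \<Longrightarrow> a = J v \<Longrightarrow> thesis" "J V < a \<Longrightarrow> thesis"
        show thesis
        proof (cases "0 \<le> a \<and> a \<le> J V")
          case True
          then have "0 \<le> a / c" "a / c \<le> ?F V" using c by (auto simp: J_def field_simps)
          from clock_integral_ivt[OF w this(1) V this(2)] obtain v
            where "0 \<le> v" "v \<le> V" "?F v = a / c" .
          then show thesis using c by (intro *(2)) (auto simp: J_def)
        qed (use * in linarith)
      qed
      then show ?thesis
      proof cases
        case 1
        have "a < J v" if "0 \<le> v" for v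
          using 1 c clock_integral_nonneg[of \<alpha> w v] by (simp add: J_def less_le_trans)
        then have s: "{0..V} \<inter> {v. a < J v} = {0..V}" "{0..J V} \<inter> {a<..} = {0..J V}"
          using 1 by auto
        show ?thesis
          unfolding M eqN s using J_V c
          by (simp add: exp_functional_eq_clock_integral[OF w] J_def ennreal_mult clock_integral_nonneg)
      next
        case (2 v)
        have "0 \<le> a" using 2 c by (simp add: J_def clock_integral_nonneg)
        then have s: "{0..V} \<inter> {v. a < J v} = {v<..V}" "{0..J V} \<inter> {a<..} = {a<..J V}"
          using 2 J_less by auto
        have "a \<le> J V" using 2 J_less[of V v] V by (simp add: not_less[symmetric])
        then show ?thesis
          unfolding M eqN s exp_functional_increment[OF w 2(1) 2(2)] using c 2
          by (simp add: ennreal_mult'[symmetric] J_def algebra_simps)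
      next
        case 3
        have "\<not> a < J v" if "0 \<le> v" "v \<le> V" for v
          using 3 J_less[of V v] that V by (auto simp: not_less)
        then have s: "{0..V} \<inter> {v. a < J v} = {}" "{0..J V} \<inter> {a<..} = {}"
          using 3 by auto
        show ?thesis unfolding M eqN s by (simp add: exp_functional_def)
      qed
    qed
    show "emeasure ?M {a<..} < \<infinity>" for a
    proof -
      have "emeasure ?N {a<..} \<le> emeasure lborel {0..J V}"
        unfolding eqN by (rule emeasure_mono) auto
      also have "\<dots> < \<infinity>" using J_V by simp
      finally show ?thesis unfolding eq .
    qed
  qed simp_all
  then have "integral\<^sup>N ?N f = integral\<^sup>N ?M f" by simp
  also have "\<dots> = (\<integral>\<^sup>+v. d v * f (J v) \<partial>lborel)"
    by (simp add: nn_integral_distr nn_integral_density)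
  finally have "(\<integral>\<^sup>+u. indicator {0..J V} u * f u \<partial>lborel) = (\<integral>\<^sup>+v. d v * f (J v) \<partial>lborel)"
    by (simp add: nn_integral_density)
  then show ?thesis
    unfolding d_def J_def by (simp add: mult_ac)
qed

lemma measurable_lamperti_path_time:
  "lamperti_path \<beta> w \<in> borel_measurable borel"
proof -
  have "(\<lambda>t. (restrict w {0..}, t)) \<in> borel \<rightarrow>\<^sub>M path_space \<Otimes>\<^sub>M borel"
    by (intro measurable_Pair measurable_const) (auto simp: space_PiM)
  from measurable_compose[OF this measurable_lamperti_path[of \<beta>]] show ?thesis
    by simp
qed

lemma positive_before_passage_time:
  assumes "0 < s" "ereal s < passage_time X \<omega>"
  shows "0 < X s \<omega>"
proof (rule ccontr)
  assume "\<not> 0 < X s \<omega>"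
  with assms(1) have "passage_time X \<omega> \<le> ereal s"
    unfolding passage_time_def by (intro Inf_lower) auto
  with assms(2) show False by simp
qed

text \<open>The path w serves as common parameter: at parameter v the killed process is at time
  \<open>J v\<close>, the branching process at time \<open>G v\<close>, and both have the value
  \<open>x * exp (w v)\<close>. What needs care is that J covers exactly the times before the
  passage time, and that absorption of the two sides coincides.\<close>

lemma cb_process_lamperti:
  fixes X :: "real \<Rightarrow> 'a \<Rightarrow> real"
  assumes w: "cadlag w" and x: "0 < x"
    and rep: "\<And>t. 0 \<le> t \<Longrightarrow> ereal t \<le> hitting_time_zero (\<lambda>u. killed X u \<omega>) \<Longrightarrow>
      killed X t \<omega> = x * exp_path_at w (lamperti_clock \<alpha> w (t * x powr (- \<alpha>)))"
    and t: "0 \<le> t"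
  shows "cb_process X t \<omega> = x * lamperti_path (\<alpha> - 1) w (t * x powr (- (\<alpha> - 1)))"
proof -
  define T where "T = passage_time X \<omega>"
  define J where "J v = x powr \<alpha> * clock_integral \<alpha> w v" for v
  define G where "G v = x powr (\<alpha> - 1) * clock_integral (\<alpha> - 1) w v" for v
  have J_nonneg: "0 \<le> J v" for v by (simp add: J_def clock_integral_nonneg)
  have J_inv: "J v * x powr (- \<alpha>) = clock_integral \<alpha> w v" for v
    using x by (simp add: J_def powr_minus field_simps)
  have G_inv: "G v * x powr (- (\<alpha> - 1)) = clock_integral (\<alpha> - 1) w v" for v
    using x unfolding G_def powr_minus by (simp add: field_simps)
  have pos: "0 < X s \<omega>" if "0 < s" "ereal s < T" for s
    using positive_before_passage_time that unfolding T_def .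
  \<comment> \<open>The killed process is positive strictly between 0 and T, so the representation
    is available up to T, and T itself is included.\<close>
  have hit: "T \<le> hitting_time_zero (\<lambda>u. killed X u \<omega>)"
    unfolding hitting_time_zero_def
  proof (rule Inf_greatest)
    fix z assume "z \<in> {ereal t | t. 0 < t \<and> killed X t \<omega> = 0}"
    then obtain s where s: "z = ereal s" "0 < s" "killed X s \<omega> = 0" by auto
    show "T \<le> z"
    proof (rule ccontr)
      assume "\<not> T \<le> z"
      with s pos[of s] show False by (simp add: killed_def T_def[symmetric] not_le)
    qed
  qed
  have rep': "killed X s \<omega> = x * lamperti_path \<alpha> w (s * x powr (- \<alpha>))" if "0 \<le> s" "ereal s \<le> T" for s
    using rep[OF that(1) order_trans[OF that(2) hit]] by (simp add: lamperti_path_eq[OF w])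
  have repJ: "killed X (J v) \<omega> = x * exp (w v)" if "0 \<le> v" "ereal (J v) \<le> T" for v
    using rep'[OF J_nonneg that(2)] unfolding J_inv by (simp add: lamperti_path_clock_integral[OF w that(1)])
  \<comment> \<open>If T were at most \<open>J v\<close>, continuity of the clock would give T =
    \<open>J v'\<close>; there the killed process is 0 by definition but positive by its
    representation.\<close>
  have J_less_T: "ereal (J v) < T" if v: "0 \<le> v" for v
  proof (rule ccontr)
    assume "\<not> ereal (J v) < T"
    then have T_le: "T \<le> ereal (J v)" by simp
    have "0 \<le> T" unfolding T_def passage_time_def by (rule Inf_greatest) auto
    with T_le obtain r where r: "T = ereal r" "0 \<le> r" "r \<le> J v"
      by (cases T) auto
    then have "0 \<le> r * x powr (- \<alpha>)" "r * x powr (- \<alpha>) \<le> clock_integral \<alpha> w v"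
      unfolding J_inv[symmetric] by (auto intro: mult_right_mono)
    from clock_integral_ivt[OF w this(1) v this(2)] obtain v'
      where v': "0 \<le> v'" "clock_integral \<alpha> w v' = r * x powr (- \<alpha>)" .
    then have "r = J v'" using x by (simp add: J_def powr_minus)
    with repJ[OF v'(1)] r x show False
      by (simp add: killed_def T_def[symmetric])
  qed
  have XJ: "X (J v) \<omega> = x * exp (w v)" if "0 \<le> v" for v
    using repJ[OF that] J_less_T[OF that] by (simp add: killed_def T_def[symmetric])
  \<comment> \<open>A time before T outside the range of J would lie beyond the clock, where the
    representation gives 0, against positivity of X before T.\<close>
  have onto: "\<exists>v\<ge>0. s = J v" if s: "0 \<le> s" "ereal s < T" for s
  proof -
    have s': "0 \<le> s * x powr (- \<alpha>)" using s by simp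
    from w s' show ?thesis
    proof (cases rule: clock_integral_cases[where \<beta>=\<alpha>])
      case (finite v)
      then show ?thesis using x by (intro exI[of _ v]) (simp add: J_def powr_minus)
    next
      case infinite
      then have "s \<noteq> 0" using infinite[of 0] by auto
      with s pos have "0 < X s \<omega>" by simp
      moreover have "X s \<omega> = 0"
        using rep'[OF s(1)] s(2) lamperti_path_infinite[OF w, of \<alpha> "s * x powr (- \<alpha>)"] infinite
        by (simp add: killed_def T_def[symmetric] less_imp_le)
      ultimately show ?thesis by simp
    qed
  qed
  have A: "cb_additive X \<omega> (J v) = ennreal (G v)" if v: "0 \<le> v" for v
  proof -
    have "cb_additive X \<omega> (J v) =
        (\<integral>\<^sup>+u\<in>{0..x powr \<alpha> * clock_integral \<alpha> w v}. ennreal (1 / (x * lamperti_path \<alpha> w (u * x powr (- \<alpha>)))) \<partial>lborel)"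
      unfolding cb_additive_def J_def[symmetric]
    proof (rule nn_integral_cong)
      fix u
      show "ennreal (1 / X u \<omega>) * indicator {0..J v} u =
          ennreal (1 / (x * lamperti_path \<alpha> w (u * x powr (- \<alpha>)))) * indicator {0..J v} u"
      proof (cases "u \<in> {0..J v}")
        case True
        then have u: "ereal u < T" using J_less_T[OF v] by (auto intro: le_less_trans[of _ "ereal (J v)"])
        then show ?thesis
          using rep'[of u] True by (simp add: killed_def T_def[symmetric])
      qed simp
    qed
    also have "\<dots> = (\<integral>\<^sup>+u\<in>{0..v}. ennreal (1 / (x * lamperti_path \<alpha> w (J u * x powr (- \<alpha>)))) *
        ennreal (x powr \<alpha> * exp (\<alpha> * w u)) \<partial>lborel)"
      unfolding J_def using x v
      by (subst nn_integral_clock_substitution[OF w])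
        (auto intro!: measurable_compose[OF _ measurable_ennreal] borel_measurable_divide
          borel_measurable_times measurable_compose[OF _ measurable_lamperti_path_time])
    also have "\<dots> = (\<integral>\<^sup>+u. ennreal (x powr (\<alpha> - 1)) *
        (ennreal (exp ((\<alpha> - 1) * w u)) * indicator {0..v} u) \<partial>lborel)"
    proof (rule nn_integral_cong)
      fix u
      show "ennreal (1 / (x * lamperti_path \<alpha> w (J u * x powr (- \<alpha>)))) *
          ennreal (x powr \<alpha> * exp (\<alpha> * w u)) * indicator {0..v} u =
        ennreal (x powr (\<alpha> - 1)) * (ennreal (exp ((\<alpha> - 1) * w u)) * indicator {0..v} u)"
      proof (cases "u \<in> {0..v}")
        case True
        then have "lamperti_path \<alpha> w (J u * x powr (- \<alpha>)) = exp (w u)"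
          unfolding J_inv by (simp add: lamperti_path_clock_integral[OF w])
        \<comment> \<open>Here the index drops from \<alpha> to \<alpha> - 1: the factor 1 / X
          cancels one power of \<open>x * exp (w u)\<close>.\<close>
        moreover have "1 / (x * exp (w u)) * (x powr \<alpha> * exp (\<alpha> * w u)) =
            x powr (\<alpha> - 1) * exp ((\<alpha> - 1) * w u)"
          using x by (simp add: powr_diff left_diff_distrib exp_diff field_simps)
        ultimately show ?thesis
          using x True by (simp add: ennreal_mult'[symmetric] del: times_divide_eq_left)
      qed simp
    qed
    also have "\<dots> = ennreal (x powr (\<alpha> - 1)) * exp_functional (\<alpha> - 1) w {0..v}"
      unfolding exp_functional_def by (intro nn_integral_cmult) (auto intro!: measurable_exp_path w)
    also have "\<dots> = ennreal (G v)"
      by (simp add: exp_functional_eq_clock_integral[OF w] G_def ennreal_mult clock_integral_nonneg)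
    finally show ?thesis .
  qed
  have G_nonneg: "0 \<le> G v" for v by (simp add: G_def clock_integral_nonneg)
  \<comment> \<open>Reparametrises the infimum by v, which brings it into the shape of
    \<open>Inf_image_above\<close> with J as time scale and G as clock.\<close>
  have clock: "cb_clock X \<omega> s = Inf {ereal (J v) | v. 0 \<le> v \<and> s < G v}" if "0 \<le> s" for s
  proof -
    have "{ereal s' | s'. 0 \<le> s' \<and> ereal s' < T \<and> ennreal s < cb_additive X \<omega> s'} =
        {ereal (J v) | v. 0 \<le> v \<and> s < G v}"
    proof (intro set_eqI iffI)
      fix z assume "z \<in> {ereal s' | s'. 0 \<le> s' \<and> ereal s' < T \<and> ennreal s < cb_additive X \<omega> s'}"
      then obtain s' where s': "z = ereal s'" "0 \<le> s'" "ereal s' < T" "ennreal s < cb_additive X \<omega> s'"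
        by blast
      from onto[OF s'(2,3)] obtain v where v: "0 \<le> v" "s' = J v" by blast
      then show "z \<in> {ereal (J v) | v. 0 \<le> v \<and> s < G v}"
        using s' A[OF v(1)] that by (auto simp: ennreal_less_iff)
    next
      fix z assume "z \<in> {ereal (J v) | v. 0 \<le> v \<and> s < G v}"
      then obtain v where v: "z = ereal (J v)" "0 \<le> v" "s < G v" by blast
      then show "z \<in> {ereal s' | s'. 0 \<le> s' \<and> ereal s' < T \<and> ennreal s < cb_additive X \<omega> s'}"
        using J_less_T A[OF v(2)] that J_nonneg by (auto simp: ennreal_less_iff)
    qed
    then show ?thesis unfolding cb_clock_def T_def by simp
  qed
  have tc: "cb_time_change X s \<omega> = x * lamperti_path (\<alpha> - 1) w (s * x powr (- (\<alpha> - 1)))"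
    if s: "0 \<le> s" for s
  proof -
    have s': "0 \<le> s * x powr (- (\<alpha> - 1))" using s by simp
    from w s' show ?thesis
    proof (cases rule: clock_integral_cases[where \<beta>="\<alpha> - 1"])
      case (finite v)
      have Gs: "s = G v" using finite x unfolding G_def powr_minus by simp
      have "continuous_on {0..v + 1} J"
        unfolding J_def[abs_def] by (intro continuous_intros continuous_on_clock_integral[OF w])
      then have "(J \<longlongrightarrow> J v) (at v within {0..v + 1})"
        using finite(1) by (auto simp: continuous_on_def)
      then have "(J \<longlongrightarrow> J v) (at v within {v..v + 1})"
        by (rule tendsto_within_subset) (use finite(1) in auto)
      then have lim: "(J \<longlongrightarrow> J v) (at_right v)"
        by (simp add: at_within_Icc_at_right)
      have "cb_clock X \<omega> s = ereal (J v)"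
        unfolding clock[OF s] unfolding Gs
      proof (rule Inf_image_above[OF finite(1) lim])
        show "J v < J v'" if "v < v'" for v'
          using clock_integral_strict_mono[OF w finite(1) that, of \<alpha>] x by (simp add: J_def)
        show "G v < G v' \<longleftrightarrow> v < v'" if "0 \<le> v'" for v'
          using clock_integral_less_iff[OF w finite(1) that, of "\<alpha> - 1"] x by (simp add: G_def)
      qed
      then have "cb_time_change X s \<omega> = x * exp (w v)"
        unfolding cb_time_change_def by (simp add: XJ[OF finite(1)])
      then show ?thesis
        using lamperti_path_clock_integral[OF w finite(1), of "\<alpha> - 1"] finite(2) by simp
    next
      case infinite
      have "G v \<le> s" if "0 \<le> v" for v
        using infinite[OF that] x unfolding G_inv[symmetric] by simp
      then have e: "{ereal (J v) | v. 0 \<le> v \<and> s < G v} = {}" by (auto simp: not_less)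
      have "cb_clock X \<omega> s = \<infinity>"
        unfolding clock[OF s] e by (simp only: Inf_empty top_ereal_def)
      then have "cb_time_change X s \<omega> = 0" by (simp add: cb_time_change_def)
      moreover have "lamperti_path (\<alpha> - 1) w (s * x powr (- (\<alpha> - 1))) = 0"
        by (rule lamperti_path_infinite[OF w]) (use infinite in \<open>auto intro: less_imp_le\<close>)
      ultimately show ?thesis by simp
    qed
  qed
  show ?thesis
  proof (cases "\<exists>s. 0 \<le> s \<and> s \<le> t \<and> cb_time_change X s \<omega> = 0")
    case False
    show ?thesis unfolding cb_process_def if_not_P[OF False] by (rule tc[OF t])
  next
    case True
    then obtain s where s: "0 \<le> s" "s \<le> t" "cb_time_change X s \<omega> = 0" by blast
    \<comment> \<open>At a reached time the transform is an exponential, hence nonzero; a zero at s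
      therefore shows that the clock never passes s, and so never passes t.\<close>
    have "clock_integral (\<alpha> - 1) w v \<le> t * x powr (- (\<alpha> - 1))" if v: "0 \<le> v" for v
    proof (rule ccontr)
      assume "\<not> clock_integral (\<alpha> - 1) w v \<le> t * x powr (- (\<alpha> - 1))"
      moreover have "s * x powr (- (\<alpha> - 1)) \<le> t * x powr (- (\<alpha> - 1))"
        using s(2) by (rule mult_right_mono) simp
      ultimately have "lamperti_path (\<alpha> - 1) w (s * x powr (- (\<alpha> - 1))) \<noteq> 0"
        using s(1) lamperti_path_clock_inverse(1)[OF w _ v, of "s * x powr (- (\<alpha> - 1))" "\<alpha> - 1"] by simp
      with s tc[OF s(1)] x show False by simp
    qed
    then have "lamperti_path (\<alpha> - 1) w (t * x powr (- (\<alpha> - 1))) = 0"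
      by (rule lamperti_path_infinite[OF w])
    then show ?thesis unfolding cb_process_def if_P[OF True] by simp
  qed
qed

text \<open>It is enough that the time-changed process is 0 at time 0, since
  \<open>cb_process\<close> then stays at 0. For T = 0 the clock at 0 is an infimum over the empty
  set; for T > 0 the additive functional is positive at every positive time before T, so that clock
  is 0 and X 0 = 0.\<close>

lemma cb_process_from_0:
  fixes X :: "real \<Rightarrow> 'a \<Rightarrow> real"
  assumes X: "cadlag (\<lambda>t. X t \<omega>)" "X 0 \<omega> = 0" and t: "0 \<le> t"
  shows "cb_process X t \<omega> = 0"
proof -
  define T where "T = passage_time X \<omega>"
  have pos: "0 < X s \<omega>" if "0 < s" "ereal s < T" for s
    using positive_before_passage_time that unfolding T_def .
  \<comment> \<open>If the integral vanished, an integrand that is positive on (0, s] would be 0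
    almost everywhere. Measurability again comes from \<open>reg\<close>.\<close>
  have A: "0 < cb_additive X \<omega> s" if s: "0 < s" "ereal s < T" for s
  proof (rule ccontr)
    have [measurable]: "(\<lambda>u. ennreal (1 / reg (\<lambda>t. X t \<omega>) u) * indicator {0..s} u) \<in> borel_measurable lborel"
      using measurable_reg_path[of "\<lambda>t. X t \<omega>"] by measurable
    have "cb_additive X \<omega> s = (\<integral>\<^sup>+u\<in>{0..s}. ennreal (1 / reg (\<lambda>t. X t \<omega>) u) \<partial>lborel)"
      unfolding cb_additive_def
      by (rule nn_integral_cong) (auto simp: indicator_def reg_eq[OF X(1)])
    moreover assume "\<not> 0 < cb_additive X \<omega> s"
    ultimately have "AE u in lborel. ennreal (1 / reg (\<lambda>t. X t \<omega>) u) * indicator {0..s} u = 0"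
      by (simp add: nn_integral_0_iff_AE)
    then have "AE u in lborel. u \<notin> {0<..s}"
    proof eventually_elim
      case (elim u)
      show ?case
      proof
        assume u: "u \<in> {0<..s}"
        then have "0 < X u \<omega>" using s by (intro pos) (auto intro: le_less_trans[of _ "ereal s"])
        then show False using elim u by (simp add: reg_eq[OF X(1)] indicator_def)
      qed
    qed
    then have "emeasure lborel {0<..s} = 0"
      by (subst (asm) AE_iff_measurable[where N="{0<..s}"]) auto
    then show False using s by simp
  qed
  have "cb_time_change X 0 \<omega> = 0"
  proof (cases "0 < T")
    case False
    then have e: "{ereal s |s. 0 \<le> s \<and> ereal s < T \<and> ennreal 0 < cb_additive X \<omega> s} = {}"
      by (auto simp: not_less zero_ereal_def[symmetric] intro: order_trans dest: less_le_trans)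
    have "cb_clock X \<omega> 0 = \<infinity>"
      unfolding cb_clock_def T_def[symmetric] e by (simp only: Inf_empty top_ereal_def)
    then show ?thesis by (simp add: cb_time_change_def)
  next
    case True
    have "cb_clock X \<omega> 0 = 0"
      unfolding cb_clock_def T_def[symmetric]
    proof (rule Inf_eqI)
      fix y assume y: "\<And>i. i \<in> {ereal s |s. 0 \<le> s \<and> ereal s < T \<and> ennreal 0 < cb_additive X \<omega> s} \<Longrightarrow> y \<le> i"
      from ereal_dense2[OF True] obtain r where r: "0 < r" "ereal r < T" by auto
      have "eventually (\<lambda>s. s < r) (at_right (0::real))"
        using r(1) by (auto simp: eventually_at_right_field)
      with eventually_at_right_less[of "0::real"] have "eventually (\<lambda>s. y \<le> ereal s) (at_right 0)"
      proof eventually_elim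
        case (elim s)
        then have "ereal s < T" using r(2) by (auto intro: less_trans[of _ "ereal r"])
        with elim A show ?case by (intro y) auto
      qed
      moreover have "((\<lambda>s. ereal s) \<longlongrightarrow> ereal 0) (at_right 0)"
        by (simp add: tendsto_ident_at)
      ultimately show "y \<le> 0"
        using tendsto_lowerbound[of "\<lambda>s. ereal s" "ereal 0" "at_right 0" y] by (simp add: zero_ereal_def)
    qed auto
    then show ?thesis by (simp add: cb_time_change_def X)
  qed
  then show ?thesis unfolding cb_process_def using t by auto
qed

section \<open>Levy processes\<close>

abbreviation product_borel :: "'i set \<Rightarrow> ('i \<Rightarrow> real) measure" where
  "product_borel I \<equiv> \<Pi>\<^sub>M i\<in>I. borel"

text \<open>Orthants with finitely many constraints are a convenient generator: they are stable
  under intersection, and each coordinate half-line is one of them.\<close>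

lemma sets_product_borel_orthants:
  "sets (product_borel I) = sigma_sets (space (product_borel I))
    {{w \<in> space (product_borel I). \<forall>i\<in>J. w i \<le> a i} | J a. finite J \<and> J \<subseteq> I}"
  (is "_ = sigma_sets ?\<Omega> ?E")
proof (rule antisym)
  have E: "?E \<subseteq> Pow ?\<Omega>" by auto
  have "(\<lambda>w. w) \<in> sigma ?\<Omega> ?E \<rightarrow>\<^sub>M product_borel I"
  proof (rule measurable_PiM_single')
    fix i assume i: "i \<in> I"
    show "(\<lambda>w. w i) \<in> borel_measurable (sigma ?\<Omega> ?E)"
    proof (subst borel_measurable_iff_le, rule allI)
      fix a :: real
      have "{w \<in> ?\<Omega>. w i \<le> a} \<in> ?E"
        using i by (intro CollectI exI[of _ "{i}"] exI[of _ "\<lambda>_. a"]) auto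
      then show "{w \<in> space (sigma ?\<Omega> ?E). w i \<le> a} \<in> sets (sigma ?\<Omega> ?E)"
        using E by simp
    qed
  qed (use E in \<open>auto simp: space_PiM\<close>)
  then show "sets (product_borel I) \<subseteq> sigma_sets ?\<Omega> ?E"
    using E by (auto dest!: measurable_sets simp: Int_absorb2 sets.sets_into_space)
next
  have "?E \<subseteq> sets (product_borel I)"
  proof safe
    fix J :: "'a set" and a :: "'a \<Rightarrow> real" assume J: "finite J" "J \<subseteq> I"
    have [measurable]: "i \<in> J \<Longrightarrow> (\<lambda>w. w i) \<in> borel_measurable (product_borel I)" for i
      using J by (intro measurable_component_singleton) auto
    show "{w \<in> ?\<Omega>. \<forall>i\<in>J. w i \<le> a i} \<in> sets (product_borel I)"
      using J by measurable
  qed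
  then show "sigma_sets ?\<Omega> ?E \<subseteq> sets (product_borel I)"
    by (rule sets.sigma_sets_subset)
qed

text \<open>Uniqueness from an intersection-stable generator. On shared coordinates the smaller
  bound is kept, and the empty set of constraints yields the whole space, whose mass is
  finite.\<close>

lemma product_borel_measure_eqI:
  assumes sets: "sets A = sets (product_borel I)" "sets B = sets (product_borel I)"
    and eq: "\<And>J a. finite J \<Longrightarrow> J \<subseteq> I \<Longrightarrow>
      emeasure A {w \<in> space (product_borel I). \<forall>i\<in>J. w i \<le> a i} =
      emeasure B {w \<in> space (product_borel I). \<forall>i\<in>J. w i \<le> a i}"
    and fin: "emeasure A (space (product_borel I)) \<noteq> \<infinity>"
  shows "A = B"
proof (rule measure_eqI_generator_eq)
  let ?\<Omega> = "space (product_borel I)"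
  let ?E = "{{w \<in> ?\<Omega>. \<forall>i\<in>J. w i \<le> a i} | J a. finite J \<and> J \<subseteq> I}"
  show "Int_stable ?E"
  proof (rule Int_stableI)
    fix S1 S2 assume "S1 \<in> ?E" "S2 \<in> ?E"
    then obtain J1 a1 J2 a2 where J: "finite J1" "J1 \<subseteq> I" "finite J2" "J2 \<subseteq> I"
      "S1 = {w \<in> ?\<Omega>. \<forall>i\<in>J1. w i \<le> a1 i}" "S2 = {w \<in> ?\<Omega>. \<forall>i\<in>J2. w i \<le> a2 i}"
      by blast
    define a where "a i = (if i \<in> J1 then if i \<in> J2 then min (a1 i) (a2 i) else a1 i else a2 i)" for i
    have "S1 \<inter> S2 = {w \<in> ?\<Omega>. \<forall>i\<in>J1 \<union> J2. w i \<le> a i}"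
      unfolding J a_def by auto
    then show "S1 \<inter> S2 \<in> ?E" using J by blast
  qed
  show "range (\<lambda>_::nat. ?\<Omega>) \<subseteq> ?E"
    by (auto intro!: exI[of _ "{}"])
  show "emeasure A X = emeasure B X" if "X \<in> ?E" for X
    using that eq by auto
qed (use sets sets_product_borel_orthants fin in auto)

text \<open>Independence of increments is stated for monotone sequences, so a finite time set is
  listed as one: increasingly, then constant at its largest point. Repeated values contribute zero
  increments.\<close>

lemma mono_enumeration:
  fixes S :: "real set"
  assumes "finite S" "S \<noteq> {}"
  obtains t :: "nat \<Rightarrow> real" and n :: nat
  where "mono t" "t 0 = Min S" "\<And>s. s \<in> S \<Longrightarrow> \<exists>k\<le>n. t k = s"
proof
  define L where "L = sorted_list_of_set S"
  define t where "t i = L ! min i (length L - 1)" for i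
  have L: "set L = S" "sorted L" using assms by (auto simp: L_def)
  then have "L \<noteq> []" using assms by auto
  then have len: "0 < length L" by simp
  show "mono t"
    unfolding t_def by (rule monoI, rule sorted_nth_mono[OF L(2)]) (use len in \<open>auto simp: min_less_iff_disj\<close>)
  show "t 0 = Min S"
    using assms len by (simp add: t_def L_def sorted_list_of_set_nonempty)
  show "\<exists>k\<le>length L. t k = s" if "s \<in> S" for s
  proof -
    from that L(1) have "s \<in> set L" by simp
    then obtain k where "k < length L" "L ! k = s" unfolding in_set_conv_nth by blast
    then show ?thesis by (intro exI[of _ k]) (auto simp: t_def min_def)
  qed
qed

text \<open>Finite-dimensional distributions are a function of the increments along a grid, whose
  joint law is the product of their marginals; equal one-step laws thus give equal laws.\<close>

lemma process_law_eqI: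
  fixes Z Z' :: "real \<Rightarrow> 'a \<Rightarrow> real"
  assumes M: "prob_space M"
    and Z[measurable]: "\<And>t. 0 \<le> t \<Longrightarrow> Z t \<in> borel_measurable M"
    and Z'[measurable]: "\<And>t. 0 \<le> t \<Longrightarrow> Z' t \<in> borel_measurable M"
    and Z0: "AE \<omega> in M. Z 0 \<omega> = 0" "AE \<omega> in M. Z' 0 \<omega> = 0"
    and indep: "\<And>(t :: nat \<Rightarrow> real) n. 0 \<le> t 0 \<Longrightarrow> mono t \<Longrightarrow>
      prob_space.indep_vars M (\<lambda>_. borel) (\<lambda>i \<omega>. Z (t (Suc i)) \<omega> - Z (t i) \<omega>) {..<n}"
    and indep': "\<And>(t :: nat \<Rightarrow> real) n. 0 \<le> t 0 \<Longrightarrow> mono t \<Longrightarrow>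
      prob_space.indep_vars M (\<lambda>_. borel) (\<lambda>i \<omega>. Z' (t (Suc i)) \<omega> - Z' (t i) \<omega>) {..<n}"
    and incr: "\<And>s t. 0 \<le> s \<Longrightarrow> s \<le> t \<Longrightarrow>
      distr M borel (\<lambda>\<omega>. Z t \<omega> - Z s \<omega>) = distr M borel (\<lambda>\<omega>. Z' t \<omega> - Z' s \<omega>)"
  shows "process_law M Z = process_law M Z'"
proof (rule product_borel_measure_eqI[where I="{0..}"])
  interpret prob_space M by fact
  have meas: "(\<lambda>\<omega>. \<lambda>t\<in>{0..}. Y t \<omega>) \<in> M \<rightarrow>\<^sub>M path_space"
    if "\<And>t. 0 \<le> t \<Longrightarrow> Y t \<in> borel_measurable M" for Y :: "real \<Rightarrow> 'a \<Rightarrow> real"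
    using that by (intro measurable_restrict) auto
  show "emeasure (process_law M Z) (space path_space) \<noteq> \<infinity>"
    unfolding process_law_def by (subst emeasure_distr) (auto intro!: meas)
  fix J :: "real set" and a :: "real \<Rightarrow> real" assume J: "finite J" "J \<subseteq> {0..}"
  let ?O = "{w \<in> space path_space. \<forall>i\<in>J. w i \<le> a i}"
  have O: "?O \<in> sets path_space"
    unfolding sets_product_borel_orthants using J by (intro sigma_sets.Basic) blast
  \<comment> \<open>With 0 in the grid the partial sums of increments telescope to Y s - Y 0, which
    is almost surely Y s.\<close>
  have "Min (insert 0 J) = 0" using J by (intro Min_eqI) auto
  with mono_enumeration[of "insert 0 J"] J(1) obtain t :: "nat \<Rightarrow> real" and n where t: "mono t" "t 0 = 0"
    and "\<And>s. s \<in> insert 0 J \<Longrightarrow> \<exists>k\<le>n. t k = s" by auto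
  then have "\<forall>s\<in>J. \<exists>k\<le>n. t k = s" by blast
  then obtain k where k: "\<And>s. s \<in> J \<Longrightarrow> k s \<le> n" "\<And>s. s \<in> J \<Longrightarrow> t (k s) = s" by metis
  have t_nonneg: "0 \<le> t i" for i using monoD[OF t(1), of 0 i] t(2) by simp
  \<comment> \<open>One index more than necessary, so that the index set is nonempty, as the product
    form of independence requires.\<close>
  let ?N = "{..<Suc n}"
  let ?D = "{y \<in> space (product_borel ?N). \<forall>s\<in>J. (\<Sum>i<k s. y i) \<le> a s}"
  have D: "?D \<in> sets (product_borel ?N)"
  proof -
    have "(\<lambda>y. \<Sum>i<k s. y i) \<in> borel_measurable (product_borel ?N)" if "s \<in> J" for s
      using k(1)[OF that] by (intro borel_measurable_sum measurable_component_singleton) auto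
    then show ?thesis using J(1) by measurable
  qed
  have law: "emeasure (process_law M Y) ?O =
      emeasure (\<Pi>\<^sub>M i\<in>?N. distr M borel (\<lambda>\<omega>. Y (t (Suc i)) \<omega> - Y (t i) \<omega>)) ?D"
    if Y[measurable]: "\<And>t. 0 \<le> t \<Longrightarrow> Y t \<in> borel_measurable M" and Y0: "AE \<omega> in M. Y 0 \<omega> = 0"
      and ind: "indep_vars (\<lambda>_. borel) (\<lambda>i \<omega>. Y (t (Suc i)) \<omega> - Y (t i) \<omega>) ?N" for Y
  proof -
    have [measurable]: "s \<in> J \<Longrightarrow> Y s \<in> borel_measurable M" for s using J Y by auto
    have [measurable]: "Y (t i) \<in> borel_measurable M" for i using t_nonneg Y by auto
    have sum: "(\<Sum>i<k s. Y (t (Suc i)) \<omega> - Y (t i) \<omega>) = Y s \<omega> - Y 0 \<omega>" if "s \<in> J" for s \<omega>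
      using k(2)[OF that] t(2) sum_lessThan_telescope[of "\<lambda>i. Y (t i) \<omega>" "k s"] by simp
    have inc[measurable]: "(\<lambda>\<omega>. \<lambda>i\<in>?N. Y (t (Suc i)) \<omega> - Y (t i) \<omega>) \<in> M \<rightarrow>\<^sub>M product_borel ?N"
      by (intro measurable_restrict) measurable
    have "emeasure (process_law M Y) ?O = emeasure M {\<omega> \<in> space M. \<forall>s\<in>J. Y s \<omega> \<le> a s}"
      unfolding process_law_def using J(2) O
      by (subst emeasure_distr[OF meas[OF Y]]) (auto intro!: arg_cong[where f="emeasure M"] simp: space_PiM)
    also have "\<dots> = emeasure M {\<omega> \<in> space M. \<forall>s\<in>J. Y s \<omega> - Y 0 \<omega> \<le> a s}"
      using Y0 J(1) by (intro emeasure_eq_AE) auto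
    also have "\<dots> = emeasure (distr M (product_borel ?N) (\<lambda>\<omega>. \<lambda>i\<in>?N. Y (t (Suc i)) \<omega> - Y (t i) \<omega>)) ?D"
    proof (subst emeasure_distr[OF inc D], rule arg_cong[where f="emeasure M"], intro set_eqI iffI)
      have e: "(\<Sum>i<k s. (\<lambda>i\<in>?N. Y (t (Suc i)) \<omega> - Y (t i) \<omega>) i) = Y s \<omega> - Y 0 \<omega>" if "s \<in> J" for s \<omega>
        unfolding sum[OF that, symmetric] using k(1)[OF that] by (intro sum.cong) auto
      fix \<omega>
      show "\<omega> \<in> (\<lambda>\<omega>. \<lambda>i\<in>?N. Y (t (Suc i)) \<omega> - Y (t i) \<omega>) -` ?D \<inter> space M"
        if "\<omega> \<in> {\<omega> \<in> space M. \<forall>s\<in>J. Y s \<omega> - Y 0 \<omega> \<le> a s}"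
        using that e by (auto simp: space_PiM simp del: restrict_apply sum.lessThan_Suc)
      show "\<omega> \<in> {\<omega> \<in> space M. \<forall>s\<in>J. Y s \<omega> - Y 0 \<omega> \<le> a s}"
        if "\<omega> \<in> (\<lambda>\<omega>. \<lambda>i\<in>?N. Y (t (Suc i)) \<omega> - Y (t i) \<omega>) -` ?D \<inter> space M"
        using that e by (auto simp: space_PiM simp del: restrict_apply sum.lessThan_Suc)
    qed
    also have "distr M (product_borel ?N) (\<lambda>\<omega>. \<lambda>i\<in>?N. Y (t (Suc i)) \<omega> - Y (t i) \<omega>) =
        (\<Pi>\<^sub>M i\<in>?N. distr M borel (\<lambda>\<omega>. Y (t (Suc i)) \<omega> - Y (t i) \<omega>))"
      using ind by (subst (asm) indep_vars_iff_distr_eq_PiM) auto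
    finally show ?thesis .
  qed
  have "distr M borel (\<lambda>\<omega>. Z (t (Suc i)) \<omega> - Z (t i) \<omega>) = distr M borel (\<lambda>\<omega>. Z' (t (Suc i)) \<omega> - Z' (t i) \<omega>)" for i
    using t_nonneg monoD[OF t(1), of i "Suc i"] by (intro incr) auto
  then show "emeasure (process_law M Z) ?O = emeasure (process_law M Z') ?O"
    using law[OF Z Z0(1) indep[OF _ t(1)]] law[OF Z' Z0(2) indep'[OF _ t(1)]] t(2) by simp
qed (simp_all add: process_law_def)

section \<open>Levy processes at a fixed time\<close>

lemma levy_processD:
  assumes "levy_process M Z x"
  shows "prob_space M" "\<And>t. 0 \<le> t \<Longrightarrow> Z t \<in> borel_measurable M" "AE \<omega> in M. Z 0 \<omega> = x"
    "AE \<omega> in M. cadlag (\<lambda>t. Z t \<omega>)"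
    "\<And>(t :: nat \<Rightarrow> real) n. 0 \<le> t 0 \<Longrightarrow> mono t \<Longrightarrow>
      prob_space.indep_vars M (\<lambda>_. borel) (\<lambda>i \<omega>. Z (t (Suc i)) \<omega> - Z (t i) \<omega>) {..<n}"
    "\<And>s t. 0 \<le> s \<Longrightarrow> 0 \<le> t \<Longrightarrow>
      distr M borel (\<lambda>\<omega>. Z (s + t) \<omega> - Z s \<omega>) = distr M borel (\<lambda>\<omega>. Z t \<omega> - Z 0 \<omega>)"
  using assms unfolding levy_process_def by blast+

text \<open>Increments of the shifted process are increments of Z along the translated grid, and
  stationarity reduces both kinds to the same law.\<close>

lemma levy_shift_law:
  assumes Z: "levy_process M Z 0" and r: "0 \<le> r"
  shows "process_law M (\<lambda>v \<omega>. Z (r + v) \<omega> - Z r \<omega>) = process_law M Z"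
proof (rule process_law_eqI[OF levy_processD(1)[OF Z]])
  show "(\<lambda>\<omega>. Z (r + t) \<omega> - Z r \<omega>) \<in> borel_measurable M" if "0 \<le> t" for t
    using that r by (intro borel_measurable_diff levy_processD(2)[OF Z]) auto
  show "prob_space.indep_vars M (\<lambda>_. borel)
      (\<lambda>i \<omega>. Z (r + t (Suc i)) \<omega> - Z r \<omega> - (Z (r + t i) \<omega> - Z r \<omega>)) {..<n}"
    if t: "0 \<le> t 0" "mono t" for t :: "nat \<Rightarrow> real" and n
    using levy_processD(5)[OF Z, of "\<lambda>i. r + t i" n] t r by (simp add: mono_def)
  show "distr M borel (\<lambda>\<omega>. Z (r + t) \<omega> - Z r \<omega> - (Z (r + s) \<omega> - Z r \<omega>)) =
      distr M borel (\<lambda>\<omega>. Z t \<omega> - Z s \<omega>)" if "0 \<le> s" "s \<le> t" for s t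
    using levy_processD(6)[OF Z, of "r + s" "t - s"] levy_processD(6)[OF Z, of s "t - s"] that r by simp
qed (use levy_processD(2,3,5)[OF Z] in auto)

text \<open>The past is encoded as the path stopped at r, so past and future live in the same path
  space. On orthants they are functions of two disjoint blocks of increments of one grid; the
  general case follows by uniqueness of measures, in E and then in D.\<close>

lemma levy_markov:
  assumes Z: "levy_process M Z 0" and r: "0 \<le> r"
    and D: "D \<in> sets path_space" and E: "E \<in> sets path_space"
  shows "emeasure M {\<omega> \<in> space M. (\<lambda>v\<in>{0..}. Z (min v r) \<omega>) \<in> D \<and>
      (\<lambda>v\<in>{0..}. Z (r + v) \<omega> - Z r \<omega>) \<in> E} =
    emeasure M {\<omega> \<in> space M. (\<lambda>v\<in>{0..}. Z (min v r) \<omega>) \<in> D} * emeasure (process_law M Z) E"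
proof -
  interpret prob_space M by (rule levy_processD(1)[OF Z])
  define S where "S \<omega> = (\<lambda>v\<in>{0..}. Z (min v r) \<omega>)" for \<omega>
  define I where "I \<omega> = (\<lambda>v\<in>{0..}. Z (r + v) \<omega> - Z r \<omega>)" for \<omega>
  have S[measurable]: "S \<in> M \<rightarrow>\<^sub>M path_space"
    unfolding S_def[abs_def] using r by (intro measurable_restrict levy_processD(2)[OF Z]) auto
  have I[measurable]: "I \<in> M \<rightarrow>\<^sub>M path_space"
    unfolding I_def[abs_def] using r
    by (intro measurable_restrict borel_measurable_diff levy_processD(2)[OF Z]) auto
  have law: "distr M path_space I = process_law M Z"
    using levy_shift_law[OF Z r] unfolding process_law_def I_def[abs_def] .
  have O[measurable]: "{w \<in> space path_space. \<forall>i\<in>J. w i \<le> a i} \<in> sets path_space"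
    if "finite J" "J \<subseteq> {0..}" for J :: "real set" and a
    unfolding sets_product_borel_orthants using that by (intro sigma_sets.Basic) blast
  have orthants: "emeasure M (S -` {w \<in> space path_space. \<forall>i\<in>J. w i \<le> a i} \<inter>
        I -` {w \<in> space path_space. \<forall>i\<in>K. w i \<le> b i} \<inter> space M) =
      emeasure M (S -` {w \<in> space path_space. \<forall>i\<in>J. w i \<le> a i} \<inter> space M) *
      emeasure M (I -` {w \<in> space path_space. \<forall>i\<in>K. w i \<le> b i} \<inter> space M)"
    (is "emeasure M (S -` ?D \<inter> I -` ?E \<inter> space M) = _")
    if J: "finite J" "J \<subseteq> {0..}" and K: "finite K" "K \<subseteq> {0..}" for J K :: "real set" and a b
  proof -
    \<comment> \<open>All times occurring in the two orthants; r belongs to the grid so that its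
      index p separates the blocks.\<close>
    let ?T = "insert 0 (insert r ((\<lambda>i. min i r) ` J \<union> (\<lambda>i. r + i) ` K))"
    have finT: "finite ?T" using J K by auto
    have "Min ?T = 0" using finT J K r by (intro Min_eqI) auto
    with mono_enumeration[OF finT] obtain t :: "nat \<Rightarrow> real" and n where t: "mono t" "t 0 = 0"
      and ex: "\<And>s. s \<in> ?T \<Longrightarrow> \<exists>k\<le>n. t k = s" by auto
    from ex[of r] obtain p where p: "p \<le> n" "t p = r" by auto
    \<comment> \<open>The value r may occur in the grid at indices other than p, so the index has to
      be chosen on the right side of p.\<close>
    have "\<exists>k\<le>p. t k = min s r" if s: "s \<in> J" for s
    proof -
      obtain k where k: "k \<le> n" "t k = min s r" using ex[of "min s r"] s by auto
      show ?thesis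
      proof (cases "k \<le> p")
        case False
        then have "t p \<le> t k" using monoD[OF t(1), of p k] by simp
        then have "t k = t p" using k p by simp
        then show ?thesis using k by (intro exI[of _ p]) simp
      qed (use k in auto)
    qed
    then have "\<forall>s\<in>J. \<exists>k\<le>p. t k = min s r" by blast
    then obtain k where k: "\<And>s. s \<in> J \<Longrightarrow> k s \<le> p" "\<And>s. s \<in> J \<Longrightarrow> t (k s) = min s r" by metis
    have "\<exists>k\<le>n. p \<le> k \<and> t k = r + s" if s: "s \<in> K" for s
    proof -
      obtain k where k: "k \<le> n" "t k = r + s" using ex[of "r + s"] s by auto
      show ?thesis
      proof (cases "p \<le> k")
        case False
        then have "t k \<le> t p" using monoD[OF t(1), of k p] by simp
        moreover have "0 \<le> s" using s K by auto
        ultimately have "t k = t p" using k p by simp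
        then show ?thesis using k p by (intro exI[of _ p]) simp
      qed (use k in auto)
    qed
    then have "\<forall>s\<in>K. \<exists>k\<le>n. p \<le> k \<and> t k = r + s" by blast
    then obtain l where l: "\<And>s. s \<in> K \<Longrightarrow> l s \<le> n" "\<And>s. s \<in> K \<Longrightarrow> p \<le> l s"
      "\<And>s. s \<in> K \<Longrightarrow> t (l s) = r + s" by metis
    have t_nonneg: "0 \<le> t i" for i using monoD[OF t(1), of 0 i] t(2) by simp
    have [measurable]: "Z (t i) \<in> borel_measurable M" for i using t_nonneg levy_processD(2)[OF Z] by auto
    let ?d = "\<lambda>i \<omega>. Z (t (Suc i)) \<omega> - Z (t i) \<omega>"
    let ?D' = "{y \<in> space (product_borel {..<p}). \<forall>s\<in>J. (\<Sum>i<k s. y i) \<le> a s}"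
    let ?E' = "{y \<in> space (product_borel {p..<n}). \<forall>s\<in>K. (\<Sum>i=p..<l s. y i) \<le> b s}"
    have D': "?D' \<in> sets (product_borel {..<p})"
    proof -
      have "(\<lambda>y. \<Sum>i<k s. y i) \<in> borel_measurable (product_borel {..<p})" if "s \<in> J" for s
        using k(1)[OF that] by (intro borel_measurable_sum measurable_component_singleton) auto
      then show ?thesis using J(1) by measurable
    qed
    have E': "?E' \<in> sets (product_borel {p..<n})"
    proof -
      have "(\<lambda>y. \<Sum>i=p..<l s. y i) \<in> borel_measurable (product_borel {p..<n})" if "s \<in> K" for s
        using l(1)[OF that] by (intro borel_measurable_sum measurable_component_singleton) auto
      then show ?thesis using K(1) by measurable
    qed
    let ?U = "\<lambda>\<omega>. \<lambda>i\<in>{..<p}. ?d i \<omega>" and ?V = "\<lambda>\<omega>. \<lambda>i\<in>{p..<n}. ?d i \<omega>"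
    have [measurable]: "?U \<in> M \<rightarrow>\<^sub>M product_borel {..<p}" "?V \<in> M \<rightarrow>\<^sub>M product_borel {p..<n}"
      by (intro measurable_restrict; measurable)+
    have "indep_vars (\<lambda>_. borel) ?d {..<n}"
      using levy_processD(5)[OF Z _ t(1)] t(2) by simp
    then have "indep_var (product_borel {..<p}) ?U (product_borel {p..<n}) ?V"
      by (rule indep_var_restrict) (use p(1) in auto)
    from indep_varD[OF this D' E']
    have "prob ((\<lambda>\<omega>. (?U \<omega>, ?V \<omega>)) -` (?D' \<times> ?E') \<inter> space M) =
        prob (?U -` ?D' \<inter> space M) * prob (?V -` ?E' \<inter> space M)" .
    moreover have "(\<lambda>\<omega>. (?U \<omega>, ?V \<omega>)) -` (?D' \<times> ?E') \<inter> space M =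
        (?U -` ?D' \<inter> space M) \<inter> (?V -` ?E' \<inter> space M)" by auto
    ultimately have ind: "emeasure M ((?U -` ?D' \<inter> space M) \<inter> (?V -` ?E' \<inter> space M)) =
        emeasure M (?U -` ?D' \<inter> space M) * emeasure M (?V -` ?E' \<inter> space M)"
      by (simp add: emeasure_eq_measure ennreal_mult del: Int_iff)
    have sumU: "(\<Sum>i<k s. ?U \<omega> i) = Z (min s r) \<omega> - Z 0 \<omega>" if "s \<in> J" for s \<omega>
    proof -
      have "(\<Sum>i<k s. ?U \<omega> i) = (\<Sum>i<k s. ?d i \<omega>)"
        using k(1)[OF that] by (intro sum.cong) auto
      then show ?thesis
        using k(2)[OF that] t(2) sum_lessThan_telescope[of "\<lambda>i. Z (t i) \<omega>" "k s"] by simp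
    qed
    have sumV: "(\<Sum>i=p..<l s. ?V \<omega> i) = Z (r + s) \<omega> - Z r \<omega>" if "s \<in> K" for s \<omega>
    proof -
      have "(\<Sum>i=p..<l s. ?V \<omega> i) = (\<Sum>i=p..<l s. ?d i \<omega>)"
        using l(1)[OF that] by (intro sum.cong) auto
      then show ?thesis
        using l(3)[OF that] p(2) sum_Suc_diff'[OF l(2)[OF that], of "\<lambda>i. Z (t i) \<omega>"] by simp
    qed
    have I_at: "I \<omega> s = Z (r + s) \<omega> - Z r \<omega>" if "s \<in> K" for s \<omega>
      using that K(2) by (auto simp: I_def)
    have S_at: "S \<omega> s = Z (min s r) \<omega>" if "s \<in> J" for s \<omega>
      using that J(2) by (auto simp: S_def)
    have sp: "S \<omega> \<in> space path_space" "I \<omega> \<in> space path_space"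
      "?U \<omega> \<in> space (product_borel {..<p})" "?V \<omega> \<in> space (product_borel {p..<n})" for \<omega>
      by (simp_all add: S_def I_def space_PiM)
    have memV: "\<omega> \<in> I -` ?E \<longleftrightarrow> \<omega> \<in> ?V -` ?E'" for \<omega>
      unfolding vimage_eq mem_Collect_eq by (simp only: sp simp_thms sumV I_at cong: ball_cong)
    have memU: "\<omega> \<in> S -` ?D \<longleftrightarrow> \<omega> \<in> ?U -` ?D'" if "Z 0 \<omega> = 0" for \<omega>
      unfolding vimage_eq mem_Collect_eq
      by (simp only: sp simp_thms sumU S_at that diff_zero cong: ball_cong)
    have Z0: "AE \<omega> in M. Z 0 \<omega> = 0" by (rule levy_processD(3)[OF Z])
    have [measurable]: "?D \<in> sets path_space" "?E \<in> sets path_space"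
      by (rule O[OF J], rule O[OF K])
    have "emeasure M (S -` ?D \<inter> I -` ?E \<inter> space M) =
        emeasure M ((?U -` ?D' \<inter> space M) \<inter> (?V -` ?E' \<inter> space M))"
    proof (rule emeasure_eq_AE)
      show "AE \<omega> in M. (\<omega> \<in> S -` ?D \<inter> I -` ?E \<inter> space M) =
          (\<omega> \<in> (?U -` ?D' \<inter> space M) \<inter> (?V -` ?E' \<inter> space M))"
        using Z0 by eventually_elim (simp only: Int_iff memU memV, blast)
      have "S -` ?D \<inter> I -` ?E \<inter> space M = (S -` ?D \<inter> space M) \<inter> (I -` ?E \<inter> space M)" by blast
      also have "\<dots> \<in> sets M" by measurable
      finally show "S -` ?D \<inter> I -` ?E \<inter> space M \<in> sets M" .
      show "(?U -` ?D' \<inter> space M) \<inter> (?V -` ?E' \<inter> space M) \<in> sets M"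
        using D' E' by (intro sets.Int measurable_sets) auto
    qed
    moreover have "emeasure M (S -` ?D \<inter> space M) = emeasure M (?U -` ?D' \<inter> space M)"
    proof (rule emeasure_eq_AE)
      show "AE \<omega> in M. (\<omega> \<in> S -` ?D \<inter> space M) = (\<omega> \<in> ?U -` ?D' \<inter> space M)"
        using Z0 by eventually_elim (simp only: Int_iff memU)
      show "?U -` ?D' \<inter> space M \<in> sets M" using D' by (intro measurable_sets) auto
    qed measurable
    moreover have "I -` ?E \<inter> space M = ?V -` ?E' \<inter> space M" using memV by blast
    ultimately show ?thesis using ind by simp
  qed
  \<comment> \<open>For a fixed orthant in the past, both sides are finite measures in E that agree
    on orthants by the previous step.\<close>
  have step: "emeasure M (S -` {w \<in> space path_space. \<forall>i\<in>J. w i \<le> a i} \<inter> I -` E \<inter> space M) =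
      emeasure M (S -` {w \<in> space path_space. \<forall>i\<in>J. w i \<le> a i} \<inter> space M) * emeasure (distr M path_space I) E"
    (is "emeasure M (S -` ?D \<inter> _ \<inter> _) = _")
    if J: "finite J" "J \<subseteq> {0..}" for J :: "real set" and a
  proof -
    note [measurable] = O[OF J]
    let ?A = "distr (restrict_space M (S -` ?D \<inter> space M)) path_space I"
    let ?B = "scale_measure (emeasure M (S -` ?D \<inter> space M)) (distr M path_space I)"
    have A: "emeasure ?A F = emeasure M (S -` ?D \<inter> I -` F \<inter> space M)" if [measurable]: "F \<in> sets path_space" for F
      by (subst emeasure_distr, (auto intro!: measurable_restrict_space1)[2], subst emeasure_restrict_space)
        (auto simp: space_restrict_space intro!: arg_cong[where f="emeasure M"])
    have "?A = ?B"
    proof (rule product_borel_measure_eqI[where I="{0..}"])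
      fix K :: "real set" and b :: "real \<Rightarrow> real" assume K: "finite K" "K \<subseteq> {0..}"
      show "emeasure ?A {w \<in> space path_space. \<forall>i\<in>K. w i \<le> b i} = emeasure ?B {w \<in> space path_space. \<forall>i\<in>K. w i \<le> b i}"
        by (simp only: A[OF O[OF K]] emeasure_scale_measure emeasure_distr[OF I O[OF K]] orthants[OF J K])
    next
      show "emeasure ?A (space path_space) \<noteq> \<infinity>"
        unfolding A[OF sets.top] by (simp add: emeasure_eq_measure)
    qed simp_all
    then have "emeasure ?A E = emeasure ?B E" by simp
    then show ?thesis by (simp only: A[OF E] emeasure_scale_measure)
  qed
  have "emeasure M (S -` D \<inter> I -` E \<inter> space M) = emeasure M (S -` D \<inter> space M) * emeasure (distr M path_space I) E"
  proof -
    note [measurable] = E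
    let ?A = "distr (restrict_space M (I -` E \<inter> space M)) path_space S"
    let ?B = "scale_measure (emeasure (distr M path_space I) E) (distr M path_space S)"
    have A: "emeasure ?A F = emeasure M (S -` F \<inter> I -` E \<inter> space M)" if [measurable]: "F \<in> sets path_space" for F
      by (subst emeasure_distr, (auto intro!: measurable_restrict_space1)[2], subst emeasure_restrict_space)
        (auto simp: space_restrict_space intro!: arg_cong[where f="emeasure M"])
    have "?A = ?B"
    proof (rule product_borel_measure_eqI[where I="{0..}"])
      fix J :: "real set" and a :: "real \<Rightarrow> real" assume J: "finite J" "J \<subseteq> {0..}"
      show "emeasure ?A {w \<in> space path_space. \<forall>i\<in>J. w i \<le> a i} = emeasure ?B {w \<in> space path_space. \<forall>i\<in>J. w i \<le> a i}"
        by (simp only: A[OF O[OF J]] emeasure_scale_measure emeasure_distr[OF S O[OF J]] step[OF J] mult.commute)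
    next
      show "emeasure ?A (space path_space) \<noteq> \<infinity>"
        unfolding A[OF sets.top] by (simp add: emeasure_eq_measure)
    qed simp_all
    then have "emeasure ?A D = emeasure ?B D" by simp
    then show ?thesis
      by (simp only: A[OF D] emeasure_scale_measure emeasure_distr[OF S D] mult.commute)
  qed
  moreover have "S -` D \<inter> I -` E \<inter> space M = {\<omega> \<in> space M. S \<omega> \<in> D \<and> I \<omega> \<in> E}"
    "S -` D \<inter> space M = {\<omega> \<in> space M. S \<omega> \<in> D}" by auto
  ultimately show ?thesis unfolding law S_def I_def by simp
qed

section \<open>Passing to the limit in laws on product spaces\<close>

definition ramp :: "nat \<Rightarrow> real \<Rightarrow> real" where
  "ramp k y = max 0 (min 1 (1 - real k * y))"

lemma ramp_bounds: "0 \<le> ramp k y" "ramp k y \<le> 1"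
  by (auto simp: ramp_def)

lemma ramp_tendsto: "(\<lambda>k. ramp k y) \<longlonglongrightarrow> (if y \<le> 0 then 1 else 0)"
proof (cases "y \<le> 0")
  case True
  then have "real k * y \<le> 0" for k by (simp add: mult_nonneg_nonpos)
  then show ?thesis using True by (simp add: ramp_def)
next
  case False
  obtain n :: nat where n: "1 < real n * y" using False reals_Archimedean3[of y] by force
  have "eventually (\<lambda>k. 0 = ramp k y) sequentially"
    using eventually_ge_at_top[of n]
  proof eventually_elim
    case (elim k)
    then have "real n * y \<le> real k * y" using False by (intro mult_right_mono) auto
    then show ?case using n by (simp add: ramp_def)
  qed
  from Lim_transform_eventually[OF tendsto_const this] show ?thesis using False by simp
qed

lemma tendsto_ramp: "(f \<longlongrightarrow> l) F \<Longrightarrow> ((\<lambda>x. ramp k (f x)) \<longlongrightarrow> ramp k l) F"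
  unfolding ramp_def by (intro tendsto_intros)

text \<open>Products of ramps are bounded continuous functions of finitely many coordinates
  decreasing to the indicator of an orthant. For fixed k, dominated convergence in n shows that the
  limit law and \<mu> integrate them equally; letting k grow then gives the orthants
  themselves.\<close>

lemma distr_eq_of_tendsto:
  fixes S :: "'a \<Rightarrow> 'i \<Rightarrow> real"
  assumes M: "prob_space M"
    and Sn[measurable]: "\<And>n. Sn n \<in> M \<rightarrow>\<^sub>M product_borel I"
    and S[measurable]: "S \<in> M \<rightarrow>\<^sub>M product_borel I"
    and law: "\<And>n. distr M (product_borel I) (Sn n) = \<mu>"
    and lim: "AE \<omega> in M. \<forall>i\<in>I. (\<lambda>n. Sn n \<omega> i) \<longlonglongrightarrow> S \<omega> i"
  shows "distr M (product_borel I) S = \<mu>"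
proof (rule product_borel_measure_eqI[where I=I])
  interpret prob_space M by fact
  have \<mu>_sets[measurable_cong]: "sets \<mu> = sets (product_borel I)" unfolding law[of 0, symmetric] by simp
  interpret \<mu>: prob_space \<mu> unfolding law[of 0, symmetric] by (rule prob_space_distr) simp
  interpret D: prob_space "distr M (product_borel I) S" by (rule prob_space_distr) simp
  fix J :: "'i set" and a :: "'i \<Rightarrow> real" assume J: "finite J" "J \<subseteq> I"
  have [measurable]: "i \<in> J \<Longrightarrow> (\<lambda>w. w i) \<in> borel_measurable (product_borel I)" for i
    using J by (intro measurable_component_singleton) auto
  have [measurable]: "ramp k \<in> borel_measurable borel" for k
    unfolding ramp_def[abs_def] by measurable
  define f where "f k w = (\<Prod>i\<in>J. ramp k (w i - a i))" for k and w :: "'i \<Rightarrow> real"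
  have f[measurable]: "f k \<in> borel_measurable (product_borel I)" for k
    unfolding f_def[abs_def] by measurable
  have f_bound: "norm (f k w) \<le> 1" for k w
    unfolding f_def using ramp_bounds by (auto simp: abs_prod intro!: prod_le_1)
  let ?O = "{w \<in> space (product_borel I). \<forall>i\<in>J. w i \<le> a i}"
  have O[measurable]: "?O \<in> sets (product_borel I)" using J(1) by measurable
  have int_eq: "integral\<^sup>L (distr M (product_borel I) S) (f k) = integral\<^sup>L \<mu> (f k)" for k
  proof -
    have "(\<lambda>n. \<integral>\<omega>. f k (Sn n \<omega>) \<partial>M) \<longlonglongrightarrow> (\<integral>\<omega>. f k (S \<omega>) \<partial>M)"
    proof (rule integral_dominated_convergence[where w="\<lambda>_. 1"])
      show "AE \<omega> in M. (\<lambda>n. f k (Sn n \<omega>)) \<longlonglongrightarrow> f k (S \<omega>)"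
        using lim
      proof eventually_elim
        case (elim \<omega>)
        then show ?case
          unfolding f_def using J by (intro tendsto_prod tendsto_ramp tendsto_diff tendsto_const) auto
      qed
    qed (use f_bound in auto)
    moreover have "(\<integral>\<omega>. f k (Sn n \<omega>) \<partial>M) = integral\<^sup>L \<mu> (f k)" for n
      unfolding law[of n, symmetric] by (subst integral_distr) auto
    ultimately have "(\<integral>\<omega>. f k (S \<omega>) \<partial>M) = integral\<^sup>L \<mu> (f k)"
      by (simp add: LIMSEQ_const_iff)
    then show ?thesis by (subst integral_distr) auto
  qed
  have f_lim: "(\<lambda>k. f k w) \<longlonglongrightarrow> indicator ?O w" if "w \<in> space (product_borel I)" for w
  proof -
    have "(\<lambda>k. f k w) \<longlonglongrightarrow> (\<Prod>i\<in>J. if w i - a i \<le> 0 then 1 else 0)"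
      unfolding f_def by (intro tendsto_prod ramp_tendsto)
    also have "(\<Prod>i\<in>J. if w i - a i \<le> 0 then 1 else 0) = (indicator ?O w :: real)"
      using that J(1) by (auto simp: indicator_def intro!: prod.neutral)
    finally show ?thesis .
  qed
  have conv: "(\<lambda>k. integral\<^sup>L \<nu> (f k)) \<longlonglongrightarrow> measure \<nu> ?O"
    if \<nu>: "prob_space \<nu>" "sets \<nu> = sets (product_borel I)" for \<nu>
  proof -
    interpret \<nu>: prob_space \<nu> by fact
    note [measurable_cong] = \<nu>(2)
    have sp: "space \<nu> = space (product_borel I)" using \<nu>(2) by (rule sets_eq_imp_space_eq)
    have "(\<lambda>k. integral\<^sup>L \<nu> (f k)) \<longlonglongrightarrow> (\<integral>w. indicator ?O w \<partial>\<nu>)"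
      by (rule integral_dominated_convergence[where w="\<lambda>_. 1"]) (use f_bound f_lim sp in auto)
    also have "(\<integral>w. indicator ?O w \<partial>\<nu>) = measure \<nu> ?O"
      unfolding Bochner_Integration.integral_indicator
      by (rule arg_cong[where f="measure \<nu>"]) (auto simp: sp)
    finally show ?thesis .
  qed
  have "measure (distr M (product_borel I) S) ?O = measure \<mu> ?O"
    using LIMSEQ_unique[OF conv[OF D.prob_space_axioms] conv[OF \<mu>.prob_space_axioms \<mu>_sets, folded int_eq]] by simp
  then show "emeasure (distr M (product_borel I) S) ?O = emeasure \<mu> ?O"
    by (simp add: D.emeasure_eq_measure \<mu>.emeasure_eq_measure)
next
  interpret prob_space M by fact
  interpret D: prob_space "distr M (product_borel I) S" by (rule prob_space_distr) simp
  show "emeasure (distr M (product_borel I) S) (space (product_borel I)) \<noteq> \<infinity>"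
    by (simp add: D.emeasure_eq_measure)
  show "sets \<mu> = sets (product_borel I)" unfolding law[of 0, symmetric] by simp
qed simp

section \<open>The strong Markov property\<close>

definition shift_path :: "(real \<Rightarrow> real) \<Rightarrow> real \<Rightarrow> real \<Rightarrow> real" where
  "shift_path w s = (\<lambda>v\<in>{0..}. reg w (s + v) - reg w s)"

text \<open>Joint measurability in the path and the shift is what allows the shift to be a random
  time; this is the reason for \<open>reg\<close> in \<open>shift_path\<close>.\<close>

lemma measurable_shift_path:
  "(\<lambda>p. shift_path (fst p) (snd p)) \<in> path_space \<Otimes>\<^sub>M borel \<rightarrow>\<^sub>M path_space"
  unfolding shift_path_def
proof (rule measurable_restrict)
  fix v :: real
  have "(\<lambda>p. reg (fst p) (snd p + v)) \<in> borel_measurable (path_space \<Otimes>\<^sub>M borel)"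
    by (rule measurable_compose[OF _ measurable_reg, of "\<lambda>p. (fst p, snd p + v)", simplified]) measurable
  then show "(\<lambda>p. reg (fst p) (snd p + v) - reg (fst p) (snd p)) \<in> borel_measurable (path_space \<Otimes>\<^sub>M borel)"
    by (intro borel_measurable_diff measurable_reg)
qed

text \<open>The random time is approximated from the right by dyadic times, at which the Markov property
  holds. The hypothesis \<open>local\<close> says that \<open>\<tau>\<close> is an optional time and that \<open>H\<close> is determined by
  the path up to \<open>\<tau>\<close>.\<close>

lemma levy_strong_markov:
  assumes Z: "levy_process M Z 0"
    and \<tau>[measurable]: "\<tau> \<in> borel_measurable path_space" and \<tau>_nonneg: "\<And>w. 0 \<le> (\<tau> w :: ereal)"
    and H[measurable]: "H \<in> path_space \<rightarrow>\<^sub>M N"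
    and local: "\<And>w1 w2 r. (\<And>v. 0 \<le> v \<Longrightarrow> v \<le> r \<Longrightarrow> w1 v = w2 v) \<Longrightarrow> \<tau> w1 < ereal r \<Longrightarrow>
      \<tau> w2 = \<tau> w1 \<and> H w2 = H w1"
    and D[measurable]: "D \<in> sets N" and E[measurable]: "E \<in> sets path_space"
  defines "R \<equiv> \<lambda>\<omega>. \<lambda>v\<in>{0..}. Z v \<omega>"
  shows "emeasure M {\<omega> \<in> space M. \<tau> (R \<omega>) < \<infinity> \<and> H (R \<omega>) \<in> D \<and>
      shift_path (R \<omega>) (real_of_ereal (\<tau> (R \<omega>))) \<in> E} =
    emeasure M {\<omega> \<in> space M. \<tau> (R \<omega>) < \<infinity> \<and> H (R \<omega>) \<in> D} * emeasure (process_law M Z) E"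
proof -
  interpret prob_space M by (rule levy_processD(1)[OF Z])
  have R[measurable]: "R \<in> M \<rightarrow>\<^sub>M path_space"
    unfolding R_def by (intro measurable_restrict levy_processD(2)[OF Z]) auto
  \<comment> \<open>Where \<tau> is infinite this takes the default value 0, which the restriction
    to G makes irrelevant.\<close>
  define \<sigma> where "\<sigma> \<omega> = real_of_ereal (\<tau> (R \<omega>))" for \<omega>
  have \<sigma>[measurable]: "\<sigma> \<in> borel_measurable M" unfolding \<sigma>_def[abs_def] by measurable
  have \<sigma>_nonneg: "0 \<le> \<sigma> \<omega>" for \<omega> unfolding \<sigma>_def using \<tau>_nonneg by (simp add: real_of_ereal_pos)
  define G where "G = {\<omega> \<in> space M. \<tau> (R \<omega>) < \<infinity> \<and> H (R \<omega>) \<in> D}"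
  have G[measurable]: "G \<in> sets M" unfolding G_def by measurable
  define S where "S \<omega> = shift_path (R \<omega>) (\<sigma> \<omega>)" for \<omega>
  have S[measurable]: "S \<in> M \<rightarrow>\<^sub>M path_space"
    unfolding S_def[abs_def]
    by (rule measurable_compose[OF _ measurable_shift_path, of "\<lambda>\<omega>. (R \<omega>, \<sigma> \<omega>)", simplified]) measurable
  \<comment> \<open>The index of the level-n dyadic time strictly after \<sigma>; \<open>Sn\<close>
    restarts at that time.\<close>
  define k where "k n \<omega> = nat \<lfloor>2 ^ n * \<sigma> \<omega>\<rfloor>" for n :: nat and \<omega>
  have k[measurable]: "k n \<in> M \<rightarrow>\<^sub>M count_space UNIV" for n unfolding k_def[abs_def] by measurable
  define r where "r n i = (real i + 1) / 2 ^ n" for n i :: nat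
  have r_nonneg: "0 \<le> r n i" for n i by (simp add: r_def)
  have r_k: "r n (k n \<omega>) = dyadic_succ n (\<sigma> \<omega>)" for n \<omega> by (simp add: r_def k_def dyadic_succ_def)
  define I where "I n i \<omega> = (\<lambda>v\<in>{0..}. Z (r n i + v) \<omega> - Z (r n i) \<omega>)" for n i \<omega>
  have I[measurable]: "I n i \<in> M \<rightarrow>\<^sub>M path_space" for n i
    unfolding I_def[abs_def] using r_nonneg[of n i]
    by (intro measurable_restrict borel_measurable_diff levy_processD(2)[OF Z]) auto
  define Sn where "Sn n \<omega> = I n (k n \<omega>) \<omega>" for n \<omega>
  have Sn[measurable]: "Sn n \<in> M \<rightarrow>\<^sub>M path_space" for n
    unfolding Sn_def[abs_def] by (rule measurable_compose_countable[OF I k])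
  \<comment> \<open>Decomposing G by the value of \<open>k n\<close> leaves one fixed restart time
    on each piece, to which \<open>levy_markov\<close> applies.\<close>
  have dyadic: "emeasure M (G \<inter> (Sn n -` F \<inter> space M)) = emeasure M G * emeasure (process_law M Z) F"
    if F[measurable]: "F \<in> sets path_space" for n F
  proof -
    define Gi where "Gi i = {\<omega> \<in> G. k n \<omega> = i}" for i
    have Gi[measurable]: "Gi i \<in> sets M" for i
    proof -
      have "Gi i = G \<inter> (k n -` {i} \<inter> space M)" unfolding Gi_def G_def by auto
      then show ?thesis by simp
    qed
    have disj: "disjoint_family Gi" "disjoint_family (\<lambda>i. Gi i \<inter> (I n i -` F \<inter> space M))"
      by (auto simp: disjoint_family_on_def Gi_def)
    have step: "emeasure M (Gi i \<inter> (I n i -` F \<inter> space M)) = emeasure M (Gi i) * emeasure (process_law M Z) F" for i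
    proof -
      define C where "C = {w \<in> space path_space. \<tau> w < \<infinity> \<and> H w \<in> D \<and> nat \<lfloor>2 ^ n * real_of_ereal (\<tau> w)\<rfloor> = i}"
      have C[measurable]: "C \<in> sets path_space" unfolding C_def by measurable
      have less: "\<tau> w < ereal (r n i)" if fin: "\<tau> w < \<infinity>" and i: "nat \<lfloor>2 ^ n * real_of_ereal (\<tau> w)\<rfloor> = i" for w
      proof -
        obtain z where z: "\<tau> w = ereal z" "0 \<le> z" using fin \<tau>_nonneg[of w] by (cases "\<tau> w") auto
        show ?thesis
          using dyadic_succ_gt[OF z(2), of n] i z(1) by (simp add: dyadic_succ_def r_def)
      qed
      \<comment> \<open>On this piece \<tau> lies strictly below \<open>r n i\<close>, so by
        locality the event can be tested on the stopped path, that is, on the past in the sense of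
        \<open>levy_markov\<close>.\<close>
      have stop: "(\<lambda>v\<in>{0..}. Z (min v (r n i)) \<omega>) \<in> C \<longleftrightarrow> \<omega> \<in> Gi i" if \<omega>: "\<omega> \<in> space M" for \<omega>
      proof -
        define w where "w = (\<lambda>v\<in>{0..}. Z (min v (r n i)) \<omega>)"
        have eq: "w v = R \<omega> v" if "0 \<le> v" "v \<le> r n i" for v
          using that by (simp add: w_def R_def)
        have w: "w \<in> space path_space" by (simp add: w_def space_PiM)
        show ?thesis
          unfolding w_def[symmetric]
        proof
          assume C: "w \<in> C"
          then have "\<tau> w < ereal (r n i)" by (intro less) (auto simp: C_def)
          from local[OF eq this] C \<omega> show "\<omega> \<in> Gi i"
            by (auto simp: C_def Gi_def G_def k_def \<sigma>_def)
        next
          assume Gi: "\<omega> \<in> Gi i"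
          then have "\<tau> (R \<omega>) < ereal (r n i)" by (intro less) (auto simp: Gi_def G_def k_def \<sigma>_def)
          from local[OF eq[symmetric] this] Gi w show "w \<in> C"
            by (auto simp: C_def Gi_def G_def k_def \<sigma>_def)
        qed
      qed
      have "Gi i \<inter> (I n i -` F \<inter> space M) = {\<omega> \<in> space M. (\<lambda>v\<in>{0..}. Z (min v (r n i)) \<omega>) \<in> C \<and>
          (\<lambda>v\<in>{0..}. Z (r n i + v) \<omega> - Z (r n i) \<omega>) \<in> F}"
        using stop by (auto simp: I_def)
      moreover have "Gi i = {\<omega> \<in> space M. (\<lambda>v\<in>{0..}. Z (min v (r n i)) \<omega>) \<in> C}"
        using stop by (auto simp: Gi_def G_def)
      ultimately show ?thesis
        using levy_markov[OF Z r_nonneg[of n i] C F] by simp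
    qed
    have "G \<inter> (Sn n -` F \<inter> space M) = (\<Union>i. Gi i \<inter> (I n i -` F \<inter> space M))"
      by (auto simp: Gi_def Sn_def)
    then have "emeasure M (G \<inter> (Sn n -` F \<inter> space M)) = (\<Sum>i. emeasure M (Gi i \<inter> (I n i -` F \<inter> space M)))"
      using suminf_emeasure[OF _ disj(2)] by (simp add: image_subset_iff)
    also have "\<dots> = (\<Sum>i. emeasure M (Gi i)) * emeasure (process_law M Z) F"
      unfolding step by (rule ennreal_suminf_multc)
    also have "(\<Sum>i. emeasure M (Gi i)) = emeasure M (\<Union>i. Gi i)"
      using suminf_emeasure[OF _ disj(1)] by (simp add: image_subset_iff)
    also have "(\<Union>i. Gi i) = G" by (auto simp: Gi_def)
    finally show ?thesis .
  qed
  have "emeasure M (G \<inter> (S -` E \<inter> space M)) = emeasure M G * emeasure (process_law M Z) E"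
  \<comment> \<open>Conditioning on G below needs positive mass; for a null G both sides are
    0.\<close>
  proof (cases "emeasure M G = 0")
    case True
    have "emeasure M (G \<inter> (S -` E \<inter> space M)) \<le> emeasure M G" by (rule emeasure_mono) auto
    then show ?thesis using True by simp
  next
    case False
    let ?U = "uniform_measure M G"
    have fin: "emeasure M G \<noteq> top" by simp
    have law: "distr ?U path_space (Sn n) = process_law M Z" for n
    proof (rule measure_eqI)
      fix F assume "F \<in> sets (distr ?U path_space (Sn n))"
      then have F[measurable]: "F \<in> sets path_space" by simp
      have "emeasure (distr ?U path_space (Sn n)) F = emeasure ?U (Sn n -` F \<inter> space M)"
        by (subst emeasure_distr) auto
      also have "\<dots> = emeasure M (G \<inter> (Sn n -` F \<inter> space M)) / emeasure M G"
        by (rule emeasure_uniform_measure) auto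
      also have "\<dots> = emeasure (process_law M Z) F"
        unfolding dyadic[OF F] mult.commute[of "emeasure M G"] by (rule mult_divide_eq_ennreal[OF False fin])
      finally show "emeasure (distr ?U path_space (Sn n)) F = emeasure (process_law M Z) F" .
    qed (simp add: process_law_def)
    \<comment> \<open>Given G, every \<open>Sn\<close> has the law of Z, and right-continuity makes
      \<open>Sn\<close> converge coordinatewise to the increments after \<sigma>.\<close>
    have "distr ?U path_space S = process_law M Z"
    proof (rule distr_eq_of_tendsto[where Sn=Sn])
      show "prob_space ?U" using False by (intro prob_space_uniform_measure) (auto simp: emeasure_eq_measure)
      have "AE \<omega> in M. \<forall>i\<in>{0..}. (\<lambda>n. Sn n \<omega> i) \<longlonglongrightarrow> S \<omega> i"
        using levy_processD(4)[OF Z]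
      proof eventually_elim
        case (elim \<omega>)
        show ?case
        proof
          fix i :: real assume i: "i \<in> {0..}"
          have *: "(\<lambda>n. Z (dyadic_succ n (\<sigma> \<omega>) + u) \<omega>) \<longlonglongrightarrow> Z (\<sigma> \<omega> + u) \<omega>" if "0 \<le> u" for u
          proof -
            have "filterlim (\<lambda>v. v + u) (at_right (\<sigma> \<omega> + u)) (at_right (\<sigma> \<omega>))"
              by (auto simp: filterlim_at eventually_at_filter intro!: tendsto_eq_intros)
            from filterlim_compose[OF this filterlim_dyadic_succ[OF \<sigma>_nonneg]]
            have "filterlim (\<lambda>n. dyadic_succ n (\<sigma> \<omega>) + u) (at_right (\<sigma> \<omega> + u)) sequentially" .
            moreover have "((\<lambda>v. Z v \<omega>) \<longlongrightarrow> Z (\<sigma> \<omega> + u) \<omega>) (at_right (\<sigma> \<omega> + u))"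
              using \<sigma>_nonneg[of \<omega>] that by (intro cadlagD_right[OF elim]) auto
            ultimately show ?thesis by (rule filterlim_compose[rotated])
          qed
          have "(\<lambda>n. Z (dyadic_succ n (\<sigma> \<omega>) + i) \<omega> - Z (dyadic_succ n (\<sigma> \<omega>)) \<omega>)
              \<longlonglongrightarrow> Z (\<sigma> \<omega> + i) \<omega> - Z (\<sigma> \<omega>) \<omega>"
            using *[of i] *[of 0] i by (intro tendsto_diff) auto
          then show "(\<lambda>n. Sn n \<omega> i) \<longlonglongrightarrow> S \<omega> i"
            using i \<sigma>_nonneg[of \<omega>]
            by (simp add: Sn_def I_def S_def shift_path_def r_k R_def reg_eq[OF elim])
        qed
      qed
      then show "AE \<omega> in ?U. \<forall>i\<in>{0..}. (\<lambda>n. Sn n \<omega> i) \<longlonglongrightarrow> S \<omega> i"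
        by (intro AE_uniform_measureI) auto
    qed (use law in auto)
    then have "emeasure (process_law M Z) E = emeasure (distr ?U path_space S) E" by simp
    also have "\<dots> = emeasure M (G \<inter> (S -` E \<inter> space M)) / emeasure M G"
      by (subst emeasure_distr) auto
    finally have *: "emeasure (process_law M Z) E = emeasure M (G \<inter> (S -` E \<inter> space M)) / emeasure M G" .
    show ?thesis
      unfolding * ennreal_times_divide mult.commute[of "emeasure M G"] mult_divide_eq_ennreal[OF False fin] ..
  qed
  moreover have "G \<inter> (S -` E \<inter> space M) = {\<omega> \<in> space M. \<tau> (R \<omega>) < \<infinity> \<and> H (R \<omega>) \<in> D \<and>
      shift_path (R \<omega>) (real_of_ereal (\<tau> (R \<omega>))) \<in> E}"
    by (auto simp: G_def S_def \<sigma>_def)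
  ultimately show ?thesis unfolding G_def by simp
qed

section \<open>The transform restarted at its own clock\<close>

lemma lamperti_clock_mono: "t \<le> t' \<Longrightarrow> lamperti_clock \<beta> f t \<le> lamperti_clock \<beta> f t'"
  unfolding lamperti_clock_def
  by (rule Inf_superset_mono) (auto intro: le_less_trans[OF ennreal_leI])

text \<open>The Markov property path by path: from its value y at time t the transform goes on as a
  transform started from y, driven by the increments of w after h. For infinite h it is at 0 and
  stays there.\<close>

lemma lamperti_path_shift:
  fixes \<beta> :: real
  assumes w: "cadlag w" and x: "0 < x" and t: "0 \<le> t" and s: "0 \<le> s"
  defines "y \<equiv> x * lamperti_path \<beta> w (t * x powr (- \<beta>))"
    and "h \<equiv> lamperti_clock \<beta> (reg w) (t * x powr (- \<beta>))"
  shows "h < \<infinity> \<Longrightarrow> 0 < y \<and> x * lamperti_path \<beta> w ((t + s) * x powr (- \<beta>)) =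
      y * lamperti_path \<beta> (shift_path w (real_of_ereal h)) (s * y powr (- \<beta>))"
    and "h = \<infinity> \<Longrightarrow> y = 0 \<and> lamperti_path \<beta> w ((t + s) * x powr (- \<beta>)) = 0"
proof -
  have h: "h = lamperti_clock \<beta> w (t * x powr (- \<beta>))"
    unfolding h_def by (rule lamperti_clock_cong) (rule reg_eq[OF w])
  have t': "0 \<le> t * x powr (- \<beta>)" "0 \<le> s * x powr (- \<beta>)" using t s by simp_all
  show "0 < y \<and> x * lamperti_path \<beta> w ((t + s) * x powr (- \<beta>)) =
      y * lamperti_path \<beta> (shift_path w (real_of_ereal h)) (s * y powr (- \<beta>))" if "h < \<infinity>"
    using w t'(1)
  proof (cases rule: clock_integral_cases[where \<beta>=\<beta>])
    case infinite
    then have "h = \<infinity>" unfolding h by (intro lamperti_clock_infinite[OF w]) (simp add: less_imp_le)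
    with that show ?thesis by simp
  next
    case (finite v)
    have hv: "h = ereal v" unfolding h finite(2)[symmetric] by (rule lamperti_clock_clock_integral[OF w finite(1)])
    have y: "y = x * exp (w v)"
      unfolding y_def finite(2)[symmetric] by (simp add: lamperti_path_clock_integral[OF w finite(1)])
    have "shift_path w v = restrict (\<lambda>u. w (v + u) - w v) {0..}"
      unfolding shift_path_def using finite(1) by (auto simp: reg_eq[OF w])
    then have sh: "lamperti_path \<beta> (shift_path w v) = lamperti_path \<beta> (\<lambda>u. w (v + u) - w v)"
      by (intro ext) (simp only: lamperti_path_restrict)
    \<comment> \<open>The time factor from restarting merges with that of the start x into the
      factor belonging to the new start y.\<close>
    have "x powr (- \<beta>) * exp (- (\<beta> * w v)) = y powr (- \<beta>)"
      unfolding y using x by (simp add: powr_mult exp_powr_real)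
    then have "lamperti_path \<beta> w ((t + s) * x powr (- \<beta>)) =
        exp (w v) * lamperti_path \<beta> (shift_path w v) (s * y powr (- \<beta>))"
      using lamperti_path_add[OF w finite(1) t'(2), of \<beta>]
      by (simp add: sh finite(2) distrib_right mult.assoc)
    then show ?thesis using x by (simp add: hv y)
  qed
  show "y = 0 \<and> lamperti_path \<beta> w ((t + s) * x powr (- \<beta>)) = 0" if inf: "h = \<infinity>"
    using w t'(1)
  proof (cases rule: clock_integral_cases[where \<beta>=\<beta>])
    case (finite v)
    then have "h = ereal v"
      unfolding h finite(2)[symmetric] by (intro lamperti_clock_clock_integral[OF w])
    with inf show ?thesis by simp
  next
    case infinite
    have "t * x powr (- \<beta>) \<le> (t + s) * x powr (- \<beta>)" using s by (intro mult_right_mono) auto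
    then have "lamperti_path \<beta> w ((t + s) * x powr (- \<beta>)) = 0"
      using infinite by (intro lamperti_path_infinite[OF w]) (meson less_imp_le order_trans)
    moreover have "lamperti_path \<beta> w (t * x powr (- \<beta>)) = 0"
      using infinite by (intro lamperti_path_infinite[OF w]) (simp add: less_imp_le)
    ultimately show ?thesis by (simp add: y_def)
  qed
qed

section \<open>The Markov property of the Lamperti transform\<close>

lemma history_subalgebra:
  assumes "\<And>u. 0 \<le> u \<Longrightarrow> u \<le> t \<Longrightarrow> Y u \<in> borel_measurable M"
  shows "subalgebra M (history M Y t)"
proof -
  have gen: "{Y u -` B \<inter> space M |u B. 0 \<le> u \<and> u \<le> t \<and> B \<in> sets borel} \<subseteq> sets M"
    using assms by (auto intro: measurable_sets)
  have sub: "{Y u -` B \<inter> space M |u B. 0 \<le> u \<and> u \<le> t \<and> B \<in> sets borel} \<subseteq> Pow (space M)"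
    by auto
  show ?thesis
    unfolding subalgebra_def history_def space_measure_of[OF sub] sets_measure_of[OF sub]
    by (auto intro: sets.sigma_sets_subset[OF gen, THEN subsetD])
qed

lemma measurable_history:
  assumes "0 \<le> u" "u \<le> t"
  shows "Y u \<in> borel_measurable (history M Y t)"
proof (rule measurableI)
  have sub: "{Y u -` B \<inter> space M |u B. 0 \<le> u \<and> u \<le> t \<and> B \<in> sets borel} \<subseteq> Pow (space M)"
    by auto
  fix B :: "real set" assume "B \<in> sets borel"
  then show "Y u -` B \<inter> space (history M Y t) \<in> sets (history M Y t)"
    unfolding history_def space_measure_of[OF sub] sets_measure_of[OF sub] using assms by blast
qed simp

text \<open>The preimages under the restricted path map form a sigma-algebra containing all
  generators of the history, hence the whole history.\<close>

lemma sets_history: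
  assumes "A \<in> sets (history M Y t)"
  obtains D where "D \<in> sets (product_borel {0..t})"
    "A = {\<omega> \<in> space M. (\<lambda>u\<in>{0..t}. Y u \<omega>) \<in> D}"
proof -
  let ?h = "\<lambda>\<omega>. \<lambda>u\<in>{0..t}. Y u \<omega>"
  let ?V = "vimage_algebra (space M) ?h (product_borel {0..t})"
  have h: "?h \<in> space M \<rightarrow> space (product_borel {0..t})" by (auto simp: space_PiM)
  have "?h \<in> ?V \<rightarrow>\<^sub>M product_borel {0..t}" by (rule measurable_vimage_algebra1[OF h])
  then have Y: "Y u \<in> borel_measurable ?V" if "u \<in> {0..t}" for u
    using measurable_compose[OF _ measurable_component_singleton[OF that], of ?h ?V "\<lambda>_. borel"] that by simp
  have "{Y u -` B \<inter> space M |u B. 0 \<le> u \<and> u \<le> t \<and> B \<in> sets borel} \<subseteq> sets ?V"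
  proof safe
    fix u and B :: "real set" assume "0 \<le> u" "u \<le> t" "B \<in> sets borel"
    then show "Y u -` B \<inter> space M \<in> sets ?V"
      using measurable_sets[OF Y[of u], of B] by simp
  qed
  then have "sets (history M Y t) \<subseteq> sets ?V"
    unfolding history_def
    by (subst sets_measure_of) (use sets.sigma_sets_subset[of _ ?V] in auto)
  with assms have "A \<in> {?h -` D \<inter> space M | D. D \<in> sets (product_borel {0..t})}"
    unfolding sets_vimage_algebra2[OF h] by blast
  then obtain D where D: "D \<in> sets (product_borel {0..t})" "A = ?h -` D \<inter> space M" by blast
  show thesis by (rule that[OF D(1)]) (use D(2) in blast)
qed

text \<open>The transition function of the Lamperti transform of a process with law \<open>\<mu>\<close>.\<close>

definition lamperti_kernel :: "(real \<Rightarrow> real) measure \<Rightarrow> real \<Rightarrow> real \<Rightarrow> real set \<Rightarrow> real \<Rightarrow> real" where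
  "lamperti_kernel \<mu> \<beta> s B y =
    (if 0 < y then \<integral>w. indicator B (y * lamperti_path \<beta> w (s * y powr (- \<beta>))) \<partial>\<mu> else indicator B 0)"

lemma measurable_lamperti_functional:
  assumes "sets \<mu> = sets path_space"
  shows "(\<lambda>p. fst p * lamperti_path \<beta> (snd p) (s * fst p powr (- \<beta>))) \<in> borel_measurable (borel \<Otimes>\<^sub>M \<mu>)"
proof -
  note [measurable_cong] = assms
  have "(\<lambda>p. lamperti_path \<beta> (snd p) (s * fst p powr (- \<beta>))) \<in> borel_measurable (borel \<Otimes>\<^sub>M \<mu>)"
    by (rule measurable_compose[OF _ measurable_lamperti_path, of "\<lambda>p. (snd p, s * fst p powr (- \<beta>))", simplified])
      measurable
  then show ?thesis by measurable
qed

lemma measurable_lamperti_kernel: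
  assumes \<mu>: "prob_space \<mu>" "sets \<mu> = sets path_space" and B[measurable]: "B \<in> sets borel"
  shows "lamperti_kernel \<mu> \<beta> s B \<in> borel_measurable borel"
proof -
  interpret prob_space \<mu> by fact
  note [measurable] = measurable_lamperti_functional[OF \<mu>(2), of \<beta> s]
  have "(\<lambda>p. indicat_real B (fst p * lamperti_path \<beta> (snd p) (s * fst p powr (- \<beta>))))
      \<in> borel_measurable (borel \<Otimes>\<^sub>M \<mu>)"
    by measurable
  then have "(\<lambda>y. \<integral>w. indicat_real B (y * lamperti_path \<beta> w (s * y powr (- \<beta>))) \<partial>\<mu>) \<in> borel_measurable borel"
    by (intro borel_measurable_lebesgue_integral) (simp add: split_beta')
  then show ?thesis unfolding lamperti_kernel_def[abs_def] by measurable
qed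

lemma lamperti_kernel_bounds:
  assumes "prob_space \<mu>"
  shows "0 \<le> lamperti_kernel \<mu> \<beta> s B y" "lamperti_kernel \<mu> \<beta> s B y \<le> 1"
proof -
  interpret prob_space \<mu> by fact
  show "0 \<le> lamperti_kernel \<mu> \<beta> s B y"
    unfolding lamperti_kernel_def by (auto intro!: integral_nonneg_AE)
  show "lamperti_kernel \<mu> \<beta> s B y \<le> 1"
  \<comment> \<open>B is an arbitrary set here, so the integrand may fail to be integrable; its
    integral is then 0 by convention.\<close>
  proof (cases "integrable \<mu> (\<lambda>w. indicat_real B (y * lamperti_path \<beta> w (s * y powr (- \<beta>))))")
    case True
    have "(\<integral>w. indicat_real B (y * lamperti_path \<beta> w (s * y powr (- \<beta>))) \<partial>\<mu>) \<le> (\<integral>w. 1 \<partial>\<mu>)"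
      by (intro integral_mono True) (auto simp: indicator_def)
    then show ?thesis by (simp add: lamperti_kernel_def indicator_def prob_space)
  qed (simp add: lamperti_kernel_def indicator_def not_integrable_integral_eq)
qed

text \<open>With \<open>H\<close> the transform up to t and \<open>S\<close> the increments after h,
  the strong Markov property gives the pair a product law on the event \<open>G\<close> of finite h.
  Integrating out \<open>S\<close> leaves the kernel at Y t; off \<open>G\<close> both Y t and Y (t
  + s) are 0, where the kernel is a point mass.\<close>

lemma lamperti_markov:
  assumes Z: "levy_process M \<xi> 0" and x: "0 < x" and t: "0 \<le> t" and s: "0 \<le> s" and B[measurable]: "B \<in> sets borel"
    and Y_meas: "\<And>u. 0 \<le> u \<Longrightarrow> Y u \<in> borel_measurable M"
    and Y: "AE \<omega> in M. \<forall>u\<ge>0. Y u \<omega> = x * lamperti_path \<beta> (\<lambda>v. \<xi> v \<omega>) (u * x powr (- \<beta>))"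
  shows "AE \<omega> in M. real_cond_exp M (history M Y t) (\<lambda>\<omega>'. indicator B (Y (t + s) \<omega>')) \<omega> =
    lamperti_kernel (process_law M \<xi>) \<beta> s B (Y t \<omega>)"
proof -
  interpret prob_space M by (rule levy_processD(1)[OF Z])
  have [simp]: "finite_measure_subalgebra M (history M Y t)"
    by (intro finite_measure_subalgebra.intro finite_measure_subalgebra_axioms.intro
        finite_measure_axioms history_subalgebra Y_meas)
  interpret sub: finite_measure_subalgebra M "history M Y t" by simp
  define R where "R = (\<lambda>\<omega>. \<lambda>v\<in>{0..}. \<xi> v \<omega>)"
  define \<mu> where "\<mu> = process_law M \<xi>"
  have R[measurable]: "R \<in> M \<rightarrow>\<^sub>M path_space"
    unfolding R_def by (intro measurable_restrict levy_processD(2)[OF Z]) auto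
  have \<mu>_sets[measurable_cong]: "sets \<mu> = sets path_space" by (simp add: \<mu>_def process_law_def)
  interpret \<mu>: prob_space \<mu>
    using prob_space_distr[OF R] by (simp add: \<mu>_def process_law_def R_def)
  define \<tau> where "\<tau> w = lamperti_clock \<beta> (reg w) (t * x powr (- \<beta>))" for w
  define H where "H w = (\<lambda>u\<in>{0..t}. x * lamperti_path \<beta> w (u * x powr (- \<beta>)))" for w
  define N where "N = product_borel {0..t}"
  have \<tau>[measurable]: "\<tau> \<in> borel_measurable path_space"
    unfolding \<tau>_def[abs_def]
    by (rule measurable_compose[OF _ measurable_lamperti_clock, of "\<lambda>w. (w, t * x powr (- \<beta>))", simplified]) measurable
  have H[measurable]: "H \<in> path_space \<rightarrow>\<^sub>M N"
    unfolding H_def[abs_def] N_def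
    by (intro measurable_restrict borel_measurable_times borel_measurable_const measurable_lamperti_path_at)
  define S where "S \<omega> = shift_path (R \<omega>) (real_of_ereal (\<tau> (R \<omega>)))" for \<omega>
  have S[measurable]: "S \<in> M \<rightarrow>\<^sub>M path_space"
    unfolding S_def[abs_def]
    by (rule measurable_compose[OF _ measurable_shift_path, of "\<lambda>\<omega>. (R \<omega>, real_of_ereal (\<tau> (R \<omega>)))", simplified]) measurable
  define G where "G = {\<omega> \<in> space M. \<tau> (R \<omega>) < \<infinity>}"
  have G[measurable]: "G \<in> sets M" unfolding G_def by measurable
  have strong: "emeasure M {\<omega> \<in> space M. \<tau> (R \<omega>) < \<infinity> \<and> H (R \<omega>) \<in> D \<and> S \<omega> \<in> E} =
      emeasure M {\<omega> \<in> space M. \<tau> (R \<omega>) < \<infinity> \<and> H (R \<omega>) \<in> D} * emeasure \<mu> E"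
    if "D \<in> sets N" "E \<in> sets path_space" for D E
    unfolding S_def \<mu>_def R_def
  proof (rule levy_strong_markov[OF Z \<tau> _ H _ that])
    show "0 \<le> \<tau> w" for w unfolding \<tau>_def by (rule lamperti_clock_nonneg)
    fix w1 w2 r assume eq: "\<And>v. 0 \<le> v \<Longrightarrow> v \<le> r \<Longrightarrow> w1 v = w2 v" and less: "\<tau> w1 < ereal r"
    \<comment> \<open>Earlier values of the transform are also fixed by the path up to r, since the
      clock is monotone in time.\<close>
    have "lamperti_path \<beta> w2 (u * x powr (- \<beta>)) = lamperti_path \<beta> w1 (u * x powr (- \<beta>))" if "u \<in> {0..t}" for u
    proof (rule lamperti_path_local(2)[OF eq])
      have "u * x powr (- \<beta>) \<le> t * x powr (- \<beta>)" using that by (intro mult_right_mono) auto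
      from lamperti_clock_mono[OF this] less show "lamperti_clock \<beta> (reg w1) (u * x powr (- \<beta>)) < ereal r"
        unfolding \<tau>_def by (rule le_less_trans)
    qed auto
    then have "H w2 = H w1" unfolding H_def by (auto simp: restrict_def)
    moreover have "\<tau> w2 = \<tau> w1"
      unfolding \<tau>_def by (rule lamperti_path_local(1)[OF eq]) (use less in \<open>auto simp: \<tau>_def\<close>)
    ultimately show "\<tau> w2 = \<tau> w1 \<and> H w2 = H w1" by simp
  qed
  let ?M = "restrict_space M G"
  have RG[measurable]: "(\<lambda>\<omega>. H (R \<omega>)) \<in> ?M \<rightarrow>\<^sub>M N" "S \<in> ?M \<rightarrow>\<^sub>M path_space"
    by (intro measurable_restrict_space1; measurable)+
  interpret GM: finite_measure ?M
    by (rule finite_measureI) (simp add: emeasure_restrict_space space_restrict_space emeasure_eq_measure)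
  interpret GH: finite_measure "distr ?M N (\<lambda>\<omega>. H (R \<omega>))" by (rule GM.finite_measure_distr) simp
  \<comment> \<open>The strong Markov property is this identity on rectangles. Only finiteness of
    the first marginal is available, as \<open>G\<close> need not have mass 1.\<close>
  have joint: "distr ?M N (\<lambda>\<omega>. H (R \<omega>)) \<Otimes>\<^sub>M \<mu> = distr ?M (N \<Otimes>\<^sub>M \<mu>) (\<lambda>\<omega>. (H (R \<omega>), S \<omega>))"
  proof (rule pair_measure_eqI)
    show "sigma_finite_measure (distr ?M N (\<lambda>\<omega>. H (R \<omega>)))" by unfold_locales
    show "sigma_finite_measure \<mu>" by unfold_locales
    fix D E assume "D \<in> sets (distr ?M N (\<lambda>\<omega>. H (R \<omega>)))" "E \<in> sets \<mu>"
    then have D[measurable]: "D \<in> sets N" and E[measurable]: "E \<in> sets path_space"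
      using \<mu>_sets by auto
    have *: "emeasure ?M C = emeasure M C" if "C \<subseteq> G" "C \<in> sets M" for C
      using that by (subst emeasure_restrict_space) auto
    let ?D = "{\<omega> \<in> space M. \<tau> (R \<omega>) < \<infinity> \<and> H (R \<omega>) \<in> D}"
    let ?DE = "{\<omega> \<in> space M. \<tau> (R \<omega>) < \<infinity> \<and> H (R \<omega>) \<in> D \<and> S \<omega> \<in> E}"
    have vimage: "(\<lambda>\<omega>. H (R \<omega>)) -` D \<inter> space ?M = ?D"
      "(\<lambda>\<omega>. (H (R \<omega>), S \<omega>)) -` (D \<times> E) \<inter> space ?M = ?DE"
      by (auto simp: space_restrict_space G_def)
    have "emeasure (distr ?M N (\<lambda>\<omega>. H (R \<omega>))) D = emeasure M ?D"
      unfolding emeasure_distr[OF RG(1) D] vimage by (rule *) (auto simp: G_def)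
    moreover have "emeasure (distr ?M (N \<Otimes>\<^sub>M \<mu>) (\<lambda>\<omega>. (H (R \<omega>), S \<omega>))) (D \<times> E) = emeasure M ?DE"
    proof -
      have "(\<lambda>\<omega>. (H (R \<omega>), S \<omega>)) \<in> ?M \<rightarrow>\<^sub>M N \<Otimes>\<^sub>M \<mu>" by measurable
      moreover have "D \<times> E \<in> sets (N \<Otimes>\<^sub>M \<mu>)" by measurable
      ultimately have "emeasure (distr ?M (N \<Otimes>\<^sub>M \<mu>) (\<lambda>\<omega>. (H (R \<omega>), S \<omega>))) (D \<times> E) = emeasure ?M ?DE"
        by (simp only: emeasure_distr vimage)
      also have "\<dots> = emeasure M ?DE" by (rule *) (auto simp: G_def)
      finally show ?thesis .
    qed
    ultimately show "emeasure (distr ?M N (\<lambda>\<omega>. H (R \<omega>))) D * emeasure \<mu> E =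
        emeasure (distr ?M (N \<Otimes>\<^sub>M \<mu>) (\<lambda>\<omega>. (H (R \<omega>), S \<omega>))) (D \<times> E)"
      by (simp only: strong[OF D E])
  qed simp
  \<comment> \<open>All exceptional sets are collected here; afterwards history events, Y t and Y (t
    + s) can be rewritten in terms of \<open>H (R \<omega>)\<close> and
    \<open>S \<omega>\<close>.\<close>
  have good: "AE \<omega> in M. (\<forall>u\<ge>0. Y u \<omega> = x * lamperti_path \<beta> (R \<omega>) (u * x powr (- \<beta>))) \<and>
      (\<omega> \<in> G \<longrightarrow> 0 < Y t \<omega> \<and> Y (t + s) \<omega> = Y t \<omega> * lamperti_path \<beta> (S \<omega>) (s * Y t \<omega> powr (- \<beta>))) \<and>
      (\<omega> \<notin> G \<longrightarrow> Y t \<omega> = 0 \<and> Y (t + s) \<omega> = 0)"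
    using Y levy_processD(4)[OF Z] AE_space
  proof eventually_elim
    case (elim \<omega>)
    have RY: "Y u \<omega> = x * lamperti_path \<beta> (R \<omega>) (u * x powr (- \<beta>))" if "0 \<le> u" for u
      using elim(1) that unfolding R_def by simp
    let ?h = "lamperti_clock \<beta> (reg (\<lambda>v. \<xi> v \<omega>)) (t * x powr (- \<beta>))"
    have h: "\<tau> (R \<omega>) = ?h" by (simp add: \<tau>_def R_def)
    have Sh: "S \<omega> = shift_path (\<lambda>v. \<xi> v \<omega>) (real_of_ereal ?h)"
      unfolding S_def h by (simp add: shift_path_def R_def)
    have Yt: "Y t \<omega> = x * lamperti_path \<beta> (\<lambda>v. \<xi> v \<omega>) (t * x powr (- \<beta>))"
      "Y (t + s) \<omega> = x * lamperti_path \<beta> (\<lambda>v. \<xi> v \<omega>) ((t + s) * x powr (- \<beta>))"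
      using elim(1) t s by auto
    note sh = lamperti_path_shift[OF elim(2) x t s, of \<beta>]
    have "\<omega> \<in> G \<longleftrightarrow> ?h < \<infinity>" using elim(3) by (simp add: G_def h)
    then show ?case
      using RY sh unfolding Sh Yt by auto
  qed
  define \<kappa> where "\<kappa> = lamperti_kernel \<mu> \<beta> s B"
  have \<kappa>[measurable]: "\<kappa> \<in> borel_measurable borel"
    unfolding \<kappa>_def by (rule measurable_lamperti_kernel[OF \<mu>.prob_space_axioms \<mu>_sets B])
  have \<kappa>_bounds: "0 \<le> \<kappa> y" "\<kappa> y \<le> 1" for y
    unfolding \<kappa>_def by (rule lamperti_kernel_bounds[OF \<mu>.prob_space_axioms])+
  have [measurable]: "Y t \<in> borel_measurable M" "Y (t + s) \<in> borel_measurable M"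
    using Y_meas t s by auto
  have "AE \<omega> in M. real_cond_exp M (history M Y t) (\<lambda>\<omega>'. indicator B (Y (t + s) \<omega>')) \<omega> = \<kappa> (Y t \<omega>)"
  proof (rule sub.real_cond_exp_charact)
    fix A assume A: "A \<in> sets (history M Y t)"
    then have AM[measurable]: "A \<in> sets M" using sub.subalg by (auto simp: subalgebra_def)
    obtain D where D: "D \<in> sets N" "A = {\<omega> \<in> space M. (\<lambda>u\<in>{0..t}. Y u \<omega>) \<in> D}"
      using sets_history[OF A] unfolding N_def by blast
    note [measurable] = D(1)
    \<comment> \<open>The indicator of the event that the past lies in D and Y (t + s) in B, as a
      function of past and future; the coordinate at t of the past is the new start.\<close>
    define \<phi> where "\<phi> p = indicator D (fst p) *
      ennreal (indicator B (fst p t * lamperti_path \<beta> (snd p) (s * fst p t powr (- \<beta>))))"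
      for p :: "(real \<Rightarrow> real) \<times> (real \<Rightarrow> real)"
    have at_t: "(\<lambda>h. h t) \<in> borel_measurable N"
      unfolding N_def using t by (intro measurable_component_singleton) auto
    have [measurable]: "(\<lambda>p. fst p t * lamperti_path \<beta> (snd p) (s * fst p t powr (- \<beta>)))
        \<in> borel_measurable (N \<Otimes>\<^sub>M \<mu>)"
      by (rule measurable_compose[OF _ measurable_lamperti_functional[OF \<mu>_sets],
            of "\<lambda>p. (fst p t, snd p)", simplified])
        (intro measurable_Pair measurable_compose[OF measurable_fst at_t] measurable_snd)
    have \<phi>[measurable]: "\<phi> \<in> borel_measurable (N \<Otimes>\<^sub>M \<mu>)"
      unfolding \<phi>_def[abs_def] by measurable
    have nn: "(\<integral>\<^sup>+\<omega>. indicator (A \<inter> G) \<omega> * ennreal (indicator B (Y (t + s) \<omega>)) \<partial>M) =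
        (\<integral>\<^sup>+\<omega>. indicator (A \<inter> G) \<omega> * ennreal (\<kappa> (Y t \<omega>)) \<partial>M)"
    proof -
      have AD: "indicator A \<omega> = (indicator D (H (R \<omega>)) :: ennreal)"
        if "\<omega> \<in> space M" "\<forall>u\<ge>0. Y u \<omega> = x * lamperti_path \<beta> (R \<omega>) (u * x powr (- \<beta>))" for \<omega>
      proof -
        have "(\<lambda>u\<in>{0..t}. Y u \<omega>) = H (R \<omega>)"
          unfolding H_def using that(2) by (auto simp: restrict_def)
        then show ?thesis using that(1) D(2) by (simp add: indicator_def)
      qed
      have Ht: "H (R \<omega>) t = Y t \<omega>"
        if "\<forall>u\<ge>0. Y u \<omega> = x * lamperti_path \<beta> (R \<omega>) (u * x powr (- \<beta>))" for \<omega>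
        using that t by (simp add: H_def)
      have "(\<integral>\<^sup>+\<omega>. indicator (A \<inter> G) \<omega> * ennreal (indicator B (Y (t + s) \<omega>)) \<partial>M) =
          (\<integral>\<^sup>+\<omega>. \<phi> (H (R \<omega>), S \<omega>) * indicator G \<omega> \<partial>M)"
      proof (rule nn_integral_cong_AE)
        show "AE \<omega> in M. indicator (A \<inter> G) \<omega> * ennreal (indicator B (Y (t + s) \<omega>)) =
            \<phi> (H (R \<omega>), S \<omega>) * indicator G \<omega>"
          using good AE_space
        proof eventually_elim
          case (elim \<omega>)
          then show ?case
            using AD[of \<omega>] Ht[of \<omega>]
            by (cases "\<omega> \<in> G") (simp_all add: \<phi>_def indicator_inter_arith)
        qed
      qed
      also have "\<dots> = (\<integral>\<^sup>+\<omega>. \<phi> (H (R \<omega>), S \<omega>) \<partial>?M)"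
        by (rule nn_integral_restrict_space[symmetric]) simp
      also have "\<dots> = (\<integral>\<^sup>+p. \<phi> p \<partial>distr ?M (N \<Otimes>\<^sub>M \<mu>) (\<lambda>\<omega>. (H (R \<omega>), S \<omega>)))"
        by (rule nn_integral_distr[symmetric]) measurable
      \<comment> \<open>Fubini for the product law: the future is integrated against \<mu> with the
        past, and so the new start, held fixed.\<close>
      also have "\<dots> = (\<integral>\<^sup>+h. \<integral>\<^sup>+w. \<phi> (h, w) \<partial>\<mu> \<partial>distr ?M N (\<lambda>\<omega>. H (R \<omega>)))"
        unfolding joint[symmetric] by (rule \<mu>.nn_integral_fst[symmetric]) measurable
      also have "\<dots> = (\<integral>\<^sup>+\<omega>. \<integral>\<^sup>+w. \<phi> (H (R \<omega>), w) \<partial>\<mu> \<partial>?M)"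
        by (rule nn_integral_distr) measurable
      also have "\<dots> = (\<integral>\<^sup>+\<omega>. (\<integral>\<^sup>+w. \<phi> (H (R \<omega>), w) \<partial>\<mu>) * indicator G \<omega> \<partial>M)"
        by (rule nn_integral_restrict_space) simp
      also have "\<dots> = (\<integral>\<^sup>+\<omega>. indicator (A \<inter> G) \<omega> * ennreal (\<kappa> (Y t \<omega>)) \<partial>M)"
      proof (rule nn_integral_cong_AE)
        show "AE \<omega> in M. (\<integral>\<^sup>+w. \<phi> (H (R \<omega>), w) \<partial>\<mu>) * indicator G \<omega> =
            indicator (A \<inter> G) \<omega> * ennreal (\<kappa> (Y t \<omega>))"
          using good AE_space
        proof eventually_elim
          case (elim \<omega>)
          show ?case
          proof (cases "\<omega> \<in> G")
            case True
            let ?f = "\<lambda>w. indicat_real B (Y t \<omega> * lamperti_path \<beta> w (s * Y t \<omega> powr (- \<beta>)))"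
            have f[measurable]: "?f \<in> borel_measurable \<mu>"
              by (rule measurable_compose[OF measurable_compose[OF _ measurable_lamperti_functional[OF \<mu>_sets],
                    of "\<lambda>w. (Y t \<omega>, w)", simplified]]) measurable
            have "(\<integral>\<^sup>+w. \<phi> (H (R \<omega>), w) \<partial>\<mu>) = indicator A \<omega> * (\<integral>\<^sup>+w. ennreal (?f w) \<partial>\<mu>)"
              unfolding \<phi>_def using elim AD[of \<omega>] Ht[of \<omega>] by (simp add: nn_integral_cmult)
            also have "(\<integral>\<^sup>+w. ennreal (?f w) \<partial>\<mu>) = ennreal (\<integral>w. ?f w \<partial>\<mu>)"
              by (intro nn_integral_eq_integral \<mu>.integrable_const_bound[where B=1] f) (auto simp: indicator_leI)
            also have "(\<integral>w. ?f w \<partial>\<mu>) = \<kappa> (Y t \<omega>)"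
              using elim True by (simp add: \<kappa>_def lamperti_kernel_def)
            finally show ?thesis using True by (simp add: indicator_inter_arith)
          qed simp
        qed
      qed
      finally show ?thesis .
    qed
    have "(\<integral>\<^sup>+\<omega>. ennreal (indicator A \<omega> * indicator B (Y (t + s) \<omega>)) \<partial>M) =
        (\<integral>\<^sup>+\<omega>. indicator (A \<inter> G) \<omega> * ennreal (indicator B (Y (t + s) \<omega>)) +
          indicator (A - G) \<omega> * ennreal (indicator B (Y (t + s) \<omega>)) \<partial>M)"
      by (rule nn_integral_cong) (auto simp: indicator_def)
    also have "\<dots> = (\<integral>\<^sup>+\<omega>. indicator (A \<inter> G) \<omega> * ennreal (indicator B (Y (t + s) \<omega>)) \<partial>M) +
        (\<integral>\<^sup>+\<omega>. indicator (A - G) \<omega> * ennreal (indicator B (Y (t + s) \<omega>)) \<partial>M)"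
      by (rule nn_integral_add) measurable
    also have "(\<integral>\<^sup>+\<omega>. indicator (A - G) \<omega> * ennreal (indicator B (Y (t + s) \<omega>)) \<partial>M) =
        (\<integral>\<^sup>+\<omega>. indicator (A - G) \<omega> * ennreal (\<kappa> (Y t \<omega>)) \<partial>M)"
    proof (rule nn_integral_cong_AE)
      show "AE \<omega> in M. indicator (A - G) \<omega> * ennreal (indicator B (Y (t + s) \<omega>)) =
          indicator (A - G) \<omega> * ennreal (\<kappa> (Y t \<omega>))"
        using good
        by eventually_elim (auto simp: indicator_def \<kappa>_def lamperti_kernel_def)
    qed
    also have "(\<integral>\<^sup>+\<omega>. indicator (A \<inter> G) \<omega> * ennreal (indicator B (Y (t + s) \<omega>)) \<partial>M) +
        (\<integral>\<^sup>+\<omega>. indicator (A - G) \<omega> * ennreal (\<kappa> (Y t \<omega>)) \<partial>M) =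
        (\<integral>\<^sup>+\<omega>. indicator (A \<inter> G) \<omega> * ennreal (\<kappa> (Y t \<omega>)) + indicator (A - G) \<omega> * ennreal (\<kappa> (Y t \<omega>)) \<partial>M)"
      unfolding nn by (rule nn_integral_add[symmetric]) measurable
    also have "\<dots> = (\<integral>\<^sup>+\<omega>. ennreal (indicator A \<omega> * \<kappa> (Y t \<omega>)) \<partial>M)"
      by (rule nn_integral_cong) (auto simp: indicator_def)
    finally have eq: "(\<integral>\<^sup>+\<omega>. ennreal (indicator A \<omega> * indicator B (Y (t + s) \<omega>)) \<partial>M) =
        (\<integral>\<^sup>+\<omega>. ennreal (indicator A \<omega> * \<kappa> (Y t \<omega>)) \<partial>M)" .
    have "(\<integral>\<omega>. indicator A \<omega> * indicat_real B (Y (t + s) \<omega>) \<partial>M) = (\<integral>\<omega>. indicator A \<omega> * \<kappa> (Y t \<omega>) \<partial>M)"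
      by (subst (1 2) integral_eq_nn_integral) (auto simp: eq \<kappa>_bounds intro!: mult_nonneg_nonneg)
    then show "(LINT \<omega>:A|M. indicator B (Y (t + s) \<omega>)) = (LINT \<omega>:A|M. \<kappa> (Y t \<omega>))"
      by (simp add: set_lebesgue_integral_def)
  next
    show "integrable M (\<lambda>\<omega>. indicat_real B (Y (t + s) \<omega>))"
      by (rule integrable_const_bound[where B=1]) (auto simp: indicator_def)
    show "integrable M (\<lambda>\<omega>. \<kappa> (Y t \<omega>))"
      by (rule integrable_const_bound[where B=1]) (use \<kappa>_bounds in auto)
    show "(\<lambda>\<omega>. \<kappa> (Y t \<omega>)) \<in> borel_measurable (history M Y t)"
      by (rule measurable_compose[OF measurable_history \<kappa>]) (use t in auto)
  qed
  then show ?thesis unfolding \<kappa>_def \<mu>_def .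
qed

section \<open>The continuous state branching process\<close>

text \<open>Completeness absorbs the null set on which the two functions differ. It serves
  \<open>Y\<close>, which is only almost surely a measurable functional of \<xi>.\<close>

lemma (in complete_measure) borel_measurable_AE_eq:
  fixes f g :: "'a \<Rightarrow> 'b::topological_space"
  assumes f: "f \<in> borel_measurable M" and eq: "AE \<omega> in M. g \<omega> = f \<omega>"
  shows "g \<in> borel_measurable M"
proof (rule measurableI)
  fix B :: "'b set" assume B: "B \<in> sets borel"
  show "g -` B \<inter> space M \<in> sets M"
  proof (rule in_sets_AE)
    show "AE \<omega> in M. \<omega> \<in> f -` B \<inter> space M \<longleftrightarrow> \<omega> \<in> g -` B \<inter> space M"
      using eq by eventually_elim simp
    show "f -` B \<inter> space M \<in> sets M" using f B by (rule measurable_sets)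
  qed auto
qed simp

lemma cadlag_cong:
  assumes "\<And>t. 0 \<le> t \<Longrightarrow> f t = g t"
  shows "cadlag f \<longleftrightarrow> cadlag g"
proof -
  have right: "(f \<longlongrightarrow> l) (at_right t) \<longleftrightarrow> (g \<longlongrightarrow> l) (at_right t)" if "0 \<le> t" for t l
  proof (rule tendsto_cong)
    show "eventually (\<lambda>u. f u = g u) (at_right t)"
      using eventually_at_right_less[of t] by eventually_elim (use assms that in simp)
  qed
  have left: "(f \<longlongrightarrow> l) (at_left t) \<longleftrightarrow> (g \<longlongrightarrow> l) (at_left t)" if "0 < t" for t l
  proof (rule tendsto_cong)
    have "eventually (\<lambda>u. 0 < u) (at_left t)" using that by (auto simp: eventually_at_left_field)
    then show "eventually (\<lambda>u. f u = g u) (at_left t)" by eventually_elim (use assms in simp)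
  qed
  show ?thesis unfolding cadlag_def using right left assms by metis
qed

definition lamperti_process :: "real \<Rightarrow> real \<Rightarrow> (real \<Rightarrow> real) \<Rightarrow> real \<Rightarrow> real" where
  "lamperti_process \<beta> y w = (\<lambda>t\<in>{0..}. y * lamperti_path \<beta> w (t * y powr (- \<beta>)))"

text \<open>The law is a pushforward of the law of Z under a map depending only on \<beta> and y, so
  processes on different probability spaces can be compared.\<close>

lemma process_law_lamperti:
  assumes V: "\<And>t. 0 \<le> t \<Longrightarrow> V t \<in> borel_measurable M" and Z: "\<And>t. 0 \<le> t \<Longrightarrow> Z t \<in> borel_measurable M"
    and eq: "AE \<omega> in M. \<forall>t\<ge>0. V t \<omega> = y * lamperti_path \<beta> (\<lambda>v. Z v \<omega>) (t * y powr (- \<beta>))"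
  shows "process_law M V = distr (process_law M Z) path_space (lamperti_process \<beta> y)"
proof -
  have R: "(\<lambda>\<omega>. \<lambda>v\<in>{0..}. Z v \<omega>) \<in> M \<rightarrow>\<^sub>M path_space"
    by (intro measurable_restrict Z) auto
  have L: "lamperti_process \<beta> y \<in> path_space \<rightarrow>\<^sub>M path_space"
    unfolding lamperti_process_def[abs_def]
    by (intro measurable_restrict borel_measurable_times borel_measurable_const measurable_lamperti_path_at)
  have "process_law M V = distr M path_space (lamperti_process \<beta> y \<circ> (\<lambda>\<omega>. \<lambda>v\<in>{0..}. Z v \<omega>))"
    unfolding process_law_def
  proof (rule distr_cong_AE)
    show "AE \<omega> in M. (\<lambda>t\<in>{0..}. V t \<omega>) = (lamperti_process \<beta> y \<circ> (\<lambda>\<omega>. \<lambda>v\<in>{0..}. Z v \<omega>)) \<omega>"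
      using eq by eventually_elim (auto simp: lamperti_process_def intro!: restrict_ext)
    show "(\<lambda>\<omega>. \<lambda>t\<in>{0..}. V t \<omega>) \<in> M \<rightarrow>\<^sub>M path_space"
      by (intro measurable_restrict V) auto
    show "lamperti_process \<beta> y \<circ> (\<lambda>\<omega>. \<lambda>v\<in>{0..}. Z v \<omega>) \<in> M \<rightarrow>\<^sub>M path_space"
      using R L by (rule measurable_comp)
  qed simp_all
  also have "\<dots> = distr (process_law M Z) path_space (lamperti_process \<beta> y)"
    unfolding process_law_def by (rule distr_distr[OF L R, symmetric])
  finally show ?thesis .
qed

theorem corollary2:
  fixes P :: "real \<Rightarrow> 'a measure"
    and X \<xi> :: "real \<Rightarrow> 'a \<Rightarrow> real"
    and \<alpha> c m :: real
  assumes alpha: "1 < \<alpha>" "\<alpha> \<le> 2"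
    and c: "0 < c" "\<alpha> = 2 \<longrightarrow> c = 1 / 2"
    and complete: "\<And>x. 0 \<le> x \<Longrightarrow> complete_measure (P x)"
    and X: "\<And>x. 0 \<le> x \<Longrightarrow> spectrally_positive_stable (P x) X x \<alpha> c"
    and xi: "lamperti_representation P (killed X) \<alpha> \<xi>"
    and xi_spectrally_positive: "\<And>x. 0 < x \<Longrightarrow> AE \<omega> in P x. no_negative_jumps (\<lambda>t. \<xi> t \<omega>)"
    and xi_drift: "\<And>x. 0 < x \<Longrightarrow> AE \<omega> in P x. filterlim (\<lambda>t. \<xi> t \<omega>) at_bot at_top"
    and m: "0 < m"
    and xi_mean: "\<And>x. 0 < x \<Longrightarrow> integrable (P x) (\<xi> 1) \<and> m = - (\<integral>\<omega>. \<xi> 1 \<omega> \<partial>P x)"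
    and xi_laplace: "\<And>x t q. 0 < x \<Longrightarrow> 0 \<le> t \<Longrightarrow> 0 \<le> q \<Longrightarrow>
          integrable (P x) (\<lambda>\<omega>. exp (- q * \<xi> t \<omega>)) \<and>
          (\<integral>\<omega>. exp (- q * \<xi> t \<omega>) \<partial>P x)
            = exp (t * (m * Gamma (q + \<alpha>) / (Gamma q * Gamma \<alpha>)))"
  shows "pssMp P (cb_process X) (\<alpha> - 1) \<and>
         lamperti_representation P (cb_process X) (\<alpha> - 1) \<xi> \<and>
         (\<forall>x>0. AE \<omega> in P x. \<forall>t\<ge>0.
            ennreal t \<le> ennreal (x powr (\<alpha> - 1)) * exp_functional (\<alpha> - 1) (\<lambda>u. \<xi> u \<omega>) {0..} \<longrightarrow>
            cb_process X t \<omega>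
              = x * exp_path_at (\<lambda>u. \<xi> u \<omega>)
                  (lamperti_clock (\<alpha> - 1) (\<lambda>u. \<xi> u \<omega>) (t * x powr (- (\<alpha> - 1)))))"
proof -
  define \<beta> where "\<beta> = \<alpha> - 1"
  have \<beta>: "0 < \<beta>" using alpha by (simp add: \<beta>_def)
  define Y where "Y = cb_process X"
  have X_levy: "levy_process (P x) X x" if "0 \<le> x" for x
    using X[OF that] by (simp add: spectrally_positive_stable_def)
  have prob: "prob_space (P x)" if "0 \<le> x" for x
    using levy_processD(1)[OF X_levy[OF that]] .
  have \<xi>_levy: "levy_process (P x) \<xi> 0" if "0 < x" for x
    using xi that unfolding lamperti_representation_def by blast
  have \<xi>_law: "process_law (P x) \<xi> = process_law (P 1) \<xi>" if "0 < x" for x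
    using xi that unfolding lamperti_representation_def by (metis zero_less_one)
  \<comment> \<open>No restriction to times before absorption is needed: afterwards both sides are
    0.\<close>
  have Y_pos: "AE \<omega> in P x. cadlag (\<lambda>v. \<xi> v \<omega>) \<and> (\<forall>t\<ge>0. Y t \<omega> = x * lamperti_path \<beta> (\<lambda>v. \<xi> v \<omega>) (t * x powr (- \<beta>)))"
    if x: "0 < x" for x
  proof -
    have rep: "AE \<omega> in P x. \<forall>t\<ge>0. ereal t \<le> hitting_time_zero (\<lambda>u. killed X u \<omega>) \<longrightarrow>
        killed X t \<omega> = x * exp_path_at (\<lambda>u. \<xi> u \<omega>) (lamperti_clock \<alpha> (\<lambda>u. \<xi> u \<omega>) (t * x powr (- \<alpha>)))"
      using xi x unfolding lamperti_representation_def by blast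
    show ?thesis
      using rep levy_processD(4)[OF \<xi>_levy[OF x]]
    proof eventually_elim
      case (elim \<omega>)
      then show ?case
        unfolding Y_def \<beta>_def by (intro conjI allI impI cb_process_lamperti[OF _ x]) auto
    qed
  qed
  have Y_zero: "AE \<omega> in P 0. \<forall>t\<ge>0. Y t \<omega> = 0"
    using levy_processD(3,4)[OF X_levy[OF order_refl]]
    by eventually_elim (simp add: Y_def cb_process_from_0)
  have Y_meas: "Y t \<in> borel_measurable (P x)" if x: "0 \<le> x" and t: "0 \<le> t" for x t
  proof -
    interpret complete_measure "P x" by (rule complete[OF x])
    show ?thesis
    proof (cases "x = 0")
      case True
      show ?thesis
        by (rule borel_measurable_AE_eq[where f="\<lambda>_. 0"]) (use Y_zero True t in auto)
    next
      case False
      with x have x': "0 < x" by simp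
      have "(\<lambda>\<omega>. \<lambda>v\<in>{0..}. \<xi> v \<omega>) \<in> P x \<rightarrow>\<^sub>M path_space"
        by (intro measurable_restrict levy_processD(2)[OF \<xi>_levy[OF x']]) auto
      from measurable_compose[OF this measurable_lamperti_path_at[of \<beta> "t * x powr (- \<beta>)"]]
      have m: "(\<lambda>\<omega>. x * lamperti_path \<beta> (\<lambda>v. \<xi> v \<omega>) (t * x powr (- \<beta>))) \<in> borel_measurable (P x)"
        by simp
      show ?thesis
      proof (rule borel_measurable_AE_eq[OF m])
        show "AE \<omega> in P x. Y t \<omega> = x * lamperti_path \<beta> (\<lambda>v. \<xi> v \<omega>) (t * x powr (- \<beta>))"
          using Y_pos[OF x'] by eventually_elim (use t in simp)
      qed
    qed
  qed
  define \<mu> where "\<mu> = process_law (P 1) \<xi>"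
  have \<mu>_sets: "sets \<mu> = sets path_space" by (simp add: \<mu>_def process_law_def)
  have \<mu>_prob: "prob_space \<mu>"
    unfolding \<mu>_def process_law_def
    by (intro prob_space.prob_space_distr prob measurable_restrict levy_processD(2)[OF \<xi>_levy]) auto
  \<comment> \<open>The transition probabilities of the family all come from the single law \<mu>,
    also at y = 0. This gives their measurability in y and matches them with the conditional
    probabilities of \<open>lamperti_markov\<close>.\<close>
  have kernel: "measure (P y) {\<omega> \<in> space (P y). Y s \<omega> \<in> B} = lamperti_kernel \<mu> \<beta> s B y"
    if y: "0 \<le> y" and s: "0 \<le> s" and B[measurable]: "B \<in> sets borel" for y s B
  proof -
    interpret prob_space "P y" by (rule prob[OF y])
    have [measurable]: "Y s \<in> borel_measurable (P y)" by (rule Y_meas[OF y s])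
    have "measure (P y) {\<omega> \<in> space (P y). Y s \<omega> \<in> B} =
        (\<integral>\<omega>. indicator {\<omega> \<in> space (P y). Y s \<omega> \<in> B} \<omega> \<partial>P y)"
      unfolding Bochner_Integration.integral_indicator by (rule arg_cong[where f="measure (P y)"]) auto
    also have "\<dots> = (\<integral>\<omega>. indicator B (Y s \<omega>) \<partial>P y)"
      by (rule Bochner_Integration.integral_cong) (auto simp: indicator_def)
    also have "\<dots> = lamperti_kernel \<mu> \<beta> s B y"
    proof (cases "y = 0")
      case True
      have "(\<integral>\<omega>. indicat_real B (Y s \<omega>) \<partial>P y) = (\<integral>\<omega>. indicator B 0 \<partial>P y)"
      proof (rule integral_cong_AE)
        show "AE \<omega> in P y. indicat_real B (Y s \<omega>) = indicator B 0"
          using Y_zero unfolding True by eventually_elim (use s in simp)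
      qed measurable
      also have "\<dots> = indicator B 0" by (simp add: prob_space)
      finally show ?thesis using True by (simp add: lamperti_kernel_def)
    next
      case False
      with y have y': "0 < y" by simp
      have R: "(\<lambda>\<omega>. \<lambda>v\<in>{0..}. \<xi> v \<omega>) \<in> P y \<rightarrow>\<^sub>M path_space"
        by (intro measurable_restrict levy_processD(2)[OF \<xi>_levy[OF y']]) auto
      have [measurable]: "(\<lambda>w. lamperti_path \<beta> w (s * y powr (- \<beta>))) \<in> borel_measurable path_space"
        by (rule measurable_lamperti_path_at)
      have "(\<integral>\<omega>. indicat_real B (Y s \<omega>) \<partial>P y) =
          (\<integral>\<omega>. indicator B (y * lamperti_path \<beta> (\<lambda>v\<in>{0..}. \<xi> v \<omega>) (s * y powr (- \<beta>))) \<partial>P y)"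
      proof (rule integral_cong_AE)
        show "(\<lambda>\<omega>. indicat_real B (y * lamperti_path \<beta> (\<lambda>v\<in>{0..}. \<xi> v \<omega>) (s * y powr (- \<beta>))))
            \<in> borel_measurable (P y)"
          by (rule measurable_compose[OF R]) measurable
        show "AE \<omega> in P y. indicat_real B (Y s \<omega>) =
            indicator B (y * lamperti_path \<beta> (\<lambda>v\<in>{0..}. \<xi> v \<omega>) (s * y powr (- \<beta>)))"
          using Y_pos[OF y'] by eventually_elim (use s in simp)
      qed measurable
      also have "\<dots> = (\<integral>w. indicator B (y * lamperti_path \<beta> w (s * y powr (- \<beta>))) \<partial>process_law (P y) \<xi>)"
        unfolding process_law_def by (rule integral_distr[OF R, symmetric]) measurable
      finally show ?thesis
        using y' by (simp add: lamperti_kernel_def \<mu>_def \<xi>_law[OF y'])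
    qed
    finally show ?thesis .
  qed
  have markov: "AE \<omega> in P x. real_cond_exp (P x) (history (P x) Y t) (\<lambda>\<omega>'. indicator B (Y (t + s) \<omega>')) \<omega>
      = measure (P (Y t \<omega>)) {\<omega>' \<in> space (P (Y t \<omega>)). Y s \<omega>' \<in> B}"
    if x: "0 \<le> x" and s: "0 \<le> s" and t: "0 \<le> t" and B[measurable]: "B \<in> sets borel" for x s t B
  proof (cases "x = 0")
    case True
    interpret prob_space "P x" by (rule prob[OF x])
    have "finite_measure_subalgebra (P x) (history (P x) Y t)"
      by (intro finite_measure_subalgebra.intro finite_measure_subalgebra_axioms.intro
          finite_measure_axioms history_subalgebra Y_meas[OF x])
    then interpret sub: finite_measure_subalgebra "P x" "history (P x) Y t" .
    have [measurable]: "Y (t + s) \<in> borel_measurable (P x)" using Y_meas[OF x] s t by simp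
    have "AE \<omega> in P x. real_cond_exp (P x) (history (P x) Y t) (\<lambda>\<omega>'. indicator B (Y (t + s) \<omega>')) \<omega> =
        real_cond_exp (P x) (history (P x) Y t) (\<lambda>_. indicator B 0) \<omega>"
    proof (rule sub.real_cond_exp_cong)
      show "AE \<omega> in P x. indicat_real B (Y (t + s) \<omega>) = indicator B 0"
        using Y_zero unfolding True by eventually_elim (use s t in simp)
    qed measurable
    moreover have "AE \<omega> in P x. real_cond_exp (P x) (history (P x) Y t) (\<lambda>_. indicator B 0) \<omega> = indicator B 0"
      by (rule sub.real_cond_exp_F_meas) auto
    moreover have "AE \<omega> in P x. Y t \<omega> = 0"
      using Y_zero True t by (auto elim!: eventually_mono)
    ultimately show ?thesis
    proof eventually_elim
      case (elim \<omega>)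
      show ?case
        unfolding elim using kernel[OF order_refl s B] by (simp add: lamperti_kernel_def)
    qed
  next
    case False
    with x have x': "0 < x" by simp
    have "AE \<omega> in P x. real_cond_exp (P x) (history (P x) Y t) (\<lambda>\<omega>'. indicator B (Y (t + s) \<omega>')) \<omega> =
        lamperti_kernel (process_law (P x) \<xi>) \<beta> s B (Y t \<omega>)"
    proof (rule lamperti_markov[OF \<xi>_levy[OF x'] x' t s B])
      show "AE \<omega> in P x. \<forall>u\<ge>0. Y u \<omega> = x * lamperti_path \<beta> (\<lambda>v. \<xi> v \<omega>) (u * x powr (- \<beta>))"
        using Y_pos[OF x'] by eventually_elim simp
    qed (rule Y_meas[OF x])
    then show ?thesis
      using Y_pos[OF x']
    proof eventually_elim
      case (elim \<omega>)
      have "0 \<le> Y t \<omega>" using elim(2) t x by (simp add: lamperti_path_nonneg)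
      then show ?case
        unfolding elim(1) using kernel[OF _ s B] by (simp add: \<mu>_def \<xi>_law[OF x'])
    qed
  qed
  have start: "AE \<omega> in P x. Y 0 \<omega> = x" if x: "0 \<le> x" for x
  proof (cases "x = 0")
    case True
    then show ?thesis using Y_zero by (auto elim!: eventually_mono)
  next
    case False
    with x have x': "0 < x" by simp
    show ?thesis
      using Y_pos[OF x'] levy_processD(3)[OF \<xi>_levy[OF x']]
    proof eventually_elim
      case (elim \<omega>)
      then show ?case
        using lamperti_path_clock_integral[of "\<lambda>v. \<xi> v \<omega>" 0 \<beta>] by simp
    qed
  qed
  have nonneg: "AE \<omega> in P x. \<forall>t\<ge>0. Y t \<omega> \<in> {0..}" if x: "0 \<le> x" for x
  proof (cases "x = 0")
    case True
    then show ?thesis using Y_zero by (auto elim!: eventually_mono)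
  next
    case False
    with x have "0 < x" by simp
    from Y_pos[OF this] show ?thesis
      by eventually_elim (use x in \<open>simp add: lamperti_path_nonneg\<close>)
  qed
  have family: "markov_family {0..} P Y"
    unfolding markov_family_def
  proof (intro conjI ballI allI impI)
    fix t :: real and B :: "real set" assume t: "0 \<le> t" and B: "B \<in> sets borel"
    have "lamperti_kernel \<mu> \<beta> t B \<in> borel_measurable (restrict_space borel {0..})"
      by (rule measurable_restrict_space1[OF measurable_lamperti_kernel[OF \<mu>_prob \<mu>_sets B]])
    then show "(\<lambda>x. measure (P x) {\<omega> \<in> space (P x). Y t \<omega> \<in> B}) \<in> borel_measurable (restrict_space borel {0..})"
      by (rule measurable_cong[THEN iffD1, rotated]) (simp add: space_restrict_space kernel t B)
  next
    fix x :: real assume "x \<in> {0..}"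
    then have x: "0 \<le> x" by simp
    show "prob_space (P x)" by (rule prob[OF x])
    show "Y t \<in> borel_measurable (P x)" if "0 \<le> t" for t by (rule Y_meas[OF x that])
    show "AE \<omega> in P x. Y 0 \<omega> = x" by (rule start[OF x])
    show "AE \<omega> in P x. \<forall>t\<ge>0. Y t \<omega> \<in> {0..}" by (rule nonneg[OF x])
    show "AE \<omega> in P x. real_cond_exp (P x) (history (P x) Y t) (\<lambda>\<omega>'. indicator B (Y (t + s) \<omega>')) \<omega>
        = measure (P (Y t \<omega>)) {\<omega>' \<in> space (P (Y t \<omega>)). Y s \<omega>' \<in> B}"
      if "0 \<le> s" "0 \<le> t" "B \<in> sets borel" for s t B
      by (rule markov[OF x that])
  qed
  \<comment> \<open>The left limit at absorption comes from the drift of \<xi>.\<close>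
  have cadlag: "AE \<omega> in P x. cadlag (\<lambda>t. Y t \<omega>)" if x: "0 \<le> x" for x
  proof (cases "x = 0")
    case True
    have zero: "cadlag (\<lambda>_. 0)" unfolding cadlag_def by auto
    show ?thesis
      using Y_zero unfolding True
    proof eventually_elim
      case (elim \<omega>)
      then have "cadlag (\<lambda>t. Y t \<omega>) \<longleftrightarrow> cadlag (\<lambda>_. 0)" by (intro cadlag_cong) simp
      with zero show ?case by simp
    qed
  next
    case False
    with x have x': "0 < x" by simp
    show ?thesis
      using Y_pos[OF x'] xi_drift[OF x']
    proof eventually_elim
      case (elim \<omega>)
      have "cadlag (\<lambda>t. x * lamperti_path \<beta> (\<lambda>v. \<xi> v \<omega>) (x powr (- \<beta>) * t))"
        using elim x' by (intro cadlag_scale cadlag_lamperti_path) auto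
      then show ?case
        by (subst cadlag_cong) (use elim in \<open>auto simp: mult.commute\<close>)
    qed
  qed
  have scaling: "process_law (P x) (\<lambda>t \<omega>. k * Y (k powr (- \<beta>) * t) \<omega>) = process_law (P (k * x)) Y"
    if k: "0 < k" and x: "0 \<le> x" for k x
  proof (cases "x = 0")
    case True
    have "AE \<omega> in P 0. (\<lambda>t\<in>{0..}. k * Y (k powr (- \<beta>) * t) \<omega>) = (\<lambda>t\<in>{0..}. Y t \<omega>)"
      using Y_zero by eventually_elim (auto simp: restrict_def fun_eq_iff)
    then show ?thesis
      unfolding process_law_def using True
      by (intro distr_cong_AE measurable_restrict borel_measurable_times borel_measurable_const Y_meas) auto
  next
    case False
    with x have x': "0 < x" by simp
    then have kx: "0 < k * x" using k by simp
    have "process_law (P x) (\<lambda>t \<omega>. k * Y (k powr (- \<beta>) * t) \<omega>) =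
        distr (process_law (P x) \<xi>) path_space (lamperti_process \<beta> (k * x))"
    proof (rule process_law_lamperti)
      show "(\<lambda>\<omega>. k * Y (k powr (- \<beta>) * t) \<omega>) \<in> borel_measurable (P x)" if "0 \<le> t" for t
        using that x by (intro borel_measurable_times borel_measurable_const Y_meas) auto
      show "AE \<omega> in P x. \<forall>t\<ge>0. k * Y (k powr (- \<beta>) * t) \<omega> =
          k * x * lamperti_path \<beta> (\<lambda>v. \<xi> v \<omega>) (t * (k * x) powr (- \<beta>))"
        using Y_pos[OF x'] by eventually_elim (use k x in \<open>auto simp: powr_mult ac_simps\<close>)
    qed (rule levy_processD(2)[OF \<xi>_levy[OF x']])
    \<comment> \<open>Both processes are now the same functional of \<xi>, started from
      \<open>k * x\<close>; self-similarity reduces to \<xi> having one law under all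
      starts.\<close>
    also have "\<dots> = distr (process_law (P (k * x)) \<xi>) path_space (lamperti_process \<beta> (k * x))"
      by (simp only: \<xi>_law[OF x'] \<xi>_law[OF kx])
    also have "\<dots> = process_law (P (k * x)) Y"
    proof (rule process_law_lamperti[symmetric])
      show "AE \<omega> in P (k * x). \<forall>t\<ge>0. Y t \<omega> =
          k * x * lamperti_path \<beta> (\<lambda>v. \<xi> v \<omega>) (t * (k * x) powr (- \<beta>))"
        using Y_pos[OF kx] by eventually_elim simp
    qed (use Y_meas kx levy_processD(2)[OF \<xi>_levy[OF kx]] in auto)
    finally show ?thesis .
  qed
  \<comment> \<open>Valid at every t, hence stronger than both the representation up to the hitting
    time of 0 and the one up to the total clock.\<close>
  have rep: "AE \<omega> in P x. \<forall>t\<ge>0. Y t \<omega> =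
      x * exp_path_at (\<lambda>u. \<xi> u \<omega>) (lamperti_clock \<beta> (\<lambda>u. \<xi> u \<omega>) (t * x powr (- \<beta>)))"
    if x: "0 < x" for x
    using Y_pos[OF x] by eventually_elim (simp add: lamperti_path_eq)
  have "pssMp P Y \<beta>"
    unfolding pssMp_def by (intro conjI allI impI \<beta> family cadlag scaling)
  moreover have "lamperti_representation P Y \<beta> \<xi>"
    unfolding lamperti_representation_def
  proof (intro conjI allI impI)
    fix x y :: real assume "0 < x" "0 < y"
    then show "process_law (P x) \<xi> = process_law (P y) \<xi>"
      using \<xi>_law[of x] \<xi>_law[of y] by simp
  next
    fix x :: real assume "0 < x"
    from rep[OF this] show "AE \<omega> in P x. \<forall>t\<ge>0. ereal t \<le> hitting_time_zero (\<lambda>u. Y u \<omega>) \<longrightarrow>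
        Y t \<omega> = x * exp_path_at (\<lambda>u. \<xi> u \<omega>) (lamperti_clock \<beta> (\<lambda>u. \<xi> u \<omega>) (t * x powr (- \<beta>)))"
      by eventually_elim simp
  qed (rule \<xi>_levy)
  moreover have "\<forall>x>0. AE \<omega> in P x. \<forall>t\<ge>0.
      ennreal t \<le> ennreal (x powr \<beta>) * exp_functional \<beta> (\<lambda>u. \<xi> u \<omega>) {0..} \<longrightarrow>
      Y t \<omega> = x * exp_path_at (\<lambda>u. \<xi> u \<omega>) (lamperti_clock \<beta> (\<lambda>u. \<xi> u \<omega>) (t * x powr (- \<beta>)))"
  proof (intro allI impI)
    fix x :: real assume "0 < x"
    from rep[OF this] show "AE \<omega> in P x. \<forall>t\<ge>0.
        ennreal t \<le> ennreal (x powr \<beta>) * exp_functional \<beta> (\<lambda>u. \<xi> u \<omega>) {0..} \<longrightarrow>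
        Y t \<omega> = x * exp_path_at (\<lambda>u. \<xi> u \<omega>) (lamperti_clock \<beta> (\<lambda>u. \<xi> u \<omega>) (t * x powr (- \<beta>)))"
      by eventually_elim simp
  qed
  ultimately show ?thesis unfolding Y_def \<beta>_def by blast
qed

end
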